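(* Let $D\subset\mathbb{R}^n$, $n\geqslant 2$, be a domain, let $Q:\mathbb{R}^n\to[0,\infty]$ be a Lebesgue measurable function with $Q\in L^1_{\rm loc}(\mathbb{R}^n)$, and let $\mathfrak{R}_Q(D)$ be some family of open discrete mappings $f:D\to\mathbb{R}^n$ each of which satisfies the inverse Poletsky inequality with majorant $Q$ at every (finite) point of $\mathbb{R}^n$. Let $x_0\in D$. Assume that there exist a point $y_0\in C(x_0,\mathfrak{R}_Q(D))$, $y_0\neq\infty$, a number $r_0>0$ and a sequence $y_m\in B(y_0,r_0)$, $y_m\ne y_0$, $y_m\to y_0$ as $m\to\infty$, such that for every $m\in\mathbb{N}$ there exists $C_m>0$ with $d(x_0,A_m)\geqslant C_m$, where $$A_m:=\{x\in D:\ \exists\, f\in\mathfrak{R}_Q(D):\ f(x)=y_m\}.$$ Then the family $\mathfrak{R}_Q(D)$ is equicontinuous at $x_0$ (as a family of mappings into $(\overline{\mathbb{R}^n},h)$).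
   Context: A domain is a nonempty connected open set. $B(y_0,r)=\{y\in\mathbb{R}^n:|y-y_0|<r\}$, $S(y_0,r)=\{y\in\mathbb{R}^n:|y-y_0|=r\}$, $A(y_0,r_1,r_2)=\{y\in\mathbb{R}^n:r_1<|y-y_0|<r_2\}$, $m$ (in integrals) is Lebesgue measure in $\mathbb{R}^n$, $\overline{\mathbb{R}^n}=\mathbb{R}^n\cup\{\infty\}$, and $d(x_0,A)$ is the Euclidean distance from a point to a set, with $d(x_0,\varnothing)=+\infty$. A mapping $f:D\to\mathbb{R}^n$ is discrete if $f^{-1}(y)$ consists of isolated points for each $y\in\mathbb{R}^n$; it is open if the image of every open subset of $D$ is open in $\mathbb{R}^n$. Mappings are continuous. For a family $\mathfrak{F}$ of mappings $f:D\to\mathbb{R}^n$ and $x_0 \in D$, $$C(x_0,\mathfrak{F}):=\{y\in\overline{\mathbb{R}^n}:\ \exists\,x_k\in D,\ f_k\in\mathfrak{F}:\ x_k\to x_0,\ f_k(x_k)\to y,\ k\to\infty\}.$$ Modulus. A Borel function $\rho:\mathbb{R}^n\to[0,\infty]$ is admissible for a family $\Gamma$ of paths in $\mathbb{R}^n$ ($\rho\in\mathrm{adm}\,\Gamma$) if $\int_\gamma\rho(x)\,|dx|\geqslant1$ for all locally rectifiable $\gamma\in\Gamma$. The ($n$-)modulus of $\Gamma$ is $M(\Gamma)=\inf_{\rho\in\mathrm{adm}\,\Gamma}\int_{\mathbb{R}^n}\rho^n(x)\,dm(x)$. Path families. For $E,F\subset\overline{\mathbb{R}^n}$ and a domain $G\subset\mathbb{R}^n$,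 $\Gamma(E,F,G)$ is the family of all paths $\gamma:[a,b]\to\overline{\mathbb{R}^n}$ with $\gamma(a)\in E$, $\gamma(b)\in F$ and $\gamma(t)\in G$ for $t\in(a,b)$. The family $\Gamma_f(y_0,r_1,r_2)$ consists of all paths $\gamma$ in $D$ such that $f(\gamma)\in\Gamma(S(y_0,r_1),S(y_0,r_2),A(y_0,r_1,r_2))$. Inverse Poletsky inequality. $f$ satisfies the inverse Poletsky inequality with majorant $Q$ at $y_0$ if there is $r_0=r_0(y_0)>0$, $r_0<d_0=\sup_{y\in f(D)}|y-y_0|$, such that $$M(\Gamma_f(y_0,r_1,r_2))\leqslant\int_{f(D)\cap A(y_0,r_1,r_2)}Q(y)\,\eta^n(|y-y_0|)\,dm(y)$$ for any $0<r_1<r_2<r_0$ and any Lebesgue measurable function $\eta:(r_1,r_2)\to[0,\infty]$ with $\int_{r_1}^{r_2}\eta(r)\,dr\geqslant1$. Chordal metric: $h(x,\infty)=\frac{1}{\sqrt{1+|x|^2}}$ and $h(x,y)=\frac{|x-y|}{\sqrt{1+|x|^2}\sqrt{1+|y|^2}}$ for $x\ne\infty\ne y$. A family $\mathfrak{F}$ of mappings $f:D\to\overline{\mathbb{R}^n}$ is equicontinuous at $x_0\in D$ if for every $\varepsilon>0$ there is $\delta>0$ such that $h(f(x),f(x_0))<\varepsilon$ for all $f\in\mathfrak{F}$ and all $x\in D$ with $|x-x_0|<\delta$. *)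

theory Defs
  imports "HOL-Analysis.Analysis"
begin

section \<open>Modulus of path families\<close>

text \<open>
  Paths over a compact parameter interval are normalised to the library's interval \<open>{0..1}\<close>; an
  affine change of parameter does not affect line integrals, hence not the modulus either.
  On a compact parameter interval "locally rectifiable" means "rectifiable".
\<close>

definition arc_length :: "(real \<Rightarrow> real ^ 'n) \<Rightarrow> real \<Rightarrow> ennreal" where
  "arc_length \<gamma> t =
     (SUP ts \<in> {ts. sorted ts \<and> set ts \<subseteq> {0..t}}.
        \<Sum>i<length ts - 1. ennreal (dist (\<gamma> (ts ! i)) (\<gamma> (ts ! Suc i))))"

definition rectifiable :: "(real \<Rightarrow> real ^ 'n) \<Rightarrow> bool" where
  "rectifiable \<gamma> \<longleftrightarrow> path \<gamma> \<and> arc_length \<gamma> 1 < \<infinity>"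

text \<open>
  Parametrisation of a rectifiable path by arc length. The path is constant on each level set of
  its length function, so the choice of \<open>t\<close> is immaterial.
\<close>

definition normal_representation :: "(real \<Rightarrow> real ^ 'n) \<Rightarrow> real \<Rightarrow> real ^ 'n" where
  "normal_representation \<gamma> s = \<gamma> (SOME t. t \<in> {0..1} \<and> arc_length \<gamma> t = ennreal s)"

definition line_integral :: "(real \<Rightarrow> real ^ 'n) \<Rightarrow> (real ^ 'n \<Rightarrow> ennreal) \<Rightarrow> ennreal" where
  "line_integral \<gamma> \<rho> =
     (\<integral>\<^sup>+ s \<in> {0..enn2real (arc_length \<gamma> 1)}. \<rho> (normal_representation \<gamma> s) \<partial>lebesgue)"

definition adm :: "(real \<Rightarrow> real ^ 'n) set \<Rightarrow> (real ^ 'n \<Rightarrow> ennreal) set" where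
  "adm \<Gamma> = {\<rho> \<in> borel_measurable borel. \<forall>\<gamma>\<in>\<Gamma>. rectifiable \<gamma> \<longrightarrow> 1 \<le> line_integral \<gamma> \<rho>}"

definition modulus :: "(real \<Rightarrow> real ^ 'n) set \<Rightarrow> ennreal" where
  "modulus \<Gamma> = (INF \<rho> \<in> adm \<Gamma>. \<integral>\<^sup>+ x. \<rho> x ^ CARD('n) \<partial>lebesgue)"


section \<open>The inverse Poletsky inequality\<close>

definition annulus :: "real ^ 'n \<Rightarrow> real \<Rightarrow> real \<Rightarrow> (real ^ 'n) set" where
  "annulus y0 r1 r2 = {y. r1 < dist y y0 \<and> dist y y0 < r2}"

text \<open>
  Only finite \<open>E\<close>, \<open>F\<close>, \<open>G\<close> are needed, and then the paths do not meet the point at infinity.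
\<close>

definition joining_paths ::
    "(real ^ 'n) set \<Rightarrow> (real ^ 'n) set \<Rightarrow> (real ^ 'n) set \<Rightarrow> (real \<Rightarrow> real ^ 'n) set" where
  "joining_paths E F G =
     {\<gamma>. path \<gamma> \<and> pathstart \<gamma> \<in> E \<and> pathfinish \<gamma> \<in> F \<and> (\<forall>t\<in>{0<..<1}. \<gamma> t \<in> G)}"

definition ring_preimage_paths ::
    "(real ^ 'n) set \<Rightarrow> (real ^ 'n \<Rightarrow> real ^ 'n) \<Rightarrow> real ^ 'n \<Rightarrow> real \<Rightarrow> real
      \<Rightarrow> (real \<Rightarrow> real ^ 'n) set" where
  "ring_preimage_paths D f y0 r1 r2 =
     {\<gamma>. path \<gamma> \<and> path_image \<gamma> \<subseteq> D \<and>
         f \<circ> \<gamma> \<in> joining_paths (sphere y0 r1) (sphere y0 r2) (annulus y0 r1 r2)}"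

text \<open>The supremum in the condition on \<open>r0\<close> may be infinite.\<close>

definition inverse_Poletsky ::
    "(real ^ 'n) set \<Rightarrow> (real ^ 'n \<Rightarrow> ennreal) \<Rightarrow> (real ^ 'n \<Rightarrow> real ^ 'n) \<Rightarrow> real ^ 'n \<Rightarrow> bool" where
  "inverse_Poletsky D Q f y0 \<longleftrightarrow>
     (\<exists>r0>0. ennreal r0 < (SUP y \<in> f ` D. ennreal (dist y y0)) \<and>
       (\<forall>r1 r2 \<eta>. 0 < r1 \<and> r1 < r2 \<and> r2 < r0 \<and>
          \<eta> \<in> borel_measurable (lebesgue_on {r1<..<r2}) \<and>
          1 \<le> (\<integral>\<^sup>+ r. \<eta> r \<partial>lebesgue_on {r1<..<r2}) \<longrightarrow>
          modulus (ring_preimage_paths D f y0 r1 r2)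
            \<le> (\<integral>\<^sup>+ y \<in> f ` D \<inter> annulus y0 r1 r2. Q y * \<eta> (dist y y0) ^ CARD('n) \<partial>lebesgue)))"


section \<open>Mappings\<close>

definition open_discrete_mapping :: "(real ^ 'n) set \<Rightarrow> (real ^ 'n \<Rightarrow> real ^ 'n) \<Rightarrow> bool" where
  "open_discrete_mapping D f \<longleftrightarrow>
     continuous_on D f \<and> open_map (top_of_set D) euclidean f \<and> (\<forall>y. discrete {x \<in> D. f x = y})"


section \<open>The extended space\<close>

text \<open>The point at infinity is \<^const>\<open>None\<close>.\<close>

fun chordal_dist :: "(real ^ 'n) option \<Rightarrow> (real ^ 'n) option \<Rightarrow> real" where
  "chordal_dist (Some x) (Some y) =
     norm (x - y) / (sqrt (1 + (norm x)\<^sup>2) * sqrt (1 + (norm y)\<^sup>2))"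
| "chordal_dist (Some x) None = 1 / sqrt (1 + (norm x)\<^sup>2)"
| "chordal_dist None (Some y) = 1 / sqrt (1 + (norm y)\<^sup>2)"
| "chordal_dist None None = 0"

definition limit_set ::
    "(real ^ 'n) set \<Rightarrow> real ^ 'n \<Rightarrow> (real ^ 'n \<Rightarrow> real ^ 'n) set \<Rightarrow> (real ^ 'n) option set" where
  "limit_set D x0 \<FF> =
     {y. \<exists>x f. (\<forall>k::nat. x k \<in> D \<and> f k \<in> \<FF>) \<and> x \<longlonglongrightarrow> x0 \<and>
           (\<lambda>k. chordal_dist (Some (f k (x k))) y) \<longlonglongrightarrow> 0}"

definition equicontinuous_at ::
    "(real ^ 'n) set \<Rightarrow> real ^ 'n \<Rightarrow> (real ^ 'n \<Rightarrow> (real ^ 'n) option) set \<Rightarrow> bool" where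
  "equicontinuous_at D x0 \<FF> \<longleftrightarrow>
     (\<forall>\<epsilon>>0. \<exists>\<delta>>0. \<forall>f\<in>\<FF>. \<forall>x\<in>D. dist x x0 < \<delta> \<longrightarrow> chordal_dist (f x) (f x0) < \<epsilon>)"

text \<open>
  Unlike \<^const>\<open>infdist\<close> and \<^const>\<open>setdist\<close>, this distance to the empty set is infinite.
\<close>

definition ext_dist :: "real ^ 'n \<Rightarrow> (real ^ 'n) set \<Rightarrow> ennreal" where
  "ext_dist x A = (INF a \<in> A. ennreal (dist x a))"

end

theory Submission
  imports Defs
begin

text \<open>
  Let \<open>y1 = y 0\<close>, a value omitted near \<open>x0\<close>. If \<open>f a\<close> and \<open>f b\<close> are chordally far apart for \<open>a\<close>, \<open>b\<close>
  close to \<open>x0\<close>, with \<open>f a\<close> not farther from \<open>y1\<close> than \<open>f b\<close>, then the preimage components of the segment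
  from \<open>f a\<close> to \<open>y1\<close> and of the ray from \<open>f b\<close> away from \<open>y1\<close> both reach from near \<open>x0\<close> to a fixed distance,
  because \<open>f\<close> is open and omits \<open>y1\<close> and infinity there. The modulus of the curves joining these
  continua is therefore logarithmically large (Morrey's inequality on the faces of concentric cubes).
  On the other hand their images have length bounded below near a bounded set, and the ring
  inequalities bound the modulus of such curves by the integral of \<open>Q\<close>. Since the radius \<open>r0\<close> of the inverse
  Poletsky inequality depends on \<open>f\<close> and on the centre, this bound is assembled from small rings by
  coverings, with a constant independent of \<open>f\<close>.
\<close>

section \<open>Line integrals along Lipschitz curves\<close>

text \<open>The inverse Poletsky inequality enters only on rings with radii \<open>r\<close> and
  \<open>2 * r\<close>, with \<open>\<eta>\<close> constantly \<open>1 / r\<close>. The modulus is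
  then bounded by \<open>1 / r ^ n\<close> times an integral over the ball, so a density multiplied
  by the size of its ring has energy bounded by that integral alone. This scale invariance is what
  lets rings of unrelated, arbitrarily small radii be combined. The obstacle in combining them is
  that one curve may run through centres whose admissible radii differ wildly, so that no family of
  equal rings sees enough of its image. Crossing counts of different families cannot be compared.
  The measure of the image under a real 1-Lipschitz function can, being subadditive over regions of
  the target. The lower bound is taken over cubes instead of spheres because a face is flat:
  segments between its points stay in it, and contraction towards one of its points is
  affine.\<close>

definition poly_length :: "(real \<Rightarrow> real ^ 'n) \<Rightarrow> real list \<Rightarrow> real" where
  "poly_length \<gamma> ts = (\<Sum>i<length ts - 1. dist (\<gamma> (ts ! i)) (\<gamma> (ts ! Suc i)))"

lemma poly_length_snoc:
  "poly_length \<gamma> (ts @ [x]) =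
     poly_length \<gamma> ts + (if ts = [] then 0 else dist (\<gamma> (last ts)) (\<gamma> x))"
proof (cases ts rule: rev_cases)
  case Nil
  then show ?thesis by (simp add: poly_length_def)
next
  case (snoc us y)
  then show ?thesis
    by (auto simp: poly_length_def nth_append intro!: sum.cong)
qed

lemma arc_length_eq_SUP:
  "arc_length \<gamma> t = (SUP ts \<in> {ts. sorted ts \<and> set ts \<subseteq> {0..t}}. ennreal (poly_length \<gamma> ts))"
  unfolding arc_length_def poly_length_def by (simp add: sum_ennreal)

lemma poly_length_le_arc_length:
  "sorted ts \<Longrightarrow> set ts \<subseteq> {0..t} \<Longrightarrow> ennreal (poly_length \<gamma> ts) \<le> arc_length \<gamma> t"
  unfolding arc_length_eq_SUP by (rule SUP_upper) auto

lemma poly_length_nonneg: "0 \<le> poly_length \<gamma> ts"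
  unfolding poly_length_def by (simp add: sum_nonneg)

text \<open>The points up to \<open>s\<close>, together with \<open>s\<close> itself, contribute at
  most \<open>A\<close>; the rest is Lipschitz. The \<open>max\<close> is there because the
  induction also passes through lists that end before \<open>s\<close>.\<close>

lemma poly_length_le_lipschitz:
  assumes "L-lipschitz_on {0..1} \<gamma>" "0 \<le> s" "sorted ts" "set ts \<subseteq> {0..t}" "t \<le> 1" "s \<le> t"
    "arc_length \<gamma> s = ennreal A" "0 \<le> A"
  shows "poly_length \<gamma> ts \<le> A + L * max 0 (if ts = [] then 0 else last ts - s)"
  using assms(3,4)
proof (induction ts rule: rev_induct)
  case Nil
  then show ?case using assms by (simp add: poly_length_def)
next
  case (snoc x ts)
  have L: "0 \<le> L" using assms(1) lipschitz_on_nonneg by blast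
  have lip: "dist (\<gamma> a) (\<gamma> b) \<le> L * \<bar>a - b\<bar>" if "a \<in> {0..1}" "b \<in> {0..1}" for a b
    using lipschitz_onD[OF assms(1) that] by (simp add: dist_real_def)
  have low: "poly_length \<gamma> us \<le> A" if "sorted us" "set us \<subseteq> {0..s}" for us
    using poly_length_le_arc_length[OF that, of \<gamma>] assms(7,8) by simp
  have srt: "sorted ts" "\<And>z. z \<in> set ts \<Longrightarrow> z \<le> x" "x \<in> {0..t}" "set ts \<subseteq> {0..t}"
    using snoc.prems by (auto simp: sorted_append)
  show ?case
  proof (cases "x \<le> s")
    case True
    have "set (ts @ [x]) \<subseteq> {0..s}"
      using snoc.prems True srt by force
    then show ?thesis using low[OF snoc.prems(1)] True L by simp
  next
    case xs: False
    show ?thesis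
    proof (cases "ts = []")
      case True
      then show ?thesis using assms(8) L xs by (simp add: poly_length_def)
    next
      case False
      define y where "y = last ts"
      have "y \<in> set ts" using last_in_set[OF False] by (simp add: y_def)
      then have y: "y \<in> set ts" "y \<le> x" "0 \<le> y" "y \<le> t" using srt by auto
      show ?thesis
      proof (cases "s \<le> y")
        case True
        have "poly_length \<gamma> ts \<le> A + L * (y - s)"
          using snoc.IH srt True False by (simp add: y_def)
        moreover have "dist (\<gamma> y) (\<gamma> x) \<le> L * (x - y)"
          using lip[of y x] y srt assms(5) by simp
        ultimately have "poly_length \<gamma> ts + dist (\<gamma> y) (\<gamma> x) \<le> A + L * (x - s)"
          by (simp add: algebra_simps)
        then show ?thesis using False xs by (simp add: poly_length_snoc y_def)
      next
        case ys: False
        have "z \<le> y" if "z \<in> set ts" for z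
          using that srt(1) unfolding y_def by (cases ts rule: rev_cases) (auto simp: sorted_append)
        \<comment> \<open>The step from \<open>y\<close> to \<open>x\<close> jumps over
          \<open>s\<close>; inserting \<open>s\<close> splits it.\<close>
        then have "set (ts @ [s]) \<subseteq> {0..s}" "sorted (ts @ [s])"
          using ys srt assms(2) by (force simp: sorted_append)+
        from low[OF this(2,1)] have "poly_length \<gamma> ts + dist (\<gamma> y) (\<gamma> s) \<le> A"
          using False by (simp add: poly_length_snoc y_def)
        moreover have "dist (\<gamma> s) (\<gamma> x) \<le> L * (x - s)"
          using lip[of s x] xs srt assms by simp
        moreover have "dist (\<gamma> y) (\<gamma> x) \<le> dist (\<gamma> y) (\<gamma> s) + dist (\<gamma> s) (\<gamma> x)"
          by (rule dist_triangle)
        ultimately have "poly_length \<gamma> ts + dist (\<gamma> y) (\<gamma> x) \<le> A + L * (x - s)" by linarith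
        then show ?thesis using False xs by (simp add: poly_length_snoc y_def)
      qed
    qed
  qed
qed

lemma arc_length_0: "arc_length \<gamma> 0 = 0"
proof -
  have "poly_length \<gamma> ts = 0" if "set ts \<subseteq> {0..0}" for ts
    unfolding poly_length_def
  proof (rule sum.neutral, safe)
    fix i assume "i < length ts - 1"
    then have "ts ! i \<in> set ts" "ts ! Suc i \<in> set ts" by auto
    then show "dist (\<gamma> (ts ! i)) (\<gamma> (ts ! Suc i)) = 0" using that by (metis (no_types, lifting) atLeastAtMost_singleton dist_self singletonD subsetD)
  qed
  then show ?thesis unfolding arc_length_eq_SUP
    by (intro antisym SUP_least) auto
qed

lemma arc_length_add_le:
  assumes "L-lipschitz_on {0..1} \<gamma>" "0 \<le> s" "s \<le> t" "t \<le> 1" "arc_length \<gamma> s < top"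
  shows "arc_length \<gamma> t \<le> arc_length \<gamma> s + ennreal (L * (t - s))"
proof -
  have L: "0 \<le> L" using assms(1) lipschitz_on_nonneg by blast
  obtain A where A: "arc_length \<gamma> s = ennreal A" "0 \<le> A"
    using assms(5) by (cases "arc_length \<gamma> s") auto
  have "poly_length \<gamma> ts \<le> A + L * (t - s)" if "sorted ts" "set ts \<subseteq> {0..t}" for ts
  proof -
    have "last ts \<le> t" if "ts \<noteq> []" using that \<open>set ts \<subseteq> {0..t}\<close> last_in_set by force
    then have "L * max 0 (if ts = [] then 0 else last ts - s) \<le> L * (t - s)"
      using L assms(3) by (intro mult_left_mono) auto
    then show ?thesis
      using poly_length_le_lipschitz[OF assms(1,2) that assms(4,3) A] by linarith
  qed
  then have "arc_length \<gamma> t \<le> ennreal (A + L * (t - s))"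
    unfolding arc_length_eq_SUP[of \<gamma> t] by (intro SUP_least ennreal_leI) auto
  also have "\<dots> = arc_length \<gamma> s + ennreal (L * (t - s))"
    using A L assms(3) by simp
  finally show ?thesis .
qed

lemma arc_length_finite:
  assumes "L-lipschitz_on {0..1} \<gamma>" "0 \<le> t" "t \<le> 1"
  shows "arc_length \<gamma> t < top"
  using arc_length_add_le[OF assms(1) order_refl assms(2,3)]
  by (simp add: arc_length_0) (metis ennreal_less_top order_le_less_trans)

lemma dist_le_arc_length:
  assumes "0 \<le> s" "s \<le> t"
  shows "arc_length \<gamma> s + ennreal (dist (\<gamma> s) (\<gamma> t)) \<le> arc_length \<gamma> t"
proof -
  have "ennreal (poly_length \<gamma> ts) + ennreal (dist (\<gamma> s) (\<gamma> t)) \<le> arc_length \<gamma> t"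
    if ts: "sorted ts" "set ts \<subseteq> {0..s}" for ts
  proof -
    have "poly_length \<gamma> ts + dist (\<gamma> s) (\<gamma> t) \<le> poly_length \<gamma> ((ts @ [s]) @ [t])"
      unfolding poly_length_snoc by simp
    then have "ennreal (poly_length \<gamma> ts) + ennreal (dist (\<gamma> s) (\<gamma> t))
        \<le> ennreal (poly_length \<gamma> ((ts @ [s]) @ [t]))"
      by (simp add: poly_length_nonneg flip: ennreal_plus)
    also have "\<dots> \<le> arc_length \<gamma> t"
      using ts assms by (intro poly_length_le_arc_length) (force simp: sorted_append)+
    finally show ?thesis .
  qed
  moreover have "{ts. sorted ts \<and> set ts \<subseteq> {0..s}} \<noteq> {}"
    by (metis (mono_tags) empty_iff empty_set mem_Collect_eq sorted_simps(1) subsetI)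
  ultimately show ?thesis
    unfolding arc_length_eq_SUP[of \<gamma> s]
    by (subst ennreal_SUP_add_left[symmetric]) (auto intro!: SUP_least)
qed

section \<open>Change of variables for expanding functions of a real variable\<close>

lemma expanding_imp_mono_on:
  fixes \<theta> :: "real \<Rightarrow> real"
  assumes exp: "\<And>s s'. s \<in> {0..M} \<Longrightarrow> s' \<in> {0..M} \<Longrightarrow> s \<le> s' \<Longrightarrow> s' - s \<le> L * (\<theta> s' - \<theta> s)"
    and "0 < L"
  shows "mono_on {0..M} \<theta>"
proof (rule mono_onI)
  fix s s' assume "s \<in> {0..M}" "s' \<in> {0..M}" "s \<le> s'"
  then have "0 \<le> L * (\<theta> s' - \<theta> s)" using exp[of s s'] by simp
  then show "\<theta> s \<le> \<theta> s'" using \<open>0 < L\<close> by (simp add: zero_le_mult_iff)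
qed

text \<open>\<open>\<theta>\<close> is monotone but may jump, so a substitution rule for continuous
  maps does not apply. The preimage of an interval has diameter at most \<open>L\<close> times its
  length; open sets follow through their components, Borel sets by outer regularity.\<close>

lemma expanding_emeasure_vimage_le:
  fixes \<theta> :: "real \<Rightarrow> real"
  assumes exp: "\<And>s s'. s \<in> {0..M} \<Longrightarrow> s' \<in> {0..M} \<Longrightarrow> s \<le> s' \<Longrightarrow> s' - s \<le> L * (\<theta> s' - \<theta> s)"
    and "0 < L" and "A \<in> sets borel"
  shows "emeasure lborel {s \<in> {0..M}. \<theta> s \<in> A} \<le> ennreal L * emeasure lborel A"
proof -
  note mono = expanding_imp_mono_on[OF exp \<open>0 < L\<close>]
  have meas: "\<theta> \<in> borel_measurable (restrict_space borel {0..M})"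
    by (rule borel_measurable_mono_on_fnc[OF mono])
  have vimage: "{s \<in> {0..M}. \<theta> s \<in> B} \<in> sets lborel" if "B \<in> sets borel" for B
  proof -
    have "\<theta> -` B \<inter> space (restrict_space borel {0..M}) \<in> sets (restrict_space borel {0..M})"
      using meas that by (rule measurable_sets)
    then have "\<theta> -` B \<inter> {0..M} \<in> sets borel"
      by (simp add: space_restrict_space sets_restrict_space_iff)
    moreover have "\<theta> -` B \<inter> {0..M} = {s \<in> {0..M}. \<theta> s \<in> B}" by auto
    ultimately show ?thesis by simp
  qed
  have conn: "emeasure lborel {s \<in> {0..M}. \<theta> s \<in> C} \<le> ennreal L * emeasure lborel C"
    if C: "connected C" "open C" for C
  proof (cases "{s \<in> {0..M}. \<theta> s \<in> C} = {}")
    case True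
    then show ?thesis by (simp only: emeasure_empty) simp
  next
    case ne: False
    define T where "T = {s \<in> {0..M}. \<theta> s \<in> C}"
    have T: "T \<noteq> {}" "T \<subseteq> {0..M}" using ne by (auto simp: T_def)
    then have bdd: "bdd_above T" "bdd_below T"
      by (meson bdd_above_Icc bdd_above_mono bdd_below_Icc bdd_below_mono)+
    have "Sup T - Inf T \<le> x" if x: "emeasure lborel C * ennreal L = ennreal x" "0 \<le> x" for x
    proof -
      have "b - a \<le> x" if "a \<in> T" "b \<in> T" for a b
      proof (cases "a \<le> b")
        case True
        have ab: "a \<in> {0..M}" "b \<in> {0..M}" "\<theta> a \<in> C" "\<theta> b \<in> C"
          using that by (simp_all add: T_def)
        have \<theta>ab: "\<theta> a \<le> \<theta> b" using mono_onD[OF mono ab(1,2) True] .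
        have "b - a \<le> L * (\<theta> b - \<theta> a)" by (rule exp[OF ab(1,2) True])
        moreover have "{\<theta> a..\<theta> b} \<subseteq> C"
          by (rule connected_contains_Icc[OF C(1) ab(3,4)])
        then have "emeasure lborel {\<theta> a..\<theta> b} \<le> emeasure lborel C"
          using C by (intro emeasure_mono) auto
        then have "ennreal (\<theta> b - \<theta> a) * ennreal L \<le> ennreal x"
          unfolding x(1)[symmetric]
          using \<theta>ab by (intro mult_right_mono) auto
        then have "ennreal ((\<theta> b - \<theta> a) * L) \<le> ennreal x"
          using \<open>0 < L\<close> \<theta>ab by (simp add: ennreal_mult)
        then have "(\<theta> b - \<theta> a) * L \<le> x" using x by simp
        ultimately show ?thesis by (simp add: mult.commute)
      qed (use x in auto)
      then have "b - x \<le> Inf T" if "b \<in> T" for b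
        using T that by (intro cInf_greatest) (auto simp: algebra_simps)
      then have "b \<le> Inf T + x" if "b \<in> T" for b using that by fastforce
      then have "Sup T \<le> Inf T + x" using T by (intro cSup_least) auto
      then show ?thesis by simp
    qed
    then have "ennreal (Sup T - Inf T) \<le> emeasure lborel C * ennreal L"
      by (cases "emeasure lborel C * ennreal L") auto
    moreover have "T \<subseteq> {Inf T..Sup T}" using bdd by (auto intro: cInf_lower cSup_upper)
    then have "emeasure lborel T \<le> emeasure lborel {Inf T..Sup T}"
      by (intro emeasure_mono) auto
    moreover have "Inf T \<le> Sup T" using T bdd by (meson cInf_le_cSup)
    ultimately show ?thesis by (simp add: T_def mult.commute)
  qed
  have open': "emeasure lborel {s \<in> {0..M}. \<theta> s \<in> U} \<le> ennreal L * emeasure lborel U"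
    if "open U" for U
  proof -
    have op: "\<And>C. C \<in> components U \<Longrightarrow> open C" using that open_components by blast
    have disj: "disjoint_family_on (\<lambda>C. C) (components U)"
      using pairwise_disjoint_components[of U]
      by (auto simp: disjoint_family_on_def pairwise_def)
    then have disj': "disjoint_family_on (\<lambda>C. {s \<in> {0..M}. \<theta> s \<in> C}) (components U)"
      by (auto simp: disjoint_family_on_def)
    have cnt: "countable (components U)"
      using op pairwise_disjoint_components[of U]
      by (intro countable_disjoint_open_subsets) (auto simp: pairwise_def disjnt_def)
    have "{s \<in> {0..M}. \<theta> s \<in> U} = (\<Union>C\<in>components U. {s \<in> {0..M}. \<theta> s \<in> C})"
    proof -
      have "U = \<Union>(components U)" by (simp add: Union_components)
      then have "\<theta> s \<in> U \<longleftrightarrow> (\<exists>C\<in>components U. \<theta> s \<in> C)" for s by (metis Union_iff)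
      then show ?thesis by auto
    qed
    then have "emeasure lborel {s \<in> {0..M}. \<theta> s \<in> U}
        = (\<integral>\<^sup>+ C. emeasure lborel {s \<in> {0..M}. \<theta> s \<in> C} \<partial>count_space (components U))"
      using emeasure_UN_countable[OF _ cnt disj', of lborel] op vimage by (simp add: borel_open)
    also have "\<dots> \<le> (\<integral>\<^sup>+ C. ennreal L * emeasure lborel C \<partial>count_space (components U))"
      using op conn by (intro nn_integral_mono) (auto simp: in_components_connected)
    also have "\<dots> = ennreal L * (\<integral>\<^sup>+ C. emeasure lborel C \<partial>count_space (components U))"
      by (rule nn_integral_cmult) simp
    also have "(\<integral>\<^sup>+ C. emeasure lborel C \<partial>count_space (components U)) = emeasure lborel U"
      using emeasure_UN_countable[of "components U" "\<lambda>C. C" lborel] op cnt disj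
        Union_components[of U] by auto
    finally show ?thesis .
  qed
  show ?thesis
  proof (rule ennreal_le_epsilon)
    fix e :: real assume e: "0 < e"
    obtain U where U: "open U" "A \<subseteq> U" "emeasure lborel (U - A) < e / L"
      using outer_regular_lborel[OF \<open>A \<in> sets borel\<close>, of "e / L"] e \<open>0 < L\<close> by auto
    have "emeasure lborel {s \<in> {0..M}. \<theta> s \<in> A} \<le> emeasure lborel {s \<in> {0..M}. \<theta> s \<in> U}"
      using U vimage by (intro emeasure_mono) auto
    also have "\<dots> \<le> ennreal L * emeasure lborel U" using open' U by blast
    also have "emeasure lborel U = emeasure lborel A + emeasure lborel (U - A)"
      using U \<open>A \<in> sets borel\<close> plus_emeasure[of A lborel "U - A"]
      by (auto simp: Un_absorb1)
    also have "ennreal L * (emeasure lborel A + emeasure lborel (U - A))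
        \<le> ennreal L * (emeasure lborel A + ennreal (e / L))"
      using U by (intro mult_left_mono add_left_mono) auto
    also have "\<dots> = ennreal L * emeasure lborel A + ennreal e"
      using e \<open>0 < L\<close> by (simp add: distrib_left flip: ennreal_mult)
    finally show "emeasure lborel {s \<in> {0..M}. \<theta> s \<in> A}
        \<le> ennreal L * emeasure lborel A + ennreal e" .
  qed
qed

lemma nn_integral_expanding_le:
  fixes \<theta> :: "real \<Rightarrow> real"
  assumes exp: "\<And>s s'. s \<in> {0..M} \<Longrightarrow> s' \<in> {0..M} \<Longrightarrow> s \<le> s' \<Longrightarrow> s' - s \<le> L * (\<theta> s' - \<theta> s)"
    and "0 < L" and g: "g \<in> borel_measurable borel"
  shows "(\<integral>\<^sup>+ s \<in> {0..M}. g (\<theta> s) \<partial>lborel) \<le> ennreal L * (\<integral>\<^sup>+ t. g t \<partial>lborel)"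
proof -
  note mono = expanding_imp_mono_on[OF exp \<open>0 < L\<close>]
  define R where "R = restrict_space lborel {0..M}"
  have sR: "sets R = sets (restrict_space borel {0..M})"
    unfolding R_def by (rule sets_restrict_space_cong) simp
  have meas[measurable]: "\<theta> \<in> R \<rightarrow>\<^sub>M borel"
    using borel_measurable_mono_on_fnc[OF mono] measurable_cong_sets[OF sR refl] by blast
  have le: "distr R borel \<theta> \<le> density lborel (\<lambda>_. ennreal L)"
    unfolding le_measure_iff
  proof (simp, rule le_funI)
    fix A :: "real set"
    show "emeasure (distr R borel \<theta>) A \<le> emeasure (density lborel (\<lambda>_. ennreal L)) A"
    proof (cases "A \<in> sets borel")
      case True
      have "emeasure (distr R borel \<theta>) A = emeasure R (\<theta> -` A \<inter> space R)"
        using True by (simp add: emeasure_distr)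
      also have "\<theta> -` A \<inter> space R = {s \<in> {0..M}. \<theta> s \<in> A}"
        by (auto simp: R_def space_restrict_space)
      also have "emeasure R {s \<in> {0..M}. \<theta> s \<in> A} = emeasure lborel {s \<in> {0..M}. \<theta> s \<in> A}"
        unfolding R_def by (rule emeasure_restrict_space) auto
      also have "\<dots> \<le> ennreal L * emeasure lborel A"
        using expanding_emeasure_vimage_le[OF exp \<open>0 < L\<close> True] .
      also have "\<dots> = emeasure (density lborel (\<lambda>_. ennreal L)) A"
        using True by (simp add: emeasure_density_const)
      finally show ?thesis .
    qed (simp add: emeasure_notin_sets)
  qed
  have "(\<integral>\<^sup>+ s \<in> {0..M}. g (\<theta> s) \<partial>lborel) = (\<integral>\<^sup>+ s. g (\<theta> s) \<partial>R)"
    unfolding R_def by (subst nn_integral_restrict_space) auto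
  also have "\<dots> = (\<integral>\<^sup>+ t. g t \<partial>distr R borel \<theta>)"
    using g by (subst nn_integral_distr) auto
  also have "\<dots> \<le> (\<integral>\<^sup>+ t. g t \<partial>density lborel (\<lambda>_. ennreal L))"
    using le by (intro nn_integral_mono_measure) auto
  also have "\<dots> = ennreal L * (\<integral>\<^sup>+ t. g t \<partial>lborel)"
    using g by (subst nn_integral_density) (auto simp: nn_integral_cmult)
  finally show ?thesis .
qed

text \<open>The choice hidden in \<open>normal_representation\<close> is a right inverse of the
  length function. That function is \<open>L\<close>-Lipschitz, so every right inverse is expanding,
  whichever parameters are chosen. An upper bound is the useful direction, since admissibility
  bounds line integrals from below.\<close>

lemma line_integral_lipschitz_le:
  fixes \<gamma> :: "real \<Rightarrow> real ^ 'n"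
  assumes lip: "L-lipschitz_on {0..1} \<gamma>" and "0 < L" and rho: "\<rho> \<in> borel_measurable borel"
  shows "line_integral \<gamma> \<rho> \<le> ennreal L * (\<integral>\<^sup>+ t \<in> {0..1}. \<rho> (\<gamma> t) \<partial>lborel)"
proof -
  define len where "len t = enn2real (arc_length \<gamma> t)" for t
  have len: "arc_length \<gamma> t = ennreal (len t)" "0 \<le> len t" if "t \<in> {0..1}" for t
    using arc_length_finite[OF lip] that unfolding len_def by auto
  have len_le: "len t - len s \<le> L * (t - s)" and len_ge: "dist (\<gamma> s) (\<gamma> t) \<le> len t - len s"
    if "s \<in> {0..1}" "t \<in> {0..1}" "s \<le> t" for s t
  proof -
    have "ennreal (len t) \<le> ennreal (len s + L * (t - s))"
      using arc_length_add_le[OF lip, of s t] that len[of s] len[of t] \<open>0 < L\<close>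
      by auto
    moreover have "0 \<le> len s + L * (t - s)" using len[of s] that \<open>0 < L\<close> by simp
    ultimately show "len t - len s \<le> L * (t - s)"
      by (simp only: ennreal_le_iff)
    have "ennreal (len s + dist (\<gamma> s) (\<gamma> t)) \<le> ennreal (len t)"
      using dist_le_arc_length[of s t \<gamma>] that len[of s] len[of t] by simp
    then show "dist (\<gamma> s) (\<gamma> t) \<le> len t - len s"
      using len[of t] that by simp
  qed
  have len_mono: "len s \<le> len t" if "s \<in> {0..1}" "t \<in> {0..1}" "s \<le> t" for s t
    using len_ge[OF that] zero_le_dist[of "\<gamma> s" "\<gamma> t"] by linarith
  have len0: "len 0 = 0" by (simp add: len_def arc_length_0)
  have cont: "continuous_on {0..1} len"
  proof (rule lipschitz_on_continuous_on[of L])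
    show "L-lipschitz_on {0..1} len"
    proof (rule lipschitz_onI)
      fix s t :: real assume "s \<in> {0..1}" "t \<in> {0..1}"
      then show "dist (len s) (len t) \<le> L * dist s t"
        using len_le[of s t] len_mono[of s t] len_le[of t s] len_mono[of t s]
        by (cases "s \<le> t") (auto simp: dist_real_def abs_if)
    qed (use \<open>0 < L\<close> in simp)
  qed
  define \<theta> where "\<theta> s = (SOME t. t \<in> {0..1} \<and> arc_length \<gamma> t = ennreal s)" for s
  have \<theta>: "\<theta> s \<in> {0..1}" "len (\<theta> s) = s" if s: "s \<in> {0..len 1}" for s
  proof -
    obtain t where "0 \<le> t" "t \<le> 1" "len t = s"
      using IVT'[of len 0 s 1, OF _ _ _ cont] s len0 by auto
    then have "\<exists>t. t \<in> {0..1} \<and> arc_length \<gamma> t = ennreal s" using len(1)[of t] by auto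
    then have *: "\<theta> s \<in> {0..1} \<and> arc_length \<gamma> (\<theta> s) = ennreal s"
      unfolding \<theta>_def by (rule someI_ex)
    then show "\<theta> s \<in> {0..1}" by simp
    show "len (\<theta> s) = s" using * that by (simp add: len_def)
  qed
  have exp: "s' - s \<le> L * (\<theta> s' - \<theta> s)" if "s \<in> {0..len 1}" "s' \<in> {0..len 1}" "s \<le> s'" for s s'
  proof (cases "\<theta> s \<le> \<theta> s'")
    case True
    then show ?thesis using len_le[of "\<theta> s" "\<theta> s'"] \<theta> that by auto
  next
    case False
    then have "s' \<le> s" using len_mono[of "\<theta> s'" "\<theta> s"] \<theta> that by auto
    then have "s' = s" using that by simp
    then show ?thesis by simp
  qed
  \<comment> \<open>Clamping the time to the unit interval gives a Borel function on the whole line,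
    although \<open>\<gamma>\<close> is controlled only on that interval.\<close>
  define g where "g t = \<rho> (\<gamma> (max 0 (min 1 t))) * indicator {0..1} t" for t
  have "continuous_on UNIV (\<lambda>t. \<gamma> (max 0 (min 1 t)))"
    using lipschitz_on_continuous_on[OF lip]
    by (rule continuous_on_compose2) (auto intro!: continuous_intros)
  then have [measurable]: "(\<lambda>t. \<gamma> (max 0 (min 1 t))) \<in> borel_measurable borel"
    by (rule borel_measurable_continuous_onI)
  have [measurable]: "g \<in> borel_measurable borel"
    unfolding g_def using rho by measurable
  have "line_integral \<gamma> \<rho> = (\<integral>\<^sup>+ s \<in> {0..len 1}. g (\<theta> s) \<partial>lborel)"
    unfolding line_integral_def nn_integral_completion normal_representation_def
      len_def[symmetric] \<theta>_def[symmetric]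
  proof (intro nn_integral_cong)
    fix s
    show "\<rho> (\<gamma> (\<theta> s)) * indicator {0..len 1} s = g (\<theta> s) * indicator {0..len 1} s"
    proof (cases "s \<in> {0..len 1}")
      case True
      then have "max 0 (min 1 (\<theta> s)) = \<theta> s" using \<theta>(1)[OF True] by auto
      then show ?thesis using \<theta>(1)[OF True] by (simp add: g_def)
    qed simp
  qed
  also have "\<dots> \<le> ennreal L * (\<integral>\<^sup>+ t. g t \<partial>lborel)"
    by (rule nn_integral_expanding_le[OF exp \<open>0 < L\<close>]) measurable
  also have "(\<integral>\<^sup>+ t. g t \<partial>lborel) = (\<integral>\<^sup>+ t \<in> {0..1}. \<rho> (\<gamma> t) \<partial>lborel)"
    by (intro nn_integral_cong) (auto simp: g_def indicator_def max_def)
  finally show ?thesis .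
qed

section \<open>Crossing of rings\<close>

lemma first_hitting_time:
  fixes \<phi> :: "real \<Rightarrow> real"
  assumes cont: "continuous_on {a..b} \<phi>" and "a \<le> b" "\<phi> a \<le> r" "r \<le> \<phi> b"
  obtains t where "a \<le> t" "t \<le> b" "\<phi> t = r" "\<And>u. a \<le> u \<Longrightarrow> u < t \<Longrightarrow> \<phi> u < r"
proof -
  define T where "T = {u \<in> {a..b}. \<phi> u = r}"
  have "compact T"
    unfolding compact_eq_bounded_closed
  proof
    show "bounded T" by (rule bounded_subset[of "{a..b}"]) (auto simp: T_def)
    show "closed T" unfolding T_def by (rule continuous_closed_preimage_constant[OF cont]) simp
  qed
  moreover have "\<exists>x\<ge>a. x \<le> b \<and> \<phi> x = r"
    using assms by (intro IVT') auto
  then have "T \<noteq> {}" by (auto simp: T_def)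
  ultimately obtain t where t: "t \<in> T" "\<And>u. u \<in> T \<Longrightarrow> t \<le> u"
    using compact_attains_inf[of T] by metis
  have t': "a \<le> t" "t \<le> b" "\<phi> t = r" using t(1) by (auto simp: T_def)
  have "\<phi> u < r" if u: "a \<le> u" "u < t" for u
  proof (rule ccontr)
    assume "\<not> \<phi> u < r"
    moreover have "continuous_on {a..u} \<phi>"
      by (rule continuous_on_subset[OF cont]) (use u t' in auto)
    ultimately obtain v where "a \<le> v" "v \<le> u" "\<phi> v = r"
      using IVT'[of \<phi> a r u] assms(3) u by auto
    then show False using t(2)[of v] u t' by (auto simp: T_def)
  qed
  then show ?thesis using t' that by metis
qed

text \<open>The end is the first time at height \<open>r2\<close>, the start is the last earlier
  time at height \<open>r1\<close>. In this order the inner part stays strictly between the two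
  heights, as \<open>annulus\<close> demands.\<close>

lemma crossing_subinterval:
  fixes \<phi> :: "real \<Rightarrow> real"
  assumes cont: "continuous_on {a..b} \<phi>" and "a \<le> b" "\<phi> a \<le> r1" "r1 < r2" "r2 \<le> \<phi> b"
  obtains s t where "a \<le> s" "s < t" "t \<le> b" "\<phi> s = r1" "\<phi> t = r2"
    "\<And>u. s < u \<Longrightarrow> u < t \<Longrightarrow> r1 < \<phi> u \<and> \<phi> u < r2"
proof -
  have "\<phi> a \<le> r2" using assms by simp
  then obtain t where t': "a \<le> t" "t \<le> b" "\<phi> t = r2"
    and below: "\<And>u. a \<le> u \<Longrightarrow> u < t \<Longrightarrow> \<phi> u < r2"
    using first_hitting_time[OF cont \<open>a \<le> b\<close> _ \<open>r2 \<le> \<phi> b\<close>] by metis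
  have cont': "continuous_on {a..t} \<phi>"
    by (rule continuous_on_subset[OF cont]) (use t' in auto)
  define S where "S = {u \<in> {a..t}. \<phi> u = r1}"
  have "compact S"
    unfolding compact_eq_bounded_closed
  proof
    show "bounded S" by (rule bounded_subset[of "{a..t}"]) (auto simp: S_def)
    show "closed S" unfolding S_def by (rule continuous_closed_preimage_constant[OF cont']) simp
  qed
  moreover have "\<exists>x\<ge>a. x \<le> t \<and> \<phi> x = r1"
    using assms t' cont' by (intro IVT') auto
  then have "S \<noteq> {}" by (auto simp: S_def)
  ultimately obtain s where s: "s \<in> S" "\<And>u. u \<in> S \<Longrightarrow> u \<le> s"
    using compact_attains_sup[of S] by metis
  have s': "a \<le> s" "s \<le> t" "\<phi> s = r1" using s(1) by (auto simp: S_def)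
  have above: "r1 < \<phi> u" if u: "s < u" "u < t" for u
  proof (rule ccontr)
    assume "\<not> r1 < \<phi> u"
    moreover have "continuous_on {u..t} \<phi>"
      by (rule continuous_on_subset[OF cont]) (use u t' s' in auto)
    ultimately obtain v where "u \<le> v" "v \<le> t" "\<phi> v = r1"
      using IVT'[of \<phi> u r1 t] assms(4) u t' by auto
    then show False using s(2)[of v] u s' by (auto simp: S_def)
  qed
  have "s \<noteq> t" using s' t' assms(4) by auto
  then show ?thesis using that[of s t] s' t' above below by auto
qed

text \<open>The indicator records that the crossing is paid for by the part of the curve lying over
  \<open>ball z r2\<close>. This localisation later gives the densities of different rings bounded
  overlap.\<close>

lemma admissible_crossing_forward:
  fixes \<gamma> :: "real \<Rightarrow> real ^ 'n"
  assumes lip: "1-lipschitz_on {0..l} \<gamma>" and im: "\<gamma> ` {0..l} \<subseteq> D" and f: "continuous_on D f"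
    and "r1 < r2" and rho: "\<rho> \<in> adm (ring_preimage_paths D f z r1 r2)"
    and a: "0 \<le> a" "a \<le> b" "b \<le> l" and cross: "dist (f (\<gamma> a)) z \<le> r1" "r2 \<le> dist (f (\<gamma> b)) z"
  shows "1 \<le> (\<integral>\<^sup>+ t \<in> {0..l}. \<rho> (\<gamma> t) * indicator {x \<in> D. f x \<in> ball z r2} (\<gamma> t) \<partial>lborel)"
proof -
  have rhom[measurable]: "\<rho> \<in> borel_measurable borel" using rho by (simp add: adm_def)
  have contg: "continuous_on {0..l} \<gamma>" by (rule lipschitz_on_continuous_on[OF lip])
  have contf: "continuous_on {0..l} (\<lambda>t. f (\<gamma> t))"
    by (rule continuous_on_compose2[OF f contg im])
  have "continuous_on {a..b} (\<lambda>t. dist (f (\<gamma> t)) z)"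
    by (intro continuous_intros continuous_on_subset[OF contf]) (use a in auto)
  then obtain s t where st: "a \<le> s" "s < t" "t \<le> b" "dist (f (\<gamma> s)) z = r1" "dist (f (\<gamma> t)) z = r2"
    and between: "\<And>u. s < u \<Longrightarrow> u < t \<Longrightarrow> r1 < dist (f (\<gamma> u)) z \<and> dist (f (\<gamma> u)) z < r2"
    by (rule crossing_subinterval[of a b "\<lambda>t. dist (f (\<gamma> t)) z" r1 r2,
          OF _ a(2) cross(1) \<open>r1 < r2\<close> cross(2)]) blast
  \<comment> \<open>Over the unit interval the crossing piece has Lipschitz constant
    \<open>t - s\<close>; the change of variables below absorbs this factor.\<close>
  define \<sigma> where "\<sigma> \<tau> = \<gamma> (s + (t - s) * \<tau>)" for \<tau>
  have aff: "s + (t - s) * \<tau> \<in> {s..t}" if "\<tau> \<in> {0..1}" for \<tau>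
  proof -
    have "0 \<le> (t - s) * \<tau>" "(t - s) * \<tau> \<le> t - s"
      using that st(2) by (auto intro: mult_left_le)
    then show ?thesis by simp
  qed
  have sub: "{s..t} \<subseteq> {0..l}" using st a by auto
  have lip\<sigma>: "(t - s)-lipschitz_on {0..1} \<sigma>"
  proof (rule lipschitz_onI)
    fix x y :: real assume "x \<in> {0..1}" "y \<in> {0..1}"
    then have "dist (\<sigma> x) (\<sigma> y) \<le> 1 * dist (s + (t - s) * x) (s + (t - s) * y)"
      unfolding \<sigma>_def by (intro lipschitz_onD[OF lip] subsetD[OF sub] aff)
    also have "\<dots> = (t - s) * dist x y"
      using st(2) by (simp add: dist_real_def abs_mult flip: right_diff_distrib)
    finally show "dist (\<sigma> x) (\<sigma> y) \<le> (t - s) * dist x y" .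
  qed (use st in simp)
  have path: "path \<sigma>" unfolding path_def by (rule lipschitz_on_continuous_on[OF lip\<sigma>])
  have imS: "path_image \<sigma> \<subseteq> D"
    unfolding path_image_def \<sigma>_def using aff sub im by blast
  have "f \<circ> \<sigma> \<in> joining_paths (sphere z r1) (sphere z r2) (annulus z r1 r2)"
    unfolding joining_paths_def
  proof (intro CollectI conjI ballI)
    show "path (f \<circ> \<sigma>)"
      by (rule path_continuous_image[OF path continuous_on_subset[OF f imS]])
    show "pathstart (f \<circ> \<sigma>) \<in> sphere z r1" "pathfinish (f \<circ> \<sigma>) \<in> sphere z r2"
      using st by (simp_all add: pathstart_def pathfinish_def \<sigma>_def dist_commute)
    fix \<tau> :: real assume "\<tau> \<in> {0<..<1}"
    then have \<tau>: "0 < \<tau>" "\<tau> < 1" by auto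
    have "0 < (t - s) * \<tau>" using st(2) \<tau> by simp
    moreover have "(t - s) * \<tau> < (t - s) * 1"
      by (rule mult_strict_left_mono) (use st(2) \<tau> in auto)
    ultimately have "s < s + (t - s) * \<tau>" "s + (t - s) * \<tau> < t"
      unfolding mult_1_right by linarith+
    then show "(f \<circ> \<sigma>) \<tau> \<in> annulus z r1 r2"
      using between by (simp add: annulus_def \<sigma>_def)
  qed
  then have "\<sigma> \<in> ring_preimage_paths D f z r1 r2"
    using path imS by (simp add: ring_preimage_paths_def)
  moreover have "rectifiable \<sigma>"
    using path arc_length_finite[OF lip\<sigma>, of 1] by (simp add: rectifiable_def)
  ultimately have "1 \<le> line_integral \<sigma> \<rho>" using rho by (simp add: adm_def)
  also have "\<dots> \<le> ennreal (t - s) * (\<integral>\<^sup>+ \<tau> \<in> {0..1}. \<rho> (\<sigma> \<tau>) \<partial>lborel)"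
    using st by (intro line_integral_lipschitz_le[OF lip\<sigma>]) auto
  also have "\<dots> = (\<integral>\<^sup>+ u \<in> {s..t}. \<rho> (\<gamma> u) \<partial>lborel)"
  proof -
    define g where "g u = \<rho> (\<gamma> (max s (min t u))) * indicator {s..t} u" for u
    have "continuous_on UNIV (\<lambda>u. \<gamma> (max s (min t u)))"
      using continuous_on_subset[OF contg sub]
      by (rule continuous_on_compose2) (use st in \<open>auto intro!: continuous_intros\<close>)
    then have [measurable]: "(\<lambda>u. \<gamma> (max s (min t u))) \<in> borel_measurable borel"
      by (rule borel_measurable_continuous_onI)
    have [measurable]: "g \<in> borel_measurable borel" unfolding g_def by measurable
    have g: "g u = \<rho> (\<gamma> u) * indicator {s..t} u" for u
      by (auto simp: g_def indicator_def max_def)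
    have "(\<integral>\<^sup>+ u. g u \<partial>lborel) = ennreal \<bar>t - s\<bar> * (\<integral>\<^sup>+ \<tau>. g (s + (t - s) * \<tau>) \<partial>lborel)"
      using st by (intro nn_integral_real_affine) auto
    also have "(\<integral>\<^sup>+ \<tau>. g (s + (t - s) * \<tau>) \<partial>lborel) = (\<integral>\<^sup>+ \<tau> \<in> {0..1}. \<rho> (\<sigma> \<tau>) \<partial>lborel)"
    proof (rule nn_integral_cong)
      fix \<tau>
      have "(t - s) * \<tau> \<le> (t - s) * 1 \<longleftrightarrow> \<tau> \<le> 1"
        by (rule mult_le_cancel_left_pos) (use st(2) in simp)
      moreover have "0 \<le> (t - s) * \<tau> \<longleftrightarrow> 0 \<le> \<tau>"
        using st(2) by (simp add: zero_le_mult_iff)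
      ultimately have "s + (t - s) * \<tau> \<in> {s..t} \<longleftrightarrow> \<tau> \<in> {0..1}"
        unfolding mult_1_right atLeastAtMost_iff by linarith
      then show "g (s + (t - s) * \<tau>) = \<rho> (\<sigma> \<tau>) * indicator {0..1} \<tau>"
        by (simp add: g \<sigma>_def indicator_def)
    qed
    finally show ?thesis using st by (simp add: g)
  qed
  also have "\<dots> \<le> (\<integral>\<^sup>+ u \<in> {0..l}. \<rho> (\<gamma> u) * indicator {x \<in> D. f x \<in> ball z r2} (\<gamma> u) \<partial>lborel)"
  proof (rule nn_integral_mono_AE)
    \<comment> \<open>At time \<open>t\<close> the image is on the sphere of radius
      \<open>r2\<close>, outside the open ball, so the comparison holds only almost
      everywhere.\<close>
    have "AE u in lborel. u \<noteq> s" "AE u in lborel. u \<noteq> t" by (rule AE_lborel_singleton)+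
    then show "AE u in lborel. \<rho> (\<gamma> u) * indicator {s..t} u
        \<le> \<rho> (\<gamma> u) * indicator {x \<in> D. f x \<in> ball z r2} (\<gamma> u) * indicator {0..l} u"
    proof eventually_elim
      case (elim u)
      show ?case
      proof (cases "u \<in> {s..t}")
        case True
        then have u: "s < u" "u < t" using elim by auto
        moreover have "u \<in> {0..l}" using True sub by blast
        moreover have "\<gamma> u \<in> D" using \<open>u \<in> {0..l}\<close> im by blast
        ultimately show ?thesis using between[OF u] by (simp add: dist_commute)
      qed simp
    qed
  qed
  finally show ?thesis .
qed

text \<open>\<open>ring_preimage_paths\<close> contains only curves whose images run outwards, so a
  curve that is far from \<open>z\<close> first and near it later is traversed backwards.\<close>

lemma admissible_crossing:
  fixes \<gamma> :: "real \<Rightarrow> real ^ 'n"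
  assumes lip: "1-lipschitz_on {0..l} \<gamma>" and im: "\<gamma> ` {0..l} \<subseteq> D" and f: "continuous_on D f"
    and "open D" and "r1 < r2" and rho: "\<rho> \<in> adm (ring_preimage_paths D f z r1 r2)"
    and ab: "a \<in> {0..l}" "b \<in> {0..l}"
    and cross: "dist (f (\<gamma> a)) z \<le> r1" "r2 \<le> dist (f (\<gamma> b)) z"
  shows "1 \<le> (\<integral>\<^sup>+ t \<in> {0..l}. \<rho> (\<gamma> t) * indicator {x \<in> D. f x \<in> ball z r2} (\<gamma> t) \<partial>lborel)"
proof (cases "a \<le> b")
  case True
  then show ?thesis
    using admissible_crossing_forward[OF lip im f \<open>r1 < r2\<close> rho _ True _ cross] ab by simp
next
  case False
  have [measurable]: "\<rho> \<in> borel_measurable borel" using rho by (simp add: adm_def)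
  have contg: "continuous_on {0..l} \<gamma>" by (rule lipschitz_on_continuous_on[OF lip])
  have refl: "l - t \<in> {0..l} \<longleftrightarrow> t \<in> {0..l}" for t :: real by auto
  have lip': "1-lipschitz_on {0..l} (\<lambda>t. \<gamma> (l - t))"
  proof (rule lipschitz_onI)
    fix x y :: real assume "x \<in> {0..l}" "y \<in> {0..l}"
    then have "dist (\<gamma> (l - x)) (\<gamma> (l - y)) \<le> 1 * dist (l - x) (l - y)"
      by (intro lipschitz_onD[OF lip]) auto
    then show "dist (\<gamma> (l - x)) (\<gamma> (l - y)) \<le> 1 * dist x y"
      by (simp add: dist_real_def abs_minus_commute)
  qed simp
  have im': "(\<lambda>t. \<gamma> (l - t)) ` {0..l} \<subseteq> D" using im by auto
  let ?I = "indicator {x \<in> D. f x \<in> ball z r2} :: _ \<Rightarrow> ennreal"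
  have "open (D \<inter> f -` ball z r2)"
    by (rule continuous_open_preimage[OF f \<open>open D\<close>]) simp
  moreover have "D \<inter> f -` ball z r2 = {x \<in> D. f x \<in> ball z r2}" by auto
  ultimately have [measurable]: "{x \<in> D. f x \<in> ball z r2} \<in> sets borel" by (metis borel_open)
  define g where "g u = \<rho> (\<gamma> (max 0 (min l u))) * ?I (\<gamma> (max 0 (min l u))) * indicator {0..l} u" for u
  have "continuous_on UNIV (\<lambda>u. \<gamma> (max 0 (min l u)))"
    using contg by (rule continuous_on_compose2) (use ab in \<open>auto intro!: continuous_intros\<close>)
  then have [measurable]: "(\<lambda>u. \<gamma> (max 0 (min l u))) \<in> borel_measurable borel"
    by (rule borel_measurable_continuous_onI)
  have [measurable]: "g \<in> borel_measurable borel" unfolding g_def by measurable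
  have g: "g u = \<rho> (\<gamma> u) * ?I (\<gamma> u) * indicator {0..l} u" for u
    by (cases "u \<in> {0..l}") (auto simp: g_def max_def)
  have "1 \<le> (\<integral>\<^sup>+ t \<in> {0..l}. \<rho> (\<gamma> (l - t)) * ?I (\<gamma> (l - t)) \<partial>lborel)"
    using admissible_crossing_forward[OF lip' im' f \<open>r1 < r2\<close> rho, of "l - a" "l - b"] False ab cross
    by simp
  also have "\<dots> = (\<integral>\<^sup>+ t. g (l + (-1) * t) \<partial>lborel)"
    by (intro nn_integral_cong) (auto simp: g indicator_def)
  also have "\<dots> = (\<integral>\<^sup>+ t. g t \<partial>lborel)"
    using nn_integral_real_affine[of g "-1" l] by simp
  finally show ?thesis by (simp add: g)
qed

section \<open>From small rings to long images\<close>

lemma sum_power_le_card: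
  fixes a :: "'a \<Rightarrow> ennreal"
  assumes "finite C" "card {z \<in> C. a z \<noteq> 0} \<le> N" "0 < n"
  shows "(\<Sum>z\<in>C. a z) ^ n \<le> of_nat N ^ n * (\<Sum>z\<in>C. a z ^ n)"
proof -
  define M where "M = {z \<in> C. a z \<noteq> 0}"
  have M: "finite M" "M \<subseteq> C" "card M \<le> N" using assms by (auto simp: M_def)
  have sum: "(\<Sum>z\<in>C. a z) = (\<Sum>z\<in>M. a z)"
    using assms(1) by (intro sum.mono_neutral_right) (auto simp: M_def)
  show ?thesis
  proof (cases "M = {}")
    case True
    then show ?thesis using sum \<open>0 < n\<close> by (simp add: power_0_left)
  next
    case False
    \<comment> \<open>The sum is at most \<open>N\<close> times its largest term, whose power is
      itself one of the summands.\<close>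
    have "Max (a ` M) \<in> a ` M" using False M(1) by (intro Max_in) auto
    then obtain z where z: "z \<in> M" "a z = Max (a ` M)" by (metis imageE)
    have "(\<Sum>z\<in>M. a z) \<le> of_nat (card M) * a z"
      by (rule sum_bounded_above) (use M z in auto)
    also have "\<dots> \<le> of_nat N * a z"
      using M by (intro mult_right_mono) auto
    finally have "(\<Sum>z\<in>C. a z) ^ n \<le> (of_nat N * a z) ^ n"
      unfolding sum by (intro power_mono) auto
    also have "\<dots> = of_nat N ^ n * a z ^ n" by (rule power_mult_distrib)
    also have "a z ^ n \<le> (\<Sum>z\<in>C. a z ^ n)"
      using z M assms(1) by (intro member_le_sum) auto
    finally show ?thesis by (simp add: mult_left_mono)
  qed
qed

text \<open>Volume comparison: the disjoint balls of radius \<open>\<tau>\<close> around the counted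
  centres all lie in \<open>ball y (11 * \<tau>)\<close>.\<close>

lemma card_disjoint_balls_le:
  fixes C :: "(real ^ 'n) set"
  assumes "finite C" "pairwise (\<lambda>z z'. disjnt (ball z \<tau>) (ball z' \<tau>)) C" "0 < \<tau>"
  shows "card {z \<in> C. y \<in> ball z (10 * \<tau>)} \<le> 11 ^ CARD('n)"
proof -
  define M where "M = {z \<in> C. y \<in> ball z (10 * \<tau>)}"
  define v where "v = unit_ball_vol (real CARD('n))"
  have v: "0 < v" by (simp add: v_def)
  have M: "finite M" "M \<subseteq> C" using assms(1) by (auto simp: M_def)
  have "(\<Sum>z\<in>M. emeasure lborel (ball z \<tau>)) = emeasure lborel (\<Union>z\<in>M. ball z \<tau>)"
    using assms(2) M by (intro sum_emeasure) (auto simp: disjoint_family_on_def pairwise_def disjnt_def subset_iff)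
  also have "\<dots> \<le> emeasure lborel (ball y (11 * \<tau>))"
  proof (intro emeasure_mono UN_least)
    fix z assume "z \<in> M"
    then have "dist y z < 10 * \<tau>" by (simp add: M_def dist_commute)
    then show "ball z \<tau> \<subseteq> ball y (11 * \<tau>)"
    proof (intro subsetI)
      fix x assume "x \<in> ball z \<tau>"
      then show "x \<in> ball y (11 * \<tau>)"
        using dist_triangle[of y x z] \<open>dist y z < 10 * \<tau>\<close> by (simp add: dist_commute)
    qed
  qed simp
  finally have "of_nat (card M) * ennreal (v * \<tau> ^ CARD('n)) \<le> ennreal (v * (11 * \<tau>) ^ CARD('n))"
    using \<open>0 < \<tau>\<close> by (simp add: emeasure_ball v_def)
  then have "ennreal (real (card M) * (v * \<tau> ^ CARD('n))) \<le> ennreal (v * (11 * \<tau>) ^ CARD('n))"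
    using v \<open>0 < \<tau>\<close> by (simp add: ennreal_mult ennreal_of_nat_eq_real_of_nat)
  then have "real (card M) * (v * \<tau> ^ CARD('n)) \<le> 11 ^ CARD('n) * (v * \<tau> ^ CARD('n))"
    using v \<open>0 < \<tau>\<close> by (simp add: power_mult_distrib mult_ac)
  then have "real (card M) \<le> real (11 ^ CARD('n))"
    using v \<open>0 < \<tau>\<close> by (simp add: mult_le_cancel_right)
  then show ?thesis unfolding M_def by linarith
qed

text \<open>
  The measure of \<open>u ` (f ` \<gamma> ` {0..l} \<inter> \<Omega>)\<close> is a substitute for the length of the part of \<open>f \<circ> \<gamma>\<close> in
  \<open>\<Omega>\<close> that is subadditive in \<open>\<Omega>\<close>.
\<close>

definition gains ::
    "(real ^ 'n) set \<Rightarrow> (real ^ 'n \<Rightarrow> real ^ 'n) \<Rightarrow> real \<Rightarrow> (real ^ 'n \<Rightarrow> ennreal) \<Rightarrow> (real ^ 'n) set \<Rightarrow> bool" where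
  "gains D f w \<rho> \<Omega> \<longleftrightarrow>
     (\<forall>(l :: real) \<gamma> (u :: real ^ 'n \<Rightarrow> real).
        1-lipschitz_on {0..l} \<gamma> \<and> \<gamma> ` {0..l} \<subseteq> D \<and>
        (\<exists>s\<in>{0..l}. \<exists>t\<in>{0..l}. w \<le> dist (f (\<gamma> s)) (f (\<gamma> t))) \<and> 1-lipschitz_on UNIV u \<longrightarrow>
        (\<exists>A\<in>sets lborel. u ` (f ` \<gamma> ` {0..l} \<inter> \<Omega>) \<subseteq> A \<and>
           emeasure lborel A \<le> (\<integral>\<^sup>+ t \<in> {0..l}. \<rho> (\<gamma> t) \<partial>lborel)))"

lemma gainsE:
  fixes \<gamma> :: "real \<Rightarrow> real ^ 'n" and u :: "real ^ 'n \<Rightarrow> real"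
  assumes "gains D f w \<rho> \<Omega>" "1-lipschitz_on {0..l} \<gamma>" "\<gamma> ` {0..l} \<subseteq> D"
    "s \<in> {0..l}" "t \<in> {0..l}" "w \<le> dist (f (\<gamma> s)) (f (\<gamma> t))" "1-lipschitz_on UNIV u"
  obtains A where "A \<in> sets lborel" "u ` (f ` \<gamma> ` {0..l} \<inter> \<Omega>) \<subseteq> A"
    "emeasure lborel A \<le> (\<integral>\<^sup>+ t \<in> {0..l}. \<rho> (\<gamma> t) \<partial>lborel)"
proof -
  have "\<exists>s\<in>{0..l}. \<exists>t\<in>{0..l}. w \<le> dist (f (\<gamma> s)) (f (\<gamma> t))"
    using assms(4-6) by (intro bexI)
  then have "\<exists>A\<in>sets lborel. u ` (f ` \<gamma> ` {0..l} \<inter> \<Omega>) \<subseteq> A \<and>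
           emeasure lborel A \<le> (\<integral>\<^sup>+ t \<in> {0..l}. \<rho> (\<gamma> t) \<partial>lborel)"
    using assms(1)[unfolded gains_def, THEN spec[of _ l], THEN spec[of _ \<gamma>], THEN spec[of _ u], THEN mp]
      assms(2,3,7) by metis
  then show ?thesis using that by metis
qed

lemma borel_curve_integrand:
  assumes "1-lipschitz_on {0..l} (\<gamma> :: real \<Rightarrow> real ^ 'n)" "\<rho> \<in> borel_measurable borel"
  shows "(\<lambda>t. \<rho> (\<gamma> t) * indicator {0..l} t :: ennreal) \<in> borel_measurable borel"
proof (cases "0 \<le> l")
  case True
  have "continuous_on UNIV (\<lambda>u. \<gamma> (max 0 (min l u)))"
    using lipschitz_on_continuous_on[OF assms(1)]
    by (rule continuous_on_compose2) (use True in \<open>auto intro!: continuous_intros\<close>)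
  then have [measurable]: "(\<lambda>u. \<gamma> (max 0 (min l u))) \<in> borel_measurable borel"
    by (rule borel_measurable_continuous_onI)
  have "(\<lambda>t. \<rho> (\<gamma> (max 0 (min l t))) * indicator {0..l} t) \<in> borel_measurable borel"
    using assms(2) by measurable
  also have "(\<lambda>t. \<rho> (\<gamma> (max 0 (min l t))) * indicator {0..l} t) = (\<lambda>t. \<rho> (\<gamma> t) * indicator {0..l} t)"
    by (auto simp: fun_eq_iff indicator_def max_def)
  finally show ?thesis .
qed simp

text \<open>Both hypotheses are applied to the same curve and the same \<open>u\<close>, and the two
  covers are united. The regions may overlap, and neither has to contain much of the image.\<close>

lemma gains_Un:
  assumes "gains D f w \<rho> \<Omega>" "gains D f w \<rho>' \<Omega>'"
    and [measurable]: "\<rho> \<in> borel_measurable borel" "\<rho>' \<in> borel_measurable borel"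
  shows "gains D f w (\<lambda>x. \<rho> x + \<rho>' x) (\<Omega> \<union> \<Omega>')"
  unfolding gains_def
proof (intro allI impI)
  fix l :: real and \<gamma> and u :: "real ^ 'a \<Rightarrow> real"
  assume *: "1-lipschitz_on {0..l} \<gamma> \<and> \<gamma> ` {0..l} \<subseteq> D \<and>
        (\<exists>s\<in>{0..l}. \<exists>t\<in>{0..l}. w \<le> dist (f (\<gamma> s)) (f (\<gamma> t))) \<and> 1-lipschitz_on UNIV u"
  then obtain s t where st: "1-lipschitz_on {0..l} \<gamma>" "\<gamma> ` {0..l} \<subseteq> D" "s \<in> {0..l}" "t \<in> {0..l}"
    "w \<le> dist (f (\<gamma> s)) (f (\<gamma> t))" "1-lipschitz_on UNIV u" by metis
  obtain A where A: "A \<in> sets lborel" "u ` (f ` \<gamma> ` {0..l} \<inter> \<Omega>) \<subseteq> A"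
    "emeasure lborel A \<le> (\<integral>\<^sup>+ t \<in> {0..l}. \<rho> (\<gamma> t) \<partial>lborel)"
    by (rule gainsE[OF assms(1) st])
  obtain B where B: "B \<in> sets lborel" "u ` (f ` \<gamma> ` {0..l} \<inter> \<Omega>') \<subseteq> B"
    "emeasure lborel B \<le> (\<integral>\<^sup>+ t \<in> {0..l}. \<rho>' (\<gamma> t) \<partial>lborel)"
    by (rule gainsE[OF assms(2) st])
  have "emeasure lborel (A \<union> B) \<le> emeasure lborel A + emeasure lborel B"
    using A B by (intro emeasure_subadditive)
  also have "\<dots> \<le> (\<integral>\<^sup>+ t \<in> {0..l}. \<rho> (\<gamma> t) \<partial>lborel) + (\<integral>\<^sup>+ t \<in> {0..l}. \<rho>' (\<gamma> t) \<partial>lborel)"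
    using A B by (intro add_mono)
  also have "\<dots> = (\<integral>\<^sup>+ t. \<rho> (\<gamma> t) * indicator {0..l} t + \<rho>' (\<gamma> t) * indicator {0..l} t \<partial>lborel)"
    using st borel_curve_integrand[of l \<gamma> \<rho>] borel_curve_integrand[of l \<gamma> \<rho>']
    by (intro nn_integral_add[symmetric]) auto
  finally have "emeasure lborel (A \<union> B) \<le> (\<integral>\<^sup>+ t \<in> {0..l}. (\<rho> (\<gamma> t) + \<rho>' (\<gamma> t)) \<partial>lborel)"
    by (simp add: distrib_right)
  moreover have "u ` (f ` \<gamma> ` {0..l} \<inter> (\<Omega> \<union> \<Omega>')) \<subseteq> A \<union> B"
    unfolding Int_Un_distrib image_Un using A(2) B(2) by (rule Un_mono)
  ultimately show "\<exists>A\<in>sets lborel. u ` (f ` \<gamma> ` {0..l} \<inter> (\<Omega> \<union> \<Omega>')) \<subseteq> A \<and>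
           emeasure lborel A \<le> (\<integral>\<^sup>+ t \<in> {0..l}. (\<rho> (\<gamma> t) + \<rho>' (\<gamma> t)) \<partial>lborel)"
    using A(1) B(1) by (intro bexI[of _ "A \<union> B"] conjI) auto
qed

text \<open>
  Rings of a single small radius \<open>5\<tau>\<close> around centres in \<open>E\<close>. Every ball \<open>ball z (5\<tau>)\<close> met by the
  image of a long curve is crossed, and the extremal densities have bounded overlap because their
  supports lie over the balls \<open>ball z (10\<tau>)\<close>.
\<close>

lemma one_layer:
  fixes f :: "real ^ 'n \<Rightarrow> real ^ 'n"
  assumes D: "open D" "continuous_on D f"
    and q: "q \<in> borel_measurable lebesgue"
    and "0 < w" "0 < t"
    and E: "\<And>z r. z \<in> E \<Longrightarrow> 0 < r \<Longrightarrow> 2 * r < t \<Longrightarrow>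
      modulus (ring_preimage_paths D f z r (2 * r))
        < ennreal (1 / r ^ CARD('n)) * (\<integral>\<^sup>+ y \<in> ball z (2 * r). q y \<partial>lebesgue)"
    and K: "compact K" "K \<subseteq> closure E" and U: "open U" "K \<subseteq> U"
  obtains \<rho> \<Omega> where "\<rho> \<in> borel_measurable borel" "open \<Omega>" "K \<subseteq> \<Omega>" "gains D f w \<rho> \<Omega>"
    "(\<integral>\<^sup>+ x. \<rho> x ^ CARD('n) \<partial>lborel)
       \<le> ennreal ((11 ^ CARD('n)) ^ CARD('n) * 2 ^ CARD('n) * 11 ^ CARD('n)) * (\<integral>\<^sup>+ y \<in> U. q y \<partial>lebesgue)"
proof -
  let ?n = "CARD('n)"
  obtain d where d: "0 < d" "(\<Union>x\<in>K. ball x d) \<subseteq> U"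
    using compact_subset_open_imp_ball_epsilon_subset[OF K(1) U] by metis
  \<comment> \<open>The divisor 24 leaves room for three demands: \<open>10 * \<tau>\<close> is an
    admissible outer radius, \<open>11 * \<tau>\<close> is at most \<open>d\<close>, and no ball of
    radius \<open>10 * \<tau>\<close> contains two points at distance \<open>w\<close>.\<close>
  define \<tau> where "\<tau> = min d (min t w) / 24"
  have \<tau>: "0 < \<tau>" "24 * \<tau> \<le> d" "24 * \<tau> \<le> t" "24 * \<tau> \<le> w"
    using d(1) \<open>0 < w\<close> \<open>0 < t\<close> by (auto simp: \<tau>_def)
  \<comment> \<open>Centres must belong to \<open>E\<close>, but \<open>K\<close> lies only in its
    closure; hence centres within \<open>\<tau>\<close> of \<open>K\<close>.\<close>
  define Z where "Z = {z \<in> E. \<exists>x\<in>K. dist x z < \<tau>}"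
  have "K \<subseteq> (\<Union>z\<in>Z. ball z \<tau>)"
  proof
    fix x assume x: "x \<in> K"
    then obtain z where "z \<in> E" "dist z x < \<tau>"
      using K(2) \<tau>(1) closure_approachable[of x E] by blast
    then have "z \<in> Z" "x \<in> ball z \<tau>" using x unfolding Z_def by (auto simp: dist_commute)
    then show "x \<in> (\<Union>z\<in>Z. ball z \<tau>)" by (rule UN_I)
  qed
  then obtain Z' where Z': "Z' \<subseteq> Z" "finite Z'" "K \<subseteq> (\<Union>z\<in>Z'. ball z \<tau>)"
    using compactE_image[OF K(1), of Z "\<lambda>z. ball z \<tau>"] by (metis open_ball)
  \<comment> \<open>Disjointness of the balls of radius \<open>\<tau>\<close> controls the overlap,
    while the fivefold balls still cover \<open>K\<close>.\<close>
  obtain C where C: "C \<subseteq> Z'" "pairwise (\<lambda>z z'. disjnt (ball z \<tau>) (ball z' \<tau>)) C"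
    "K \<subseteq> (\<Union>z\<in>C. ball z (5 * \<tau>))"
    using Vitali_covering_lemma_balls[OF Z'(3), of \<tau>] \<tau>(1) by (metis order_refl)
  have finC: "finite C" using C(1) Z'(2) finite_subset by blast
  have CE: "z \<in> E" and CU: "ball z (10 * \<tau>) \<subseteq> U" if z: "z \<in> C" for z
  proof -
    have zZ: "z \<in> Z" using z C(1) Z'(1) by blast
    then show "z \<in> E" by (simp add: Z_def)
    obtain x where x: "x \<in> K" "dist x z < \<tau>" using zZ by (auto simp: Z_def)
    have "ball z (10 * \<tau>) \<subseteq> ball x d"
    proof
      fix y assume "y \<in> ball z (10 * \<tau>)"
      then show "y \<in> ball x d"
        using dist_triangle[of x y z] x(2) \<tau> by (simp add: dist_commute)
    qed
    also have "\<dots> \<subseteq> U" using d(2) x(1) by blast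
    finally show "ball z (10 * \<tau>) \<subseteq> U" .
  qed
  \<comment> \<open>Strictness of the inequality in \<open>E\<close> turns the infimum into an
    actual density.\<close>
  have "\<exists>\<rho>. \<rho> \<in> adm (ring_preimage_paths D f z (5 * \<tau>) (10 * \<tau>)) \<and>
      (\<integral>\<^sup>+ x. \<rho> x ^ ?n \<partial>lebesgue)
        < ennreal (1 / (5 * \<tau>) ^ ?n) * (\<integral>\<^sup>+ y \<in> ball z (10 * \<tau>). q y \<partial>lebesgue)"
    if "z \<in> C" for z
  proof -
    have "2 * (5 * \<tau>) = 10 * \<tau>" by simp
    then have "modulus (ring_preimage_paths D f z (5 * \<tau>) (10 * \<tau>))
        < ennreal (1 / (5 * \<tau>) ^ ?n) * (\<integral>\<^sup>+ y \<in> ball z (10 * \<tau>). q y \<partial>lebesgue)"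
      using E[OF CE[OF that], of "5 * \<tau>"] \<tau> by simp
    then show ?thesis unfolding modulus_def INF_less_iff by (simp only: Bex_def)
  qed
  then have "\<forall>z\<in>C. \<exists>\<rho>. \<rho> \<in> adm (ring_preimage_paths D f z (5 * \<tau>) (10 * \<tau>)) \<and>
      (\<integral>\<^sup>+ x. \<rho> x ^ ?n \<partial>lebesgue)
        < ennreal (1 / (5 * \<tau>) ^ ?n) * (\<integral>\<^sup>+ y \<in> ball z (10 * \<tau>). q y \<partial>lebesgue)" by (rule ballI)
  from bchoice[OF this] obtain \<rho> where \<rho>: "\<forall>z\<in>C. \<rho> z \<in> adm (ring_preimage_paths D f z (5 * \<tau>) (10 * \<tau>)) \<and>
      (\<integral>\<^sup>+ x. \<rho> z x ^ ?n \<partial>lebesgue)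
        < ennreal (1 / (5 * \<tau>) ^ ?n) * (\<integral>\<^sup>+ y \<in> ball z (10 * \<tau>). q y \<partial>lebesgue)" by (rule exE)
  have adm: "\<And>z. z \<in> C \<Longrightarrow> \<rho> z \<in> adm (ring_preimage_paths D f z (5 * \<tau>) (10 * \<tau>))"
    and small: "\<And>z. z \<in> C \<Longrightarrow> (\<integral>\<^sup>+ x. \<rho> z x ^ ?n \<partial>lebesgue)
        < ennreal (1 / (5 * \<tau>) ^ ?n) * (\<integral>\<^sup>+ y \<in> ball z (10 * \<tau>). q y \<partial>lebesgue)"
    using \<rho> by (simp_all only:)
  define W where "W z = {x \<in> D. f x \<in> ball z (10 * \<tau>)}" for z
  have openW: "open (W z)" for z
  proof -
    have "W z = D \<inter> f -` ball z (10 * \<tau>)" by (auto simp: W_def)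
    then show ?thesis using continuous_open_preimage[OF D(2,1) open_ball] by simp
  qed
  \<comment> \<open>The factor \<open>10 * \<tau>\<close> is the length of an interval containing
    the \<open>u\<close>-image of \<open>ball z (5 * \<tau>)\<close>, so one crossing of the ring
    pays for that interval.\<close>
  define p where "p z x = ennreal (10 * \<tau>) * (\<rho> z x * indicator (W z) x)" for z x
  have meas: "\<rho> z \<in> borel_measurable borel" if "z \<in> C" for z
    using adm[OF that] by (simp add: adm_def)
  have pm: "p z \<in> borel_measurable borel" if "z \<in> C" for z
    unfolding p_def using meas[OF that] openW[of z]
    by (intro borel_measurable_times_ennreal borel_measurable_indicator) auto
  define P where "P x = (\<Sum>z\<in>C. p z x)" for x
  define \<Omega> where "\<Omega> = (\<Union>z\<in>C. ball z (5 * \<tau>))"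
  have P: "P \<in> borel_measurable borel"
    unfolding P_def using pm by (intro borel_measurable_sum) auto
  have gains: "gains D f w P \<Omega>"
    unfolding gains_def
  proof (intro allI impI)
    fix l :: real and \<gamma> and u :: "real ^ 'n \<Rightarrow> real"
    assume "1-lipschitz_on {0..l} \<gamma> \<and> \<gamma> ` {0..l} \<subseteq> D \<and>
        (\<exists>s\<in>{0..l}. \<exists>t\<in>{0..l}. w \<le> dist (f (\<gamma> s)) (f (\<gamma> t))) \<and> 1-lipschitz_on UNIV u"
    then obtain a b where lip: "1-lipschitz_on {0..l} \<gamma>" and im: "\<gamma> ` {0..l} \<subseteq> D"
      and ab: "a \<in> {0..l}" "b \<in> {0..l}" "w \<le> dist (f (\<gamma> a)) (f (\<gamma> b))"
      and u: "1-lipschitz_on UNIV u" by metis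
    define M where "M = {z \<in> C. \<exists>c\<in>{0..l}. f (\<gamma> c) \<in> ball z (5 * \<tau>)}"
    have M: "M \<subseteq> C" "finite M" using finC by (auto simp: M_def)
    define A where "A = (\<Union>z\<in>M. {u z - 5 * \<tau>..u z + 5 * \<tau>})"
    have "u ` (f ` \<gamma> ` {0..l} \<inter> \<Omega>) \<subseteq> A"
    proof
      fix v assume "v \<in> u ` (f ` \<gamma> ` {0..l} \<inter> \<Omega>)"
      then obtain c z where c: "c \<in> {0..l}" "v = u (f (\<gamma> c))" "z \<in> C" "f (\<gamma> c) \<in> ball z (5 * \<tau>)"
        unfolding \<Omega>_def by auto
      have "dist (u z) (u (f (\<gamma> c))) \<le> 1 * dist z (f (\<gamma> c))"
        by (rule lipschitz_onD[OF u]) auto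
      then have "v \<in> {u z - 5 * \<tau>..u z + 5 * \<tau>}"
        using c(2,4) by (auto simp: dist_real_def abs_le_iff)
      moreover have "z \<in> M" using c by (auto simp: M_def)
      ultimately show "v \<in> A" unfolding A_def by (rule UN_I[rotated])
    qed
    moreover have "emeasure lborel A \<le> (\<integral>\<^sup>+ t \<in> {0..l}. P (\<gamma> t) \<partial>lborel)"
    proof -
      have cross: "ennreal (10 * \<tau>) \<le> (\<integral>\<^sup>+ t \<in> {0..l}. p z (\<gamma> t) \<partial>lborel)" if z: "z \<in> M" for z
      proof -
        obtain c where c: "c \<in> {0..l}" "f (\<gamma> c) \<in> ball z (5 * \<tau>)" using z by (auto simp: M_def)
        \<comment> \<open>By the choice of \<open>\<tau>\<close> the two far points of the image
          cannot both be within \<open>10 * \<tau>\<close> of \<open>z\<close>, so the curve, which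
          comes within \<open>5 * \<tau>\<close>, crosses the ring.\<close>
        have "10 * \<tau> \<le> dist (f (\<gamma> a)) z \<or> 10 * \<tau> \<le> dist (f (\<gamma> b)) z"
          using dist_triangle[of "f (\<gamma> a)" "f (\<gamma> b)" z] ab(3) \<tau>(1,4)
          by (auto simp: dist_commute)
        then obtain e where e: "e \<in> {0..l}" "10 * \<tau> \<le> dist (f (\<gamma> e)) z" using ab by metis
        have zC: "z \<in> C" using z M by blast
        have *: "1 \<le> (\<integral>\<^sup>+ t \<in> {0..l}. \<rho> z (\<gamma> t) * indicator (W z) (\<gamma> t) \<partial>lborel)"
          unfolding W_def
          by (rule admissible_crossing[OF lip im D(2,1) _ adm[OF zC] c(1) e(1)])
             (use \<tau> c e in \<open>auto simp: dist_commute\<close>)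
        have m: "(\<lambda>t. (\<rho> z (\<gamma> t) * indicator (W z) (\<gamma> t)) * indicator {0..l} t) \<in> borel_measurable borel"
          using meas[OF zC] openW[of z]
          by (intro borel_curve_integrand[OF lip, of "\<lambda>x. \<rho> z x * indicator (W z) x"]
              borel_measurable_times_ennreal borel_measurable_indicator) auto
        have "ennreal (10 * \<tau>) * 1 \<le> ennreal (10 * \<tau>) *
            (\<integral>\<^sup>+ t \<in> {0..l}. \<rho> z (\<gamma> t) * indicator (W z) (\<gamma> t) \<partial>lborel)"
          using * by (rule mult_left_mono) simp
        also have "\<dots> = (\<integral>\<^sup>+ t \<in> {0..l}. p z (\<gamma> t) \<partial>lborel)"
          unfolding p_def using m by (subst nn_integral_cmult[symmetric]) (simp_all add: mult.assoc)
        finally show ?thesis by simp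
      qed
      have "emeasure lborel A \<le> (\<Sum>z\<in>M. emeasure lborel {u z - 5 * \<tau>..u z + 5 * \<tau>})"
        unfolding A_def using M by (intro emeasure_subadditive_finite) auto
      also have "\<dots> = (\<Sum>z\<in>M. ennreal (10 * \<tau>))" using \<tau>(1) by (intro sum.cong) auto
      also have "\<dots> \<le> (\<Sum>z\<in>M. \<integral>\<^sup>+ t \<in> {0..l}. p z (\<gamma> t) \<partial>lborel)"
        by (intro sum_mono cross)
      also have "\<dots> \<le> (\<Sum>z\<in>C. \<integral>\<^sup>+ t \<in> {0..l}. p z (\<gamma> t) \<partial>lborel)"
        using M finC by (intro sum_mono2) auto
      also have "\<dots> = (\<integral>\<^sup>+ t. (\<Sum>z\<in>C. p z (\<gamma> t) * indicator {0..l} t) \<partial>lborel)"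
        using borel_curve_integrand[OF lip pm] by (intro nn_integral_sum[symmetric]) auto
      also have "\<dots> = (\<integral>\<^sup>+ t \<in> {0..l}. P (\<gamma> t) \<partial>lborel)"
        by (simp add: P_def sum_distrib_right)
      finally show ?thesis .
    qed
    moreover have "A \<in> sets lborel" unfolding A_def using M by auto
    ultimately show "\<exists>A\<in>sets lborel. u ` (f ` \<gamma> ` {0..l} \<inter> \<Omega>) \<subseteq> A \<and>
           emeasure lborel A \<le> (\<integral>\<^sup>+ t \<in> {0..l}. P (\<gamma> t) \<partial>lborel)"
      by (intro bexI[of _ A] conjI)
  qed
  have pow: "P x ^ ?n \<le> of_nat (11 ^ ?n) ^ ?n * (\<Sum>z\<in>C. p z x ^ ?n)" for x
    unfolding P_def
  proof (rule sum_power_le_card[OF finC])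
    have "{z \<in> C. p z x \<noteq> 0} \<subseteq> {z \<in> C. f x \<in> ball z (10 * \<tau>)}"
      by (auto simp: p_def W_def indicator_def split: if_splits)
    then have "card {z \<in> C. p z x \<noteq> 0} \<le> card {z \<in> C. f x \<in> ball z (10 * \<tau>)}"
      using finC by (intro card_mono) auto
    also have "\<dots> \<le> 11 ^ ?n" by (rule card_disjoint_balls_le[OF finC C(2) \<tau>(1)])
    finally show "card {z \<in> C. p z x \<noteq> 0} \<le> 11 ^ ?n" .
  qed simp
  have each: "(\<integral>\<^sup>+ x. p z x ^ ?n \<partial>lborel) \<le> 2 ^ ?n * (\<integral>\<^sup>+ y \<in> ball z (10 * \<tau>). q y \<partial>lebesgue)"
    if z: "z \<in> C" for z
  proof -
    have "(\<integral>\<^sup>+ x. p z x ^ ?n \<partial>lborel) \<le> (\<integral>\<^sup>+ x. ennreal ((10 * \<tau>) ^ ?n) * \<rho> z x ^ ?n \<partial>lborel)"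
    proof (rule nn_integral_mono)
      fix x
      have "p z x \<le> ennreal (10 * \<tau>) * \<rho> z x"
        unfolding p_def by (intro mult_left_mono) (auto simp: indicator_def)
      then have "p z x ^ ?n \<le> (ennreal (10 * \<tau>) * \<rho> z x) ^ ?n" by (rule power_mono) simp
      also have "\<dots> = ennreal ((10 * \<tau>) ^ ?n) * \<rho> z x ^ ?n"
        using \<tau>(1) by (subst power_mult_distrib) (simp add: ennreal_power)
      finally show "p z x ^ ?n \<le> ennreal ((10 * \<tau>) ^ ?n) * \<rho> z x ^ ?n" .
    qed
    also have "\<dots> = ennreal ((10 * \<tau>) ^ ?n) * (\<integral>\<^sup>+ x. \<rho> z x ^ ?n \<partial>lebesgue)"
      using meas[OF z] by (simp add: nn_integral_cmult nn_integral_completion)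
    also have "\<dots> \<le> ennreal ((10 * \<tau>) ^ ?n) *
        (ennreal (1 / (5 * \<tau>) ^ ?n) * (\<integral>\<^sup>+ y \<in> ball z (10 * \<tau>). q y \<partial>lebesgue))"
      using small[OF z] by (intro mult_left_mono) auto
    also have "\<dots> = ennreal ((10 * \<tau>) ^ ?n * (1 / (5 * \<tau>) ^ ?n)) * (\<integral>\<^sup>+ y \<in> ball z (10 * \<tau>). q y \<partial>lebesgue)"
      using \<tau>(1) by (subst ennreal_mult) (auto simp: mult.assoc)
    \<comment> \<open>The radius cancels, and only the ratio 2 of the two radii survives.\<close>
    also have "(10 * \<tau>) ^ ?n * (1 / (5 * \<tau>) ^ ?n) = 2 ^ ?n"
      using \<tau>(1) by (simp flip: power_divide)
    finally show ?thesis by (simp flip: ennreal_power)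
  qed
  have qm: "(\<lambda>y. q y * indicator S y) \<in> borel_measurable lebesgue" if "open S" for S
    using that by (intro borel_measurable_times_ennreal q borel_measurable_indicator sets_completionI_sets) auto
  have "(\<integral>\<^sup>+ x. P x ^ ?n \<partial>lborel) \<le> (\<integral>\<^sup>+ x. of_nat (11 ^ ?n) ^ ?n * (\<Sum>z\<in>C. p z x ^ ?n) \<partial>lborel)"
    by (intro nn_integral_mono pow)
  also have "\<dots> = of_nat (11 ^ ?n) ^ ?n * (\<Sum>z\<in>C. \<integral>\<^sup>+ x. p z x ^ ?n \<partial>lborel)"
    using pm by (subst nn_integral_cmult) (auto simp: nn_integral_sum intro!: borel_measurable_sum)
  also have "\<dots> \<le> of_nat (11 ^ ?n) ^ ?n * (\<Sum>z\<in>C. 2 ^ ?n * (\<integral>\<^sup>+ y \<in> ball z (10 * \<tau>). q y \<partial>lebesgue))"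
    by (intro mult_left_mono sum_mono each) auto
  also have "\<dots> = of_nat (11 ^ ?n) ^ ?n * 2 ^ ?n * (\<integral>\<^sup>+ y. (\<Sum>z\<in>C. q y * indicator (ball z (10 * \<tau>)) y) \<partial>lebesgue)"
    using qm by (subst nn_integral_sum) (auto simp: sum_distrib_left mult.assoc)
  also have "\<dots> \<le> of_nat (11 ^ ?n) ^ ?n * 2 ^ ?n * (\<integral>\<^sup>+ y. of_nat (11 ^ ?n) * (q y * indicator U y) \<partial>lebesgue)"
  proof (intro mult_left_mono nn_integral_mono)
    fix y
    have "(\<Sum>z\<in>C. q y * indicator (ball z (10 * \<tau>)) y) = (\<Sum>z\<in>{z \<in> C. y \<in> ball z (10 * \<tau>)}. q y)"
      using finC by (intro sum.mono_neutral_cong_right) auto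
    also have "\<dots> = of_nat (card {z \<in> C. y \<in> ball z (10 * \<tau>)}) * q y" by simp
    also have "\<dots> \<le> of_nat (11 ^ ?n) * (q y * indicator U y)"
    proof (cases "y \<in> U")
      case True
      have "of_nat (card {z \<in> C. y \<in> ball z (10 * \<tau>)}) \<le> (of_nat (11 ^ ?n) :: ennreal)"
        using card_disjoint_balls_le[OF finC C(2) \<tau>(1), of y] by (rule of_nat_mono)
      then show ?thesis using True by (simp add: mult_right_mono)
    next
      case False
      then have "{z \<in> C. y \<in> ball z (10 * \<tau>)} = {}" using CU by blast
      then show ?thesis by (simp only: card.empty) simp
    qed
    finally show "(\<Sum>z\<in>C. q y * indicator (ball z (10 * \<tau>)) y) \<le> of_nat (11 ^ ?n) * (q y * indicator U y)" .
  qed auto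
  also have "\<dots> = of_nat (11 ^ ?n) ^ ?n * 2 ^ ?n * of_nat (11 ^ ?n) * (\<integral>\<^sup>+ y \<in> U. q y \<partial>lebesgue)"
    using qm[OF U(1)] by (subst nn_integral_cmult) (auto simp: mult.assoc)
  \<comment> \<open>The three factors come from the power of a sum with at most
    \<open>11 ^ n\<close> nonzero terms, from the ratio of the radii, and from the overlap of the
    balls over which \<open>q\<close> is integrated.\<close>
  also have "of_nat (11 ^ ?n) ^ ?n * 2 ^ ?n * of_nat (11 ^ ?n) = ennreal ((11 ^ ?n) ^ ?n * 2 ^ ?n * 11 ^ ?n)"
    by (simp add: ennreal_mult flip: ennreal_power)
  finally have bound: "(\<integral>\<^sup>+ x. P x ^ ?n \<partial>lborel)
      \<le> ennreal ((11 ^ ?n) ^ ?n * 2 ^ ?n * 11 ^ ?n) * (\<integral>\<^sup>+ y \<in> U. q y \<partial>lebesgue)" .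
  show ?thesis
  proof (rule that[OF P _ _ gains bound])
    show "open \<Omega>" by (simp add: \<Omega>_def open_UN)
    show "K \<subseteq> \<Omega>" using C(3) by (simp add: \<Omega>_def)
  qed
qed

section \<open>Exhaustion by layers of rings\<close>

text \<open>The larger of \<open>a / s\<close> and \<open>b / d\<close> carries the whole sum. For
  small \<open>d\<close> the weight of \<open>a\<close> is close to 1, so that repeated addition of
  small densities does not blow up the constant.\<close>

lemma power_add_le_weighted:
  fixes a b :: ennreal
  assumes "0 < s" "0 < d"
  shows "(a + b) ^ n \<le> ennreal (((s + d) / s) ^ n) * a ^ n + ennreal (((s + d) / d) ^ n) * b ^ n"
proof -
  have *: "(a + b) ^ n \<le> ennreal (((s + d) / s) ^ n) * a ^ n"
    if sd: "0 < s" "0 < d" and le: "ennreal s * b \<le> ennreal d * a" for s d :: real and a b :: ennreal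
  proof -
    have "ennreal s * (a + b) \<le> ennreal (s + d) * a"
      using le sd by (simp add: distrib_left distrib_right add_left_mono)
    then have "ennreal (1 / s) * (ennreal s * (a + b)) \<le> ennreal (1 / s) * (ennreal (s + d) * a)"
      by (rule mult_left_mono) simp
    moreover have "ennreal (1 / s) * (ennreal s * (a + b)) = a + b"
      using sd by (simp flip: mult.assoc ennreal_mult)
    moreover have "ennreal (1 / s) * (ennreal (s + d) * a) = ennreal ((s + d) / s) * a"
      using sd by (simp flip: mult.assoc ennreal_mult del: ennreal_plus)
    ultimately have "a + b \<le> ennreal ((s + d) / s) * a" by simp
    then have "(a + b) ^ n \<le> (ennreal ((s + d) / s) * a) ^ n" by (rule power_mono) simp
    then show ?thesis using sd by (simp add: power_mult_distrib ennreal_power)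
  qed
  show ?thesis
  proof (cases "ennreal s * b \<le> ennreal d * a")
    case True
    show ?thesis by (rule order_trans[OF *[OF assms True]]) (rule add_increasing2; simp)
  next
    case False
    have "(b + a) ^ n \<le> ennreal (((d + s) / d) ^ n) * b ^ n"
      using False by (intro * assms) simp
    then show ?thesis
      by (intro order_trans[OF _ add_increasing[OF _ order_refl]]) (simp_all add: add.commute)
  qed
qed

text \<open>
  The admissible radius of the ring inequality has no uniform lower bound. The set \<open>V\<close> is exhausted
  by the closures of the sets \<open>E m\<close> on which radii below \<open>1 / (m + 1)\<close> are admissible; the layer
  added in step \<open>k + 1\<close> only uses rings outside \<open>closure (E (m k))\<close>, where the integral of \<open>q\<close> is tiny.
\<close>

lemma all_layers:
  fixes f :: "real ^ 'n \<Rightarrow> real ^ 'n"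
  assumes D: "open D" "continuous_on D f"
    and q: "q \<in> borel_measurable lebesgue"
    and "0 < w"
    and good: "\<And>z. \<exists>t>0. \<forall>r. 0 < r \<longrightarrow> 2 * r < t \<longrightarrow>
      modulus (ring_preimage_paths D f z r (2 * r))
        < ennreal (1 / r ^ CARD('n)) * (\<integral>\<^sup>+ y \<in> ball z (2 * r). q y \<partial>lebesgue)"
    and V: "compact V" "open V'" "V \<subseteq> V'" and fin: "(\<integral>\<^sup>+ y \<in> V'. q y \<partial>lebesgue) < top"
  obtains \<rho> \<Omega> where "\<rho> \<in> borel_measurable borel" "V \<subseteq> \<Omega>" "gains D f w \<rho> \<Omega>"
    "(\<integral>\<^sup>+ x. \<rho> x ^ CARD('n) \<partial>lborel)
       \<le> ennreal (2 ^ Suc CARD('n) * ((11 ^ CARD('n)) ^ CARD('n) * 2 ^ CARD('n) * 11 ^ CARD('n)))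
          * (\<integral>\<^sup>+ y \<in> V'. q y \<partial>lebesgue)"
proof -
  let ?n = "CARD('n)"
  define \<kappa> :: real where "\<kappa> = (11 ^ ?n) ^ ?n * 2 ^ ?n * 11 ^ ?n"
  have \<kappa>: "0 \<le> \<kappa>" by (simp add: \<kappa>_def)
  define A where "A = (\<integral>\<^sup>+ y \<in> V'. q y \<partial>lebesgue)"
  define E where "E m = {z. \<forall>r. 0 < r \<longrightarrow> 2 * r < 1 / real (Suc m) \<longrightarrow>
      modulus (ring_preimage_paths D f z r (2 * r))
        < ennreal (1 / r ^ ?n) * (\<integral>\<^sup>+ y \<in> ball z (2 * r). q y \<partial>lebesgue)}" for m
  have E_mono: "E m \<subseteq> E m'" if "m \<le> m'" for m m'
  proof -
    have "1 / real (Suc m') \<le> 1 / real (Suc m)" using that by (intro divide_left_mono) auto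
    then show ?thesis unfolding E_def by (intro Collect_mono allI impI) (meson less_le_trans)
  qed
  have E_ex: "\<exists>m. z \<in> E m" for z
  proof -
    obtain t where t: "0 < t" "\<forall>r. 0 < r \<longrightarrow> 2 * r < t \<longrightarrow>
      modulus (ring_preimage_paths D f z r (2 * r))
        < ennreal (1 / r ^ ?n) * (\<integral>\<^sup>+ y \<in> ball z (2 * r). q y \<partial>lebesgue)"
      using good[of z] by (elim exE conjE)
    obtain m where "1 / real (Suc m) < t" using t(1) nat_approx_posE by blast
    then have "z \<in> E m" unfolding E_def using t(2) by (auto intro: less_trans)
    then show ?thesis ..
  qed
  define \<mu> where "\<mu> = density lebesgue q"
  have \<mu>: "emeasure \<mu> S = (\<integral>\<^sup>+ y \<in> S. q y \<partial>lebesgue)" if "open S" for S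
    unfolding \<mu>_def using that by (intro emeasure_density q sets_completionI_sets) auto
  \<comment> \<open>Removing closures keeps these sets open, so they can serve as \<open>U\<close>
    in \<open>one_layer\<close>. They decrease to the empty set, and finiteness of the integral
    makes their measures tend to 0.\<close>
  define S where "S m = V' - closure (E m)" for m
  have openS: "open (S m)" for m unfolding S_def using V(2) by (intro open_Diff) auto
  have lim: "(\<lambda>m. emeasure \<mu> (S m)) \<longlonglongrightarrow> 0"
  proof -
    have "emeasure \<mu> (S m) \<le> A" for m
      unfolding A_def \<mu>[OF V(2), symmetric]
      using V(2) by (intro emeasure_mono) (auto simp: S_def \<mu>_def intro!: sets_completionI_sets)
    then have "emeasure \<mu> (S m) \<noteq> \<infinity>" for m
      using fin unfolding A_def[symmetric] by (metis infinity_ennreal_def leD)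
    moreover have "decseq S"
      unfolding decseq_def S_def using E_mono closure_mono by blast
    moreover have "range S \<subseteq> sets \<mu>"
      using openS by (auto simp: \<mu>_def intro!: sets_completionI_sets)
    ultimately have "(\<lambda>m. emeasure \<mu> (S m)) \<longlonglongrightarrow> emeasure \<mu> (\<Inter>m. S m)"
      by (intro Lim_emeasure_decseq)
    moreover have "(\<Inter>m. S m) = {}"
    proof -
      have "\<exists>m. z \<notin> S m" for z using E_ex[of z] closure_subset unfolding S_def by blast
      then show ?thesis by auto
    qed
    ultimately show ?thesis by simp
  qed
  \<comment> \<open>With \<open>d = 1 / 2 ^ Suc k\<close> this is \<open>d ^ Suc n * A\<close>:
    \<open>n\<close> powers cancel the weight \<open>((s k + d) / d) ^ n\<close> of the new density,
    and the last one becomes the increment of \<open>s\<close>.\<close>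
  define \<delta> where "\<delta> k = ennreal (1 / 2 ^ (Suc k * Suc ?n)) * A" for k
  have "\<exists>m\<ge>k. emeasure \<mu> (S m) \<le> \<delta> k" for k
  \<comment> \<open>For \<open>A = 0\<close> the threshold is 0 and convergence yields no strict
    inequality; but then all the measures vanish.\<close>
  proof (cases "A = 0")
    case True
    have "emeasure \<mu> (S k) \<le> A"
      unfolding A_def \<mu>[OF V(2), symmetric]
      using V(2) by (intro emeasure_mono) (auto simp: S_def \<mu>_def intro!: sets_completionI_sets)
    then show ?thesis using True by (intro exI[of _ k]) simp
  next
    case False
    then have "0 < \<delta> k" unfolding \<delta>_def by (simp add: ennreal_zero_less_mult_iff zero_less_iff_neq_zero)
    with lim have "eventually (\<lambda>m. emeasure \<mu> (S m) < \<delta> k) sequentially"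
      by (rule order_tendstoD(2))
    then obtain N where "\<And>m. N \<le> m \<Longrightarrow> emeasure \<mu> (S m) < \<delta> k"
      unfolding eventually_sequentially by metis
    then show ?thesis by (intro exI[of _ "max k N"]) (auto intro: less_imp_le)
  qed
  then obtain m where m: "\<And>k. k \<le> m k" "\<And>k. emeasure \<mu> (S (m k)) \<le> \<delta> k" by metis
  \<comment> \<open>Partial sums of the geometric series, starting at 1 and bounded by 2; they
    produce the factor \<open>2 ^ Suc n\<close> of the conclusion.\<close>
  define s :: "nat \<Rightarrow> real" where "s k = 2 - 1 / 2 ^ k" for k
  have s: "1 \<le> s k" "s k \<le> 2" "s (Suc k) = s k + 1 / 2 ^ Suc k" for k
    by (auto simp: s_def field_simps)
  define P where "P k X \<longleftrightarrow> (case X of (\<rho>, \<Omega>) \<Rightarrow> \<rho> \<in> borel_measurable borel \<and> open \<Omega> \<and>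
      V \<inter> closure (E (m k)) \<subseteq> \<Omega> \<and> gains D f w \<rho> \<Omega> \<and>
      (\<integral>\<^sup>+ x. \<rho> x ^ ?n \<partial>lborel) \<le> ennreal (s k ^ Suc ?n * \<kappa>) * A)"
    for k and X :: "(real ^ 'n \<Rightarrow> ennreal) \<times> (real ^ 'n) set"
  have layer: "\<exists>\<rho> \<Omega>. \<rho> \<in> borel_measurable borel \<and> open \<Omega> \<and> K \<subseteq> \<Omega> \<and> gains D f w \<rho> \<Omega> \<and>
      (\<integral>\<^sup>+ x. \<rho> x ^ ?n \<partial>lborel) \<le> ennreal \<kappa> * emeasure \<mu> U"
    if K: "compact K" "K \<subseteq> closure (E k)" "open U" "K \<subseteq> U" for K k U
  proof -
    have "0 < 1 / real (Suc k)" by simp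
    moreover have "modulus (ring_preimage_paths D f z r (2 * r))
        < ennreal (1 / r ^ ?n) * (\<integral>\<^sup>+ y \<in> ball z (2 * r). q y \<partial>lebesgue)"
      if "z \<in> E k" "0 < r" "2 * r < 1 / real (Suc k)" for z r
      using that unfolding E_def by simp
    ultimately obtain \<rho> \<Omega> where *: "\<rho> \<in> borel_measurable borel" "open \<Omega>" "K \<subseteq> \<Omega>" "gains D f w \<rho> \<Omega>"
    "(\<integral>\<^sup>+ x. \<rho> x ^ ?n \<partial>lborel)
       \<le> ennreal ((11 ^ ?n) ^ ?n * 2 ^ ?n * 11 ^ ?n) * (\<integral>\<^sup>+ y \<in> U. q y \<partial>lebesgue)"
      by (rule one_layer[OF D q \<open>0 < w\<close> _ _ K])
    then show ?thesis unfolding \<mu>[OF K(3)] \<kappa>_def by (intro exI[of _ \<rho>] exI[of _ \<Omega>] conjI)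
  qed
  have base: "\<exists>X. P 0 X"
  proof -
    obtain \<rho> \<Omega> where "\<rho> \<in> borel_measurable borel" "open \<Omega>" "V \<inter> closure (E (m 0)) \<subseteq> \<Omega>"
      "gains D f w \<rho> \<Omega>" "(\<integral>\<^sup>+ x. \<rho> x ^ ?n \<partial>lborel) \<le> ennreal \<kappa> * emeasure \<mu> V'"
      using layer[of "V \<inter> closure (E (m 0))" "m 0" V'] V by (auto simp: compact_Int_closed)
    then have "P 0 (\<rho>, \<Omega>)" by (simp add: P_def s_def \<mu>[OF V(2)] A_def)
    then show ?thesis ..
  qed
  have step: "\<exists>Y. P (Suc k) Y \<and> snd X \<subseteq> snd Y" if X: "P k X" for k X
  proof -
    obtain \<rho> \<Omega> where X_eq: "X = (\<rho>, \<Omega>)" by (cases X)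
    then have \<rho>: "\<rho> \<in> borel_measurable borel" "open \<Omega>" "V \<inter> closure (E (m k)) \<subseteq> \<Omega>"
      "gains D f w \<rho> \<Omega>" "(\<integral>\<^sup>+ x. \<rho> x ^ ?n \<partial>lborel) \<le> ennreal (s k ^ Suc ?n * \<kappa>) * A"
      using X unfolding P_def by simp_all
    \<comment> \<open>Only points not yet covered are treated. By the invariant they avoid
      \<open>closure (E (m k))\<close>, hence lie in \<open>S (m k)\<close>, where the integral of
      \<open>q\<close> is at most \<open>\<delta> k\<close>.\<close>
    define K where "K = V \<inter> closure (E (m (Suc k))) - \<Omega>"
    have "compact K" unfolding K_def
      using V(1) \<rho>(2) by (intro compact_diff compact_Int_closed) auto
    moreover have "K \<subseteq> closure (E (m (Suc k)))" by (auto simp: K_def)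
    moreover have "K \<subseteq> S (m k)" using V(3) \<rho>(3) by (auto simp: K_def S_def)
    ultimately have "\<exists>\<rho> \<Omega>. \<rho> \<in> borel_measurable borel \<and> open \<Omega> \<and> K \<subseteq> \<Omega> \<and> gains D f w \<rho> \<Omega> \<and>
      (\<integral>\<^sup>+ x. \<rho> x ^ ?n \<partial>lborel) \<le> ennreal \<kappa> * emeasure \<mu> (S (m k))"
      by (intro layer openS)
    then obtain \<rho>' \<Omega>' where \<rho>': "\<rho>' \<in> borel_measurable borel" "open \<Omega>'" "K \<subseteq> \<Omega>'"
      "gains D f w \<rho>' \<Omega>'" "(\<integral>\<^sup>+ x. \<rho>' x ^ ?n \<partial>lborel) \<le> ennreal \<kappa> * emeasure \<mu> (S (m k))"
      by (elim exE conjE)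
    have [measurable]: "\<rho> \<in> borel_measurable borel" "\<rho>' \<in> borel_measurable borel" by fact+
    let ?d = "1 / 2 ^ Suc k :: real"
    have d: "0 < ?d" and sk: "0 < s k" using s(1)[of k] by auto
    have "(\<integral>\<^sup>+ x. (\<rho> x + \<rho>' x) ^ ?n \<partial>lborel) \<le>
        (\<integral>\<^sup>+ x. ennreal (((s k + ?d) / s k) ^ ?n) * \<rho> x ^ ?n
           + ennreal (((s k + ?d) / ?d) ^ ?n) * \<rho>' x ^ ?n \<partial>lborel)"
      by (intro nn_integral_mono power_add_le_weighted sk d)
    also have "\<dots> = ennreal (((s k + ?d) / s k) ^ ?n) * (\<integral>\<^sup>+ x. \<rho> x ^ ?n \<partial>lborel)
           + ennreal (((s k + ?d) / ?d) ^ ?n) * (\<integral>\<^sup>+ x. \<rho>' x ^ ?n \<partial>lborel)"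
      by (subst nn_integral_add) (auto simp: nn_integral_cmult)
    also have "\<dots> \<le> ennreal (((s k + ?d) / s k) ^ ?n) * (ennreal (s k ^ Suc ?n * \<kappa>) * A)
           + ennreal (((s k + ?d) / ?d) ^ ?n) * (ennreal \<kappa> * \<delta> k)"
      using \<rho>(5) order_trans[OF \<rho>'(5) mult_left_mono[OF m(2)]]
      by (intro add_mono mult_left_mono) auto
    also have "\<dots> = ennreal (((s k + ?d) / s k) ^ ?n * (s k ^ Suc ?n * \<kappa>)
           + ((s k + ?d) / ?d) ^ ?n * (\<kappa> * (1 / 2 ^ (Suc k * Suc ?n)))) * A"
    proof -
      have comb: "ennreal a * (ennreal b * A) + ennreal c * (ennreal \<kappa> * (ennreal e * A))
          = ennreal (a * b + c * (\<kappa> * e)) * A" if "0 \<le> a" "0 \<le> b" "0 \<le> c" "0 \<le> e" for a b c e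
        using that \<kappa> by (simp add: ennreal_mult distrib_right mult.assoc)
      show ?thesis unfolding \<delta>_def by (rule comb) (use sk \<kappa> d in simp_all)
    qed
    \<comment> \<open>Both terms contain \<open>(s k + d) ^ n * \<kappa>\<close>, once with the
      factor \<open>s k\<close> and once with \<open>d\<close>; these factors add up to
      \<open>s (Suc k)\<close>.\<close>
    also have "((s k + ?d) / s k) ^ ?n * (s k ^ Suc ?n * \<kappa>)
           + ((s k + ?d) / ?d) ^ ?n * (\<kappa> * (1 / 2 ^ (Suc k * Suc ?n))) = s (Suc k) ^ Suc ?n * \<kappa>"
    proof -
      have "((s k + ?d) / s k) ^ ?n * (s k ^ Suc ?n * \<kappa>) = (s k + ?d) ^ ?n * \<kappa> * s k"
        using sk by (simp add: power_divide)
      moreover have "(1 / 2 ^ (Suc k * Suc ?n) :: real) = ?d ^ ?n * ?d"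
        by (simp only: power_mult power_Suc2 power_one_over[symmetric] power_divide) (simp add: power_divide)
      then have "((s k + ?d) / ?d) ^ ?n * (\<kappa> * (1 / 2 ^ (Suc k * Suc ?n))) = (s k + ?d) ^ ?n * \<kappa> * ?d"
        using d by (simp only: power_divide[of "s k + ?d"]) (simp add: mult_ac)
      ultimately show ?thesis unfolding s(3) by (simp add: algebra_simps)
    qed
    finally have "(\<integral>\<^sup>+ x. (\<rho> x + \<rho>' x) ^ ?n \<partial>lborel) \<le> ennreal (s (Suc k) ^ Suc ?n * \<kappa>) * A" .
    moreover have "V \<inter> closure (E (m (Suc k))) \<subseteq> \<Omega> \<union> \<Omega>'" using \<rho>'(3) by (auto simp: K_def)
    moreover have "gains D f w (\<lambda>x. \<rho> x + \<rho>' x) (\<Omega> \<union> \<Omega>')"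
      by (intro gains_Un \<rho> \<rho>')
    ultimately have "P (Suc k) (\<lambda>x. \<rho> x + \<rho>' x, \<Omega> \<union> \<Omega>')"
      unfolding P_def using \<rho>(1,2) \<rho>'(1,2) by (simp add: open_Un)
    then show ?thesis by (intro exI[of _ "(\<lambda>x. \<rho> x + \<rho>' x, \<Omega> \<union> \<Omega>')"]) (simp add: X_eq)
  qed
  obtain X where X: "\<And>k. P k (X k)" "\<And>k. snd (X k) \<subseteq> snd (X (Suc k))"
    using dependent_nat_choice[of P "\<lambda>_ X Y. snd X \<subseteq> snd Y", OF base step] by metis
  have PX: "fst (X k) \<in> borel_measurable borel" "open (snd (X k))"
      "V \<inter> closure (E (m k)) \<subseteq> snd (X k)" "gains D f w (fst (X k)) (snd (X k))"
      "(\<integral>\<^sup>+ x. fst (X k) x ^ ?n \<partial>lborel) \<le> ennreal (s k ^ Suc ?n * \<kappa>) * A" for k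
    using X(1)[of k] unfolding P_def by (simp_all add: case_prod_beta)
  have mono: "snd (X j) \<subseteq> snd (X k)" if "j \<le> k" for j k
    using lift_Suc_mono_le[of "\<lambda>k. snd (X k)", OF X(2) that] .
  \<comment> \<open>Every point of \<open>V\<close> enters at some stage, and the regions are open
    and increasing. By compactness a single stage covers \<open>V\<close>, so no limit of densities
    has to be taken.\<close>
  have "V \<subseteq> (\<Union>k\<in>UNIV. snd (X k))"
  proof
    fix z assume z: "z \<in> V"
    obtain j where "z \<in> E j" using E_ex by metis
    then have "z \<in> E (m j)" using E_mono[OF m(1)] by blast
    then have "z \<in> snd (X j)" using PX(3)[of j] z closure_subset by blast
    then show "z \<in> (\<Union>k\<in>UNIV. snd (X k))" by blast
  qed
  then obtain J where J: "finite J" "V \<subseteq> (\<Union>k\<in>J. snd (X k))"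
    using compactE_image[OF V(1), of UNIV "\<lambda>k. snd (X k)"] PX(2) by metis
  define k where "k = Max (insert 0 J)"
  have "V \<subseteq> snd (X k)"
  proof
    fix z assume "z \<in> V"
    then obtain j where "j \<in> J" "z \<in> snd (X j)" using J(2) by blast
    moreover have "j \<le> k" using \<open>j \<in> J\<close> J(1) by (simp add: k_def)
    ultimately show "z \<in> snd (X k)" using mono by blast
  qed
  moreover have "(\<integral>\<^sup>+ x. fst (X k) x ^ ?n \<partial>lborel) \<le> ennreal (2 ^ Suc ?n * \<kappa>) * A"
  proof (rule order_trans[OF PX(5)])
    have "s k ^ Suc ?n \<le> 2 ^ Suc ?n" using s[of k] by (intro power_mono) auto
    then show "ennreal (s k ^ Suc ?n * \<kappa>) * A \<le> ennreal (2 ^ Suc ?n * \<kappa>) * A"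
      using \<kappa> by (intro mult_right_mono ennreal_leI) auto
  qed
  ultimately show ?thesis
    using PX(1,4) unfolding A_def \<kappa>_def by (intro that)
qed

section \<open>From the inverse Poletsky inequality to a density that charges long images\<close>

text \<open>The constant \<open>1 / r\<close> has integral 1 between \<open>r\<close> and
  \<open>2 * r\<close>. Replacing \<open>Q\<close> by \<open>Q + 1\<close> makes the estimate strict
  even where \<open>Q\<close> vanishes, since the ball has positive measure and the integral of
  \<open>Q\<close> over it is finite.\<close>

lemma inverse_Poletsky_modulus_less:
  fixes f :: "real ^ 'n \<Rightarrow> real ^ 'n"
  assumes "inverse_Poletsky D Q f z" and Q: "Q \<in> borel_measurable lebesgue"
    and fin: "\<And>K. compact K \<Longrightarrow> (\<integral>\<^sup>+ z \<in> K. Q z \<partial>lebesgue) < \<infinity>"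
  shows "\<exists>t>0. \<forall>r. 0 < r \<longrightarrow> 2 * r < t \<longrightarrow>
      modulus (ring_preimage_paths D f z r (2 * r))
        < ennreal (1 / r ^ CARD('n)) * (\<integral>\<^sup>+ y \<in> ball z (2 * r). (Q y + 1) \<partial>lebesgue)"
proof -
  let ?n = "CARD('n)"
  obtain r0 where "0 < r0" and P: "\<And>r1 r2 \<eta>. 0 < r1 \<and> r1 < r2 \<and> r2 < r0 \<and>
          \<eta> \<in> borel_measurable (lebesgue_on {r1<..<r2}) \<and>
          1 \<le> (\<integral>\<^sup>+ r. \<eta> r \<partial>lebesgue_on {r1<..<r2}) \<Longrightarrow>
          modulus (ring_preimage_paths D f z r1 r2)
            \<le> (\<integral>\<^sup>+ y \<in> f ` D \<inter> annulus z r1 r2. Q y * \<eta> (dist y z) ^ ?n \<partial>lebesgue)"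
    using assms(1) unfolding inverse_Poletsky_def by (elim exE conjE) simp
  have "modulus (ring_preimage_paths D f z r (2 * r))
        < ennreal (1 / r ^ ?n) * (\<integral>\<^sup>+ y \<in> ball z (2 * r). (Q y + 1) \<partial>lebesgue)"
    if r: "0 < r" "2 * r < r0" for r
  proof -
    have sB: "ball z (2 * r) \<in> sets lebesgue" by (intro sets_completionI_sets) auto
    have "(\<integral>\<^sup>+ t. ennreal (1 / r) \<partial>lebesgue_on {r<..<2 * r}) = ennreal (1 / r) * ennreal r"
      using r by (simp add: nn_integral_cmult_indicator emeasure_restrict_space)
    also have "\<dots> = 1" using r by (simp flip: ennreal_mult)
    finally have "modulus (ring_preimage_paths D f z r (2 * r))
        \<le> (\<integral>\<^sup>+ y \<in> f ` D \<inter> annulus z r (2 * r). Q y * ennreal (1 / r) ^ ?n \<partial>lebesgue)"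
      using r by (intro P) auto
    also have "\<dots> \<le> (\<integral>\<^sup>+ y. ennreal (1 / r ^ ?n) * (Q y * indicator (ball z (2 * r)) y) \<partial>lebesgue)"
      using r by (intro nn_integral_mono)
        (auto simp: indicator_def annulus_def dist_commute ennreal_power power_one_over mult.commute)
    also have "\<dots> = ennreal (1 / r ^ ?n) * (\<integral>\<^sup>+ y \<in> ball z (2 * r). Q y \<partial>lebesgue)"
      using Q sB by (intro nn_integral_cmult borel_measurable_times_ennreal borel_measurable_indicator)
    also have "\<dots> < ennreal (1 / r ^ ?n) * (\<integral>\<^sup>+ y \<in> ball z (2 * r). (Q y + 1) \<partial>lebesgue)"
    proof -
      have "(\<integral>\<^sup>+ y \<in> ball z (2 * r). (Q y + 1) \<partial>lebesgue)
          = (\<integral>\<^sup>+ y. Q y * indicator (ball z (2 * r)) y + indicator (ball z (2 * r)) y \<partial>lebesgue)"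
        by (simp add: distrib_right)
      also have "\<dots> = (\<integral>\<^sup>+ y \<in> ball z (2 * r). Q y \<partial>lebesgue) + emeasure lebesgue (ball z (2 * r))"
        using Q sB by (subst nn_integral_add)
          (auto intro!: borel_measurable_times_ennreal borel_measurable_indicator)
      finally have eq: "(\<integral>\<^sup>+ y \<in> ball z (2 * r). (Q y + 1) \<partial>lebesgue)
          = (\<integral>\<^sup>+ y \<in> ball z (2 * r). Q y \<partial>lebesgue) + emeasure lebesgue (ball z (2 * r))" .
      have "(\<integral>\<^sup>+ y \<in> ball z (2 * r). Q y \<partial>lebesgue) \<le> (\<integral>\<^sup>+ y \<in> cball z (2 * r). Q y \<partial>lebesgue)"
        by (intro nn_integral_mono) (auto simp: indicator_def)
      also have "\<dots> < \<infinity>" by (rule fin) simp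
      finally obtain a where a: "(\<integral>\<^sup>+ y \<in> ball z (2 * r). Q y \<partial>lebesgue) = ennreal a" "0 \<le> a"
        by (cases "\<integral>\<^sup>+ y \<in> ball z (2 * r). Q y \<partial>lebesgue") auto
      define v where "v = unit_ball_vol (real ?n) * (2 * r) ^ ?n"
      have v: "emeasure lebesgue (ball z (2 * r)) = ennreal v" "0 < v"
        using r by (simp_all add: emeasure_ball v_def)
      define c where "c = 1 / r ^ ?n"
      have c: "0 < c" using r by (simp add: c_def)
      have "ennreal c * ennreal a = ennreal (c * a)"
        using a c by (simp add: ennreal_mult)
      also have "\<dots> < ennreal (c * (a + v))" using a c v by (subst ennreal_less_iff) auto
      also have "\<dots> = ennreal c * (ennreal a + ennreal v)" using a c v by (simp add: ennreal_mult)
      finally show ?thesis unfolding eq a v(1) c_def .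
    qed
    finally show ?thesis .
  qed
  then show ?thesis using \<open>0 < r0\<close> by (intro exI[of _ r0] conjI allI impI)
qed

lemma ball_integral_add_one_finite:
  fixes Q :: "real ^ 'n \<Rightarrow> ennreal"
  assumes Q: "Q \<in> borel_measurable lebesgue"
    and fin: "\<And>K. compact K \<Longrightarrow> (\<integral>\<^sup>+ z \<in> K. Q z \<partial>lebesgue) < \<infinity>"
  shows "(\<integral>\<^sup>+ y \<in> ball a R. (Q y + 1) \<partial>lebesgue) < top"
proof -
  have sB: "cball a R \<in> sets lebesgue" by (intro sets_completionI_sets) auto
  have "(\<integral>\<^sup>+ y \<in> ball a R. (Q y + 1) \<partial>lebesgue)
    \<le> (\<integral>\<^sup>+ y. Q y * indicator (cball a R) y + indicator (cball a R) y \<partial>lebesgue)"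
    by (intro nn_integral_mono) (auto simp: indicator_def)
  also have "\<dots> = (\<integral>\<^sup>+ y \<in> cball a R. Q y \<partial>lebesgue) + emeasure lebesgue (cball a R)"
    using Q sB by (subst nn_integral_add)
      (auto intro!: borel_measurable_times_ennreal borel_measurable_indicator)
  also have "\<dots> < top"
    using fin[of "cball a R"] emeasure_compact_finite[of "cball a R"] by simp
  finally show ?thesis .
qed

text \<open>With \<open>u\<close> the distance from \<open>f (\<gamma> 0)\<close>, the values of
  \<open>u\<close> along the image fill \<open>{0..w}\<close>, so every cover of them has measure at
  least \<open>w\<close>; division by \<open>w\<close> normalises. As \<open>w \<le> 1\<close>, the
  image points used lie in \<open>cball a (R + 1)\<close>, and \<open>R + 2\<close> leaves room for
  an open neighbourhood.\<close>

lemma long_image_density: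
  fixes f :: "real ^ 'n \<Rightarrow> real ^ 'n"
  assumes D: "open D" "continuous_on D f"
    and Q: "Q \<in> borel_measurable lebesgue"
    and fin: "\<And>K. compact K \<Longrightarrow> (\<integral>\<^sup>+ z \<in> K. Q z \<partial>lebesgue) < \<infinity>"
    and iP: "\<And>z. inverse_Poletsky D Q f z"
    and w: "0 < w" "w \<le> 1"
  obtains \<rho> where "\<rho> \<in> borel_measurable borel"
    "(\<integral>\<^sup>+ x. \<rho> x ^ CARD('n) \<partial>lborel)
       \<le> ennreal (1 / w ^ CARD('n)) *
         (ennreal (2 ^ Suc CARD('n) * ((11 ^ CARD('n)) ^ CARD('n) * 2 ^ CARD('n) * 11 ^ CARD('n)))
          * (\<integral>\<^sup>+ y \<in> ball a (R + 2). (Q y + 1) \<partial>lebesgue))"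
    "\<And>(l :: real) \<gamma>. 0 \<le> l \<Longrightarrow> 1-lipschitz_on {0..l} \<gamma> \<Longrightarrow> \<gamma> ` {0..l} \<subseteq> D \<Longrightarrow> f (\<gamma> 0) \<in> cball a R \<Longrightarrow>
       w \<le> dist (f (\<gamma> 0)) (f (\<gamma> l)) \<Longrightarrow> 1 \<le> (\<integral>\<^sup>+ t \<in> {0..l}. \<rho> (\<gamma> t) \<partial>lborel)"
proof -
  let ?n = "CARD('n)"
  let ?V = "cball a (R + 1)" and ?V' = "ball a (R + 2)"
  let ?K = "ennreal (2 ^ Suc ?n * ((11 ^ ?n) ^ ?n * 2 ^ ?n * 11 ^ ?n))"
  have Q1: "(\<lambda>y. Q y + 1) \<in> borel_measurable lebesgue" using Q by simp
  have VV: "?V \<subseteq> ?V'" by auto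
  have finV: "(\<integral>\<^sup>+ y \<in> ?V'. (Q y + 1) \<partial>lebesgue) < top"
    by (rule ball_integral_add_one_finite[OF Q fin])
  obtain \<rho> \<Omega> where \<rho>: "\<rho> \<in> borel_measurable borel" "?V \<subseteq> \<Omega>" "gains D f w \<rho> \<Omega>"
    "(\<integral>\<^sup>+ x. \<rho> x ^ ?n \<partial>lborel) \<le> ?K * (\<integral>\<^sup>+ y \<in> ?V'. (Q y + 1) \<partial>lebesgue)"
    by (rule all_layers[OF D Q1 w(1) inverse_Poletsky_modulus_less[OF iP Q fin] compact_cball open_ball VV finV])
  define P where "P x = ennreal (1 / w) * \<rho> x" for x
  have Pm: "P \<in> borel_measurable borel" unfolding P_def using \<rho>(1) by measurable
  have "(\<integral>\<^sup>+ x. P x ^ ?n \<partial>lborel) = ennreal (1 / w ^ ?n) * (\<integral>\<^sup>+ x. \<rho> x ^ ?n \<partial>lborel)"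
    unfolding P_def power_mult_distrib using w \<rho>(1)
    by (simp add: nn_integral_cmult ennreal_power power_one_over)
  also have "\<dots> \<le> ennreal (1 / w ^ ?n) * (?K * (\<integral>\<^sup>+ y \<in> ?V'. (Q y + 1) \<partial>lebesgue))"
    by (rule mult_left_mono[OF \<rho>(4)]) simp
  finally have bound: "(\<integral>\<^sup>+ x. P x ^ ?n \<partial>lborel)
      \<le> ennreal (1 / w ^ ?n) * (?K * (\<integral>\<^sup>+ y \<in> ?V'. (Q y + 1) \<partial>lebesgue))" .
  have "1 \<le> (\<integral>\<^sup>+ t \<in> {0..l}. P (\<gamma> t) \<partial>lborel)"
    if l: "0 \<le> l" and lip: "1-lipschitz_on {0..l} \<gamma>" and im: "\<gamma> ` {0..l} \<subseteq> D"
      and start: "f (\<gamma> 0) \<in> cball a R" and far: "w \<le> dist (f (\<gamma> 0)) (f (\<gamma> l))" for l :: real and \<gamma>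
  proof -
    define u where "u y = dist (f (\<gamma> 0)) y" for y
    have cont: "continuous_on {0..l} (\<lambda>t. u (f (\<gamma> t)))"
      unfolding u_def
      by (intro continuous_intros continuous_on_compose2[OF D(2) lipschitz_on_continuous_on[OF lip] im])
    have "u (f (\<gamma> 0)) \<le> w" "w \<le> u (f (\<gamma> l))" using w far by (simp_all add: u_def)
    then obtain t where t: "0 \<le> t" "t \<le> l" "u (f (\<gamma> t)) = w"
      and below: "\<And>s. 0 \<le> s \<Longrightarrow> s < t \<Longrightarrow> u (f (\<gamma> s)) < w"
      using first_hitting_time[of 0 l "\<lambda>t. u (f (\<gamma> t))" w, OF cont l] by metis
    have sub: "{0..t} \<subseteq> {0..l}" using t by auto
    have lip_t: "1-lipschitz_on {0..t} \<gamma>" using lip sub by (rule lipschitz_on_subset)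
    have im_t: "\<gamma> ` {0..t} \<subseteq> D" using im sub by blast
    have lip_u: "1-lipschitz_on UNIV u"
    proof (rule lipschitz_onI)
      fix x y
      show "dist (u x) (u y) \<le> 1 * dist x y"
        using dist_triangle[of "f (\<gamma> 0)" x y] dist_triangle[of "f (\<gamma> 0)" y x] dist_commute[of x y]
        by (simp add: u_def dist_real_def abs_le_iff)
    qed simp
    obtain A where A: "A \<in> sets lborel" "u ` (f ` \<gamma> ` {0..t} \<inter> \<Omega>) \<subseteq> A"
      "emeasure lborel A \<le> (\<integral>\<^sup>+ t \<in> {0..t}. \<rho> (\<gamma> t) \<partial>lborel)"
      by (rule gainsE[OF \<rho>(3) lip_t im_t _ _ _ lip_u, of 0 t]) (use t in \<open>auto simp: u_def\<close>)
    have "{0..w} \<subseteq> A"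
    proof
      fix v assume v: "v \<in> {0..w}"
      have "continuous_on {0..t} (\<lambda>t. u (f (\<gamma> t)))" using cont sub by (rule continuous_on_subset)
      then have "\<exists>s\<ge>0. s \<le> t \<and> u (f (\<gamma> s)) = v"
        using v t by (intro IVT') (auto simp: u_def)
      then obtain s where s: "0 \<le> s" "s \<le> t" "u (f (\<gamma> s)) = v" by metis
      have "dist a (f (\<gamma> s)) \<le> dist a (f (\<gamma> 0)) + dist (f (\<gamma> 0)) (f (\<gamma> s))" by (rule dist_triangle)
      also have "\<dots> \<le> R + 1" using start s(3) v w by (simp add: u_def)
      finally have "f (\<gamma> s) \<in> \<Omega>" using \<rho>(2) by auto
      then have "f (\<gamma> s) \<in> f ` \<gamma> ` {0..t} \<inter> \<Omega>" using s by auto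
      then show "v \<in> A" using A(2) s(3) by blast
    qed
    then have "emeasure lborel {0..w} \<le> emeasure lborel A" using A(1) by (intro emeasure_mono)
    then have "ennreal w \<le> emeasure lborel A" using w by simp
    also have "\<dots> \<le> (\<integral>\<^sup>+ t \<in> {0..l}. \<rho> (\<gamma> t) \<partial>lborel)"
      by (rule order_trans[OF A(3)]) (use sub in \<open>intro nn_integral_mono; auto simp: indicator_def\<close>)
    finally have "ennreal (1 / w) * ennreal w \<le> ennreal (1 / w) * (\<integral>\<^sup>+ t \<in> {0..l}. \<rho> (\<gamma> t) \<partial>lborel)"
      by (rule mult_left_mono) simp
    also have "\<dots> = (\<integral>\<^sup>+ t \<in> {0..l}. P (\<gamma> t) \<partial>lborel)"
      unfolding P_def using borel_curve_integrand[OF lip \<rho>(1)]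
      by (subst nn_integral_cmult[symmetric]) (simp_all add: mult.assoc)
    also have "ennreal (1 / w) * ennreal w = 1" using w by (simp flip: ennreal_mult)
    finally show ?thesis .
  qed
  then show ?thesis by (rule that[OF Pm bound])
qed

section \<open>Modulus of curves joining two continua\<close>

text \<open>Functions on a face are kept as functions on the whole space that ignore coordinate
  \<open>i\<close>. Lebesgue measure on \<open>real ^ 'n\<close> then replaces area on the face, and
  the free coordinate only contributes a constant factor.\<close>

abbreviation set_coord :: "'n \<Rightarrow> real \<Rightarrow> real ^ 'n \<Rightarrow> real ^ 'n" where
  "set_coord i x u \<equiv> (\<chi> j. if j = i then x else u $ j)"

definition unit_cube :: "(real ^ 'n) set" where
  "unit_cube = {u. \<forall>j. \<bar>u $ j\<bar> \<le> 1}"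

lemma unit_cube_eq_cbox: "unit_cube = cbox (\<chi> j. -1) (\<chi> j. 1)"
  by (auto simp: unit_cube_def mem_box_cart abs_le_iff minus_le_iff)

lemma unit_cube_borel [measurable]: "unit_cube \<in> sets borel"
  by (simp add: unit_cube_eq_cbox)

lemma emeasure_unit_cube: "emeasure lborel (unit_cube :: (real ^ 'n) set) = ennreal (2 ^ CARD('n))"
proof -
  have "(unit_cube :: (real ^ 'n) set) \<noteq> {}"
    unfolding unit_cube_def by (auto intro!: exI[of _ 0])
  then have "measure lborel (unit_cube :: (real ^ 'n) set) = 2 ^ CARD('n)"
    unfolding unit_cube_eq_cbox by (subst content_cbox_cart) auto
  moreover have "emeasure lborel (unit_cube :: (real ^ 'n) set) = ennreal (measure lborel (unit_cube :: (real ^ 'n) set))"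
    unfolding unit_cube_eq_cbox 
    by (rule emeasure_eq_ennreal_measure[OF less_imp_neq[OF emeasure_lborel_cbox_finite[unfolded infinity_ennreal_def]]])
  ultimately show ?thesis by simp
qed

lemma convex_unit_cube: "convex unit_cube"
  by (simp add: unit_cube_eq_cbox)

lemma measurable_set_coord [measurable (raw)]:
  fixes g :: "'a \<Rightarrow> real ^ 'n"
  assumes [measurable]: "f \<in> borel_measurable M" "g \<in> borel_measurable M"
  shows "(\<lambda>x. set_coord i (f x) (g x)) \<in> borel_measurable M"
proof -
  have "set_coord i x u = u + (x - u $ i) *\<^sub>R axis i 1" for x :: real and u :: "real ^ 'n"
    by (simp add: vec_eq_iff axis_def)
  moreover have "(\<lambda>x. g x + (f x - g x $ i) *\<^sub>R axis i 1) \<in> borel_measurable M"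
    by (intro borel_measurable_add borel_measurable_scaleR borel_measurable_diff assms
        measurable_compose[OF assms(2)] borel_measurable_continuous_onI continuous_intros)
  ultimately show ?thesis by simp
qed

text \<open>Coordinate \<open>i\<close> is not scaled, so the Jacobian is the power
  \<open>n - 1\<close>, the scaling of area on a face.\<close>

lemma nn_integral_scale_coords:
  fixes g :: "real ^ 'n \<Rightarrow> ennreal" and t :: "real ^ 'n"
  assumes [measurable]: "g \<in> borel_measurable borel" and "0 < s"
  shows "ennreal (s ^ (CARD('n) - 1)) * (\<integral>\<^sup>+ u. g (\<chi> j. if j = i then u $ i else t $ j + s * u $ j) \<partial>lborel)
    = (\<integral>\<^sup>+ u. g u \<partial>lborel)"
proof -
  define c where "c b = (if b = axis i 1 then 1 else s)" for b :: "real ^ 'n"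
  define T where "T x = set_coord i 0 t + (\<Sum>b\<in>Basis. (c b * (x \<bullet> b)) *\<^sub>R b)" for x
  have c: "c b \<noteq> 0" for b using \<open>0 < s\<close> by (simp add: c_def)
  have T_eq: "T x = (\<chi> j. if j = i then x $ i else t $ j + s * x $ j)" for x
  proof (rule vec_eq_iff[THEN iffD2], rule allI)
    fix j
    have "(\<Sum>b\<in>Basis. (c b * (x \<bullet> b)) *\<^sub>R b) $ j = (\<Sum>b\<in>Basis. (c b * (x \<bullet> b)) *\<^sub>R b) \<bullet> axis j 1"
      by (simp add: cart_eq_inner_axis)
    also have "\<dots> = c (axis j 1) * (x \<bullet> axis j 1)" by (rule inner_sum_left_Basis) simp
    also have "\<dots> = (if j = i then 1 else s) * x $ j"
      by (simp add: c_def inner_axis axis_eq_axis)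
    finally show "T x $ j = (\<chi> j. if j = i then x $ i else t $ j + s * x $ j) $ j"
      by (simp add: T_def)
  qed
  have "(\<Prod>b\<in>Basis. \<bar>c b\<bar>) = s ^ (CARD('n) - 1)"
  proof -
    have B: "(Basis :: (real ^ 'n) set) = insert (axis i 1) (Basis - {axis i 1})"
      by (rule insert_Diff[symmetric]) simp
    have "(\<Prod>b\<in>Basis. \<bar>c b\<bar>) = \<bar>c (axis i 1)\<bar> * (\<Prod>b\<in>Basis - {axis i 1}. \<bar>c b\<bar>)"
      by (subst B, subst prod.insert) auto
    also have "\<dots> = (\<Prod>b\<in>Basis - {axis i (1::real)}. s)"
      using \<open>0 < s\<close> by (simp add: c_def)
    also have "\<dots> = s ^ (CARD('n) - 1)" by (simp add: card_Diff_singleton)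
    finally show ?thesis .
  qed
  then have "lborel = density (distr lborel borel T) (\<lambda>_. ennreal (s ^ (CARD('n) - 1)))"
    using lborel_affine_euclidean[of c "set_coord i 0 t", OF c] unfolding T_def[symmetric] by simp
  moreover have [measurable]: "T \<in> borel_measurable borel" unfolding T_def by measurable
  have "(\<integral>\<^sup>+ u. g u \<partial>density (distr lborel borel T) (\<lambda>_. ennreal (s ^ (CARD('n) - 1))))
      = ennreal (s ^ (CARD('n) - 1)) * (\<integral>\<^sup>+ u. g (T u) \<partial>lborel)"
    by (simp add: nn_integral_density nn_integral_distr nn_integral_cmult)
  ultimately show ?thesis by (simp add: T_eq)
qed

text \<open>For growing \<open>r\<close> the points
  \<open>c + r *\<^sub>R set_coord i \<sigma> u\<close> sweep out the pyramid over a face, with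
  volume element \<open>r ^ (n - 1)\<close> times the area of the face. The factor 2 is the length
  of the range of the dummy coordinate \<open>u $ i\<close>. Space is never split into a line and a
  hyperplane; Fubini and translations trade the dummy coordinate for \<open>r\<close>
  instead.\<close>

lemma nn_integral_pyramid_le:
  fixes g :: "real ^ 'n \<Rightarrow> ennreal"
  assumes [measurable]: "g \<in> borel_measurable borel" and "\<bar>\<sigma>\<bar> = 1"
  shows "(\<integral>\<^sup>+ r \<in> {0<..}. ennreal (r ^ (CARD('n) - 1))
           * (\<integral>\<^sup>+ u \<in> unit_cube. g (c + r *\<^sub>R set_coord i \<sigma> u) \<partial>lborel) \<partial>lborel)
         \<le> 2 * (\<integral>\<^sup>+ x. g x \<partial>lborel)"
proof -
  let ?I = "\<lambda>w :: real ^ 'n. indicator {-1..1} (w $ i) :: ennreal"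
  have [measurable]: "(\<lambda>w. w $ i) \<in> borel_measurable borel" for i :: 'n
    by (intro borel_measurable_continuous_onI continuous_intros)
  have slice: "ennreal (r ^ (CARD('n) - 1)) * (\<integral>\<^sup>+ u \<in> unit_cube. g (c + r *\<^sub>R set_coord i \<sigma> u) \<partial>lborel)
      \<le> (\<integral>\<^sup>+ w. ?I w * g (set_coord i (c $ i + \<sigma> * r) w) \<partial>lborel)" if "0 < r" for r
  proof -
    have "(\<integral>\<^sup>+ u \<in> unit_cube. g (c + r *\<^sub>R set_coord i \<sigma> u) \<partial>lborel)
        \<le> (\<integral>\<^sup>+ u. (\<lambda>w. ?I w * g (set_coord i (c $ i + \<sigma> * r) w))
             (\<chi> j. if j = i then u $ i else c $ j + r * u $ j) \<partial>lborel)"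
    proof (rule nn_integral_mono)
      fix u
      have "set_coord i (c $ i + \<sigma> * r) (\<chi> j. if j = i then u $ i else c $ j + r * u $ j)
          = c + r *\<^sub>R set_coord i \<sigma> u"
        by (simp add: vec_eq_iff mult.commute)
      moreover have "u \<in> unit_cube \<Longrightarrow> u $ i \<in> {-1..1}"
        by (auto simp: unit_cube_def abs_le_iff minus_le_iff)
      ultimately show "g (c + r *\<^sub>R set_coord i \<sigma> u) * indicator unit_cube u
          \<le> (\<lambda>w. ?I w * g (set_coord i (c $ i + \<sigma> * r) w))
             (\<chi> j. if j = i then u $ i else c $ j + r * u $ j)"
        by (simp add: indicator_def)
    qed
    then have "ennreal (r ^ (CARD('n) - 1)) * (\<integral>\<^sup>+ u \<in> unit_cube. g (c + r *\<^sub>R set_coord i \<sigma> u) \<partial>lborel)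
        \<le> ennreal (r ^ (CARD('n) - 1)) * (\<integral>\<^sup>+ u. (\<lambda>w. ?I w * g (set_coord i (c $ i + \<sigma> * r) w))
             (\<chi> j. if j = i then u $ i else c $ j + r * u $ j) \<partial>lborel)"
      by (rule mult_left_mono) simp
    also have "\<dots> = (\<integral>\<^sup>+ w. ?I w * g (set_coord i (c $ i + \<sigma> * r) w) \<partial>lborel)"
      by (rule nn_integral_scale_coords[OF _ \<open>0 < r\<close>]) measurable
    finally show ?thesis .
  qed
  \<comment> \<open>For fixed \<open>w\<close> both integrals run over the line through
    \<open>w\<close> in direction \<open>i\<close>.\<close>
  have inner: "(\<integral>\<^sup>+ r. g (set_coord i (c $ i + \<sigma> * r) w) \<partial>lborel)
      = (\<integral>\<^sup>+ r. g (w + r *\<^sub>R axis i 1) \<partial>lborel)" for w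
  proof -
    have "(\<integral>\<^sup>+ r. g (set_coord i (c $ i + \<sigma> * r) w) \<partial>lborel) = (\<integral>\<^sup>+ x. g (set_coord i x w) \<partial>lborel)"
      using nn_integral_real_affine[of "\<lambda>x. g (set_coord i x w)" \<sigma> "c $ i"] \<open>\<bar>\<sigma>\<bar> = 1\<close> by auto
    also have "\<dots> = (\<integral>\<^sup>+ r. g (set_coord i (w $ i + 1 * r) w) \<partial>lborel)"
      using nn_integral_real_affine[of "\<lambda>x. g (set_coord i x w)" 1 "w $ i"] by simp
    also have "(\<lambda>r. set_coord i (w $ i + 1 * r) w) = (\<lambda>r. w + r *\<^sub>R axis i 1)"
      by (simp add: fun_eq_iff vec_eq_iff axis_def)
    then have "(\<integral>\<^sup>+ r. g (set_coord i (w $ i + 1 * r) w) \<partial>lborel)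
        = (\<integral>\<^sup>+ r. g (w + r *\<^sub>R axis i 1) \<partial>lborel)"
      by (simp add: fun_eq_iff)
    finally show ?thesis .
  qed
  have "(\<integral>\<^sup>+ r \<in> {0<..}. ennreal (r ^ (CARD('n) - 1))
           * (\<integral>\<^sup>+ u \<in> unit_cube. g (c + r *\<^sub>R set_coord i \<sigma> u) \<partial>lborel) \<partial>lborel)
      \<le> (\<integral>\<^sup>+ r. (\<integral>\<^sup>+ w. ?I w * g (set_coord i (c $ i + \<sigma> * r) w) \<partial>lborel) \<partial>lborel)"
    using slice by (intro nn_integral_mono) (auto simp: indicator_def)
  also have "\<dots> = (\<integral>\<^sup>+ w. (\<integral>\<^sup>+ r. ?I w * g (set_coord i (c $ i + \<sigma> * r) w) \<partial>lborel) \<partial>lborel)"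
    by (rule lborel_pair.Fubini') measurable
  also have "\<dots> = (\<integral>\<^sup>+ w. (\<integral>\<^sup>+ r. ?I w * g (w + r *\<^sub>R axis i 1) \<partial>lborel) \<partial>lborel)"
    by (simp add: nn_integral_cmult inner)
  also have "\<dots> = (\<integral>\<^sup>+ r. (\<integral>\<^sup>+ w. ?I w * g (w + r *\<^sub>R axis i 1) \<partial>lborel) \<partial>lborel)"
    by (rule lborel_pair.Fubini') measurable
  \<comment> \<open>Translation along coordinate \<open>i\<close> frees \<open>g\<close> of
    \<open>r\<close>, which then survives only through an interval of length 2.\<close>
  also have "\<dots> = (\<integral>\<^sup>+ r. (\<integral>\<^sup>+ v. indicator {-1..1} (v $ i - r) * g v \<partial>lborel) \<partial>lborel)"
  proof (rule nn_integral_cong)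
    fix r :: real
    have "(\<integral>\<^sup>+ v. indicator {-1..1} (v $ i - r) * g v \<partial>lborel)
        = (\<integral>\<^sup>+ v. indicator {-1..1} (v $ i - r) * g v \<partial>distr lborel borel ((+) (r *\<^sub>R axis i 1)))"
      by (simp add: lborel_distr_plus)
    also have "\<dots> = (\<integral>\<^sup>+ w. indicator {-1..1} ((r *\<^sub>R axis i 1 + w) $ i - r) * g (r *\<^sub>R axis i 1 + w) \<partial>lborel)"
      by (subst nn_integral_distr) auto
    also have "\<dots> = (\<integral>\<^sup>+ w. ?I w * g (w + r *\<^sub>R axis i 1) \<partial>lborel)"
      by (simp add: axis_def add.commute)
    finally show "(\<integral>\<^sup>+ w. ?I w * g (w + r *\<^sub>R axis i 1) \<partial>lborel)
        = (\<integral>\<^sup>+ v. indicator {-1..1} (v $ i - r) * g v \<partial>lborel)" by simp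
  qed
  also have "\<dots> = (\<integral>\<^sup>+ v. (\<integral>\<^sup>+ r. indicator {-1..1} (v $ i - r) * g v \<partial>lborel) \<partial>lborel)"
    by (rule lborel_pair.Fubini') measurable
  also have "\<dots> = (\<integral>\<^sup>+ v. 2 * g v \<partial>lborel)"
  proof (rule nn_integral_cong)
    fix v :: "real ^ 'n"
    have "(\<integral>\<^sup>+ r. indicator {-1..1} (v $ i - r) * g v \<partial>lborel)
        = (\<integral>\<^sup>+ r. g v * indicator {v $ i - 1..v $ i + 1} r \<partial>lborel)"
      by (intro nn_integral_cong) (auto simp: indicator_def)
    also have "\<dots> = g v * emeasure lborel {v $ i - 1..v $ i + 1}"
      by (rule nn_integral_cmult_indicator) simp
    finally show "(\<integral>\<^sup>+ r. indicator {-1..1} (v $ i - r) * g v \<partial>lborel) = 2 * g v"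
      by (simp add: mult.commute)
  qed
  also have "\<dots> = 2 * (\<integral>\<^sup>+ v. g v \<partial>lborel)" by (rule nn_integral_cmult) simp
  finally show ?thesis .
qed

section \<open>Morrey estimate on a face\<close>

text \<open>Either \<open>x\<close> is at most \<open>\<mu>\<close>, or \<open>x / \<mu>\<close>
  exceeds 1 and is bounded by its \<open>n\<close>-th power. This stands in for Hoelder's
  inequality, with a threshold \<open>\<mu>\<close> that may depend on the scale.\<close>

lemma le_add_power_divide:
  fixes x :: ennreal
  assumes "0 < \<mu>" "0 < n"
  shows "x \<le> ennreal \<mu> + ennreal (1 / \<mu> ^ (n - 1)) * x ^ n"
proof (cases x)
  case (real y)
  show ?thesis
  proof (cases "y \<le> \<mu>")
    case True
    then show ?thesis using real by (intro add_increasing2) (auto intro: ennreal_leI)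
  next
    case False
    then have "1 \<le> (y / \<mu>) ^ (n - 1)" using assms by (intro one_le_power) simp
    then have "y * 1 \<le> y * (y / \<mu>) ^ (n - 1)" using real by (intro mult_left_mono)
    also have "\<dots> = 1 / \<mu> ^ (n - 1) * y ^ n"
      by (subst power_minus_mult[OF assms(2), of y, symmetric]) (simp add: power_divide)
    finally have "ennreal y \<le> ennreal (1 / \<mu> ^ (n - 1) * y ^ n)" by (intro ennreal_leI) simp
    also have "\<dots> = ennreal (1 / \<mu> ^ (n - 1)) * x ^ n"
      using real assms by (subst ennreal_mult) (auto simp: ennreal_power)
    finally show ?thesis using real by (intro add_increasing) auto
  qed
next
  case top
  then show ?thesis using assms by (simp add: ennreal_mult_top top_power_ennreal)
qed

text \<open>
  A Morrey estimate on an \<open>(n - 1)\<close>-dimensional cube, with coordinate \<open>i\<close> of \<open>h\<close> as a dummy: the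
  contraction towards \<open>a\<close> costs only \<open>t powr -(n - 1)\<close>, which makes the exponent \<open>n\<close> supercritical.
\<close>

lemma morrey_segments:
  fixes h :: "real ^ 'n \<Rightarrow> ennreal"
  assumes hm [measurable]: "h \<in> borel_measurable borel" and dummy: "\<And>x u. h (set_coord i x u) = h u"
    and a: "a \<in> unit_cube" and "0 < \<kappa>"
  shows "(\<integral>\<^sup>+ u \<in> unit_cube. (\<integral>\<^sup>+ t \<in> {0..1}. h ((1 - t) *\<^sub>R a + t *\<^sub>R u) \<partial>lborel) \<partial>lborel)
    \<le> ennreal (\<kappa> * real CARD('n) * 2 ^ CARD('n))
       + ennreal (real CARD('n) / \<kappa> ^ (CARD('n) - 1)) * (\<integral>\<^sup>+ u \<in> unit_cube. h u ^ CARD('n) \<partial>lborel)"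
proof -
  let ?n = "CARD('n)"
  define G where "G = (\<integral>\<^sup>+ u \<in> unit_cube. h u ^ ?n \<partial>lborel)"
  have np: "0 < ?n" by simp
  \<comment> \<open>For the threshold \<open>\<kappa> * t powr e\<close> the contraction term scales
    like \<open>t\<close> to the power \<open>-(n - 1) * (e + 1)\<close>, which equals
    \<open>e\<close> exactly when \<open>e = 1 / n - 1\<close>. Both terms are then multiples of
    \<open>t powr e\<close>, whose integral over the unit interval is \<open>n\<close>.\<close>
  define e where "e = 1 / real ?n - 1"
  have e: "-1 < e" by (simp add: e_def)
  have int_e: "(\<integral>\<^sup>+ t. indicator {0..1} t * ennreal (t powr e) \<partial>lborel) = ennreal (real ?n)"
  proof -
    have "((\<lambda>x. x powr e) has_integral (1 powr (e + 1) / (e + 1))) {0..1::real}"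
      using has_integral_powr_from_0[OF e, of 1] by simp
    then have "(\<integral>\<^sup>+ t. indicator {0..1} t * ennreal (t powr e) \<partial>lborel) = ennreal (1 powr (e + 1) / (e + 1))"
      by (subst nn_integral_has_integral_lebesgue'[symmetric])
         (auto simp: mult.commute)
    then show ?thesis by (simp add: e_def)
  qed
  have slice: "(\<integral>\<^sup>+ u \<in> unit_cube. h ((1 - t) *\<^sub>R a + t *\<^sub>R u) \<partial>lborel)
      \<le> ennreal (t powr e) * (ennreal (\<kappa> * 2 ^ ?n) + ennreal (1 / \<kappa> ^ (?n - 1)) * G)"
    if t: "0 < t" "t \<le> 1" for t
  proof -
    define \<mu> where "\<mu> = \<kappa> * t powr e"
    have \<mu>: "0 < \<mu>" using t \<open>0 < \<kappa>\<close> by (simp add: \<mu>_def)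
    have contract: "ennreal (t ^ (?n - 1)) * (\<integral>\<^sup>+ u \<in> unit_cube. h ((1 - t) *\<^sub>R a + t *\<^sub>R u) ^ ?n \<partial>lborel) \<le> G"
    proof -
      \<comment> \<open>\<open>T\<close> leaves coordinate \<open>i\<close> unchanged. As
        \<open>h\<close> ignores it, \<open>T\<close> can replace the contraction, and its Jacobian
        is \<open>t ^ (n - 1)\<close> instead of \<open>t ^ n\<close>.\<close>
      define T where "T u = (\<chi> j. if j = i then u $ i else ((1 - t) *\<^sub>R a) $ j + t * u $ j)" for u
      have "(\<integral>\<^sup>+ u \<in> unit_cube. h ((1 - t) *\<^sub>R a + t *\<^sub>R u) ^ ?n \<partial>lborel)
          \<le> (\<integral>\<^sup>+ u. (\<lambda>w. h w ^ ?n * indicator unit_cube w) (T u) \<partial>lborel)"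
      proof (rule nn_integral_mono)
        fix u :: "real ^ 'n"
        have "h ((1 - t) *\<^sub>R a + t *\<^sub>R u) = h (set_coord i (u $ i) ((1 - t) *\<^sub>R a + t *\<^sub>R u))"
          by (simp only: dummy)
        also have "set_coord i (u $ i) ((1 - t) *\<^sub>R a + t *\<^sub>R u) = T u" by (simp add: T_def vec_eq_iff)
        finally have eq: "h ((1 - t) *\<^sub>R a + t *\<^sub>R u) = h (T u)" .
        have "T u \<in> unit_cube" if u: "u \<in> unit_cube"
        proof -
          have "(1 - t) *\<^sub>R a + t *\<^sub>R u \<in> unit_cube"
            using convexD_alt[OF convex_unit_cube a u, of t] t by simp
          then show ?thesis using u by (auto simp: unit_cube_def T_def)
        qed
        then show "h ((1 - t) *\<^sub>R a + t *\<^sub>R u) ^ ?n * indicator unit_cube u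
            \<le> (\<lambda>w. h w ^ ?n * indicator unit_cube w) (T u)"
          unfolding eq by (simp add: indicator_def)
      qed
      then have "ennreal (t ^ (?n - 1)) * (\<integral>\<^sup>+ u \<in> unit_cube. h ((1 - t) *\<^sub>R a + t *\<^sub>R u) ^ ?n \<partial>lborel)
          \<le> ennreal (t ^ (?n - 1)) * (\<integral>\<^sup>+ u. (\<lambda>w. h w ^ ?n * indicator unit_cube w) (T u) \<partial>lborel)"
        by (rule mult_left_mono) simp
      also have "\<dots> = G" unfolding T_def G_def by (rule nn_integral_scale_coords[OF _ t(1)]) measurable
      finally show ?thesis .
    qed
    have "(\<integral>\<^sup>+ u \<in> unit_cube. h ((1 - t) *\<^sub>R a + t *\<^sub>R u) \<partial>lborel)
        \<le> (\<integral>\<^sup>+ u. ennreal \<mu> * indicator unit_cube u + ennreal (1 / \<mu> ^ (?n - 1)) *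
              (h ((1 - t) *\<^sub>R a + t *\<^sub>R u) ^ ?n * indicator unit_cube u) \<partial>lborel)"
      using le_add_power_divide[OF \<mu> np] by (intro nn_integral_mono) (auto simp: indicator_def)
    also have "\<dots> = ennreal \<mu> * emeasure lborel (unit_cube :: (real ^ 'n) set) + ennreal (1 / \<mu> ^ (?n - 1)) *
        (\<integral>\<^sup>+ u \<in> unit_cube. h ((1 - t) *\<^sub>R a + t *\<^sub>R u) ^ ?n \<partial>lborel)"
      by (subst nn_integral_add) (auto simp: nn_integral_cmult nn_integral_cmult_indicator)
    also have "ennreal (1 / \<mu> ^ (?n - 1)) = ennreal (t powr e * (1 / \<kappa> ^ (?n - 1))) * ennreal (t ^ (?n - 1))"
    proof -
      have "1 / \<mu> ^ (?n - 1) = t powr e * (1 / \<kappa> ^ (?n - 1)) * t ^ (?n - 1)"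
      proof -
        have "(t powr e) ^ (?n - 1) * (t powr e * t ^ (?n - 1)) = t powr (e * real (?n - 1) + e + real (?n - 1))"
          using t by (simp add: powr_add powr_powr flip: powr_realpow)
        also have "e * real (?n - 1) + e + real (?n - 1) = 0"
          by (simp add: e_def of_nat_diff field_simps)
        finally have "(t powr e) ^ (?n - 1) * (t powr e * t ^ (?n - 1)) = 1" using t by simp
        then have "t powr e * t ^ (?n - 1) = 1 / (t powr e) ^ (?n - 1)"
          using t by (simp add: field_simps)
        then show ?thesis by (simp add: \<mu>_def power_mult_distrib mult_ac)
      qed
      then show ?thesis using t \<open>0 < \<kappa>\<close> by (simp flip: ennreal_mult)
    qed
    also have "ennreal (t powr e * (1 / \<kappa> ^ (?n - 1))) * ennreal (t ^ (?n - 1)) *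
        (\<integral>\<^sup>+ u \<in> unit_cube. h ((1 - t) *\<^sub>R a + t *\<^sub>R u) ^ ?n \<partial>lborel)
        \<le> ennreal (t powr e * (1 / \<kappa> ^ (?n - 1))) * G"
      using mult_left_mono[OF contract] by (simp add: mult.assoc)
    also have "ennreal \<mu> * emeasure lborel (unit_cube :: (real ^ 'n) set) + ennreal (t powr e * (1 / \<kappa> ^ (?n - 1))) * G
        = ennreal (t powr e) * (ennreal (\<kappa> * 2 ^ ?n) + ennreal (1 / \<kappa> ^ (?n - 1)) * G)"
    proof -
      have "ennreal (\<kappa> * x) * ennreal y + ennreal (x * z) * G = ennreal x * (ennreal (\<kappa> * y) + ennreal z * G)"
        if "0 \<le> x" "0 \<le> y" "0 \<le> z" for x y z
        using that \<open>0 < \<kappa>\<close> by (simp add: ennreal_mult distrib_left mult_ac)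
      then show ?thesis unfolding \<mu>_def emeasure_unit_cube using \<open>0 < \<kappa>\<close>
        by (meson less_imp_le powr_ge_zero zero_le_divide_1_iff zero_le_numeral zero_le_power)
    qed
    finally show ?thesis by (simp add: add_left_mono)
  qed
  have "(\<integral>\<^sup>+ u \<in> unit_cube. (\<integral>\<^sup>+ t \<in> {0..1}. h ((1 - t) *\<^sub>R a + t *\<^sub>R u) \<partial>lborel) \<partial>lborel)
      = (\<integral>\<^sup>+ u. (\<integral>\<^sup>+ t. h ((1 - t) *\<^sub>R a + t *\<^sub>R u) * indicator {0..1} t * indicator unit_cube u \<partial>lborel) \<partial>lborel)"
    by (simp add: nn_integral_multc)
  also have "\<dots> = (\<integral>\<^sup>+ t. (\<integral>\<^sup>+ u. h ((1 - t) *\<^sub>R a + t *\<^sub>R u) * indicator {0..1} t * indicator unit_cube u \<partial>lborel) \<partial>lborel)"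
    by (rule lborel_pair.Fubini') measurable
  also have "\<dots> \<le> (\<integral>\<^sup>+ t. (indicator {0..1} t * ennreal (t powr e)) *
      (ennreal (\<kappa> * 2 ^ ?n) + ennreal (1 / \<kappa> ^ (?n - 1)) * G) \<partial>lborel)"
  proof (rule nn_integral_mono_AE)
    have "AE t in lborel. t \<noteq> (0::real)" by (rule AE_lborel_singleton)
    then show "AE t in lborel. (\<integral>\<^sup>+ u. h ((1 - t) *\<^sub>R a + t *\<^sub>R u) * indicator {0..1} t * indicator unit_cube u \<partial>lborel)
        \<le> (indicator {0..1} t * ennreal (t powr e)) * (ennreal (\<kappa> * 2 ^ ?n) + ennreal (1 / \<kappa> ^ (?n - 1)) * G)"
    proof eventually_elim
      case (elim t)
      show ?case
      proof (cases "t \<in> {0..1}")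
        case True
        then show ?thesis using slice[of t] elim by simp
      qed simp
    qed
  qed
  also have "\<dots> = ennreal (real ?n) * (ennreal (\<kappa> * 2 ^ ?n) + ennreal (1 / \<kappa> ^ (?n - 1)) * G)"
    by (subst nn_integral_multc) (auto simp: int_e)
  also have "\<dots> = ennreal (\<kappa> * real ?n * 2 ^ ?n) + ennreal (real ?n / \<kappa> ^ (?n - 1)) * G"
    using \<open>0 < \<kappa>\<close> by (simp add: distrib_left mult_ac flip: ennreal_mult mult.assoc)
  finally show ?thesis by (simp add: G_def)
qed

section \<open>Chains of curves of controlled cost\<close>

text \<open>A cost is any upper bound and the duration is free, so curves can be glued with additive
  costs and without selecting near-minimisers. The 1-Lipschitz normalisation survives
  concatenation.\<close>

definition reach :: "(real ^ 'n \<Rightarrow> ennreal) \<Rightarrow> (real ^ 'n) set \<Rightarrow> real ^ 'n \<Rightarrow> real ^ 'n \<Rightarrow> ennreal \<Rightarrow> bool" where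
  "reach \<rho> S p q v \<longleftrightarrow> (\<exists>(l :: real) \<gamma>. 0 \<le> l \<and> 1-lipschitz_on {0..l} \<gamma> \<and> \<gamma> 0 = p \<and> \<gamma> l = q \<and>
     \<gamma> ` {0..l} \<subseteq> S \<and> (\<integral>\<^sup>+ t \<in> {0..l}. \<rho> (\<gamma> t) \<partial>lborel) \<le> v)"

lemma reachE:
  assumes "reach \<rho> S p q v"
  obtains l :: real and \<gamma> where "0 \<le> l" "1-lipschitz_on {0..l} \<gamma>" "\<gamma> 0 = p" "\<gamma> l = q"
     "\<gamma> ` {0..l} \<subseteq> S" "(\<integral>\<^sup>+ t \<in> {0..l}. \<rho> (\<gamma> t) \<partial>lborel) \<le> v"
proof -
  from assms obtain l :: real and \<gamma> where *: "0 \<le> l \<and> 1-lipschitz_on {0..l} \<gamma> \<and> \<gamma> 0 = p \<and> \<gamma> l = q \<and>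
     \<gamma> ` {0..l} \<subseteq> S \<and> (\<integral>\<^sup>+ t \<in> {0..l}. \<rho> (\<gamma> t) \<partial>lborel) \<le> v"
    unfolding reach_def by (elim exE) (rule that)
  show thesis by (rule that[of l \<gamma>]) (use * in simp_all)
qed

lemma reach_trans:
  assumes "reach \<rho> S p q v" "reach \<rho> S q r v'" and rho: "\<rho> \<in> borel_measurable borel"
  shows "reach \<rho> S p r (v + v')"
proof -
  obtain l :: real and \<gamma> where 1: "0 \<le> l" "1-lipschitz_on {0..l} \<gamma>" "\<gamma> 0 = p" "\<gamma> l = q"
     "\<gamma> ` {0..l} \<subseteq> S" "(\<integral>\<^sup>+ t \<in> {0..l}. \<rho> (\<gamma> t) \<partial>lborel) \<le> v"
    by (rule reachE[OF assms(1)])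
  obtain l' :: real and \<gamma>' where 2: "0 \<le> l'" "1-lipschitz_on {0..l'} \<gamma>'" "\<gamma>' 0 = q" "\<gamma>' l' = r"
     "\<gamma>' ` {0..l'} \<subseteq> S" "(\<integral>\<^sup>+ t \<in> {0..l'}. \<rho> (\<gamma>' t) \<partial>lborel) \<le> v'"
    by (rule reachE[OF assms(2)])
  define \<delta> where "\<delta> t = (if t \<le> l then \<gamma> t else \<gamma>' (t - l))" for t
  have \<delta>l: "\<delta> l = q" and \<delta>r: "\<delta> (l + l') = r"
    using 1 2 by (auto simp: \<delta>_def)
  have *: "dist (\<delta> s) (\<delta> t) \<le> t - s" if st: "s \<in> {0..l + l'}" "t \<in> {0..l + l'}" "s \<le> t" for s t
  proof (cases "t \<le> l")
    case True
    then show ?thesis using lipschitz_onD[OF 1(2), of s t] st by (simp add: \<delta>_def dist_real_def)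
  next
    case t: False
    have right: "dist (\<gamma>' (x - l)) (\<gamma>' (t - l)) \<le> t - x" if "l \<le> x" "x \<le> t" for x
      using lipschitz_onD[OF 2(2), of "x - l" "t - l"] st that by (simp add: dist_real_def)
    show ?thesis
    proof (cases "s \<le> l")
      case True
      have "dist (\<delta> s) (\<delta> t) \<le> dist (\<gamma> s) q + dist q (\<gamma>' (t - l))"
        using True t by (simp add: \<delta>_def dist_triangle)
      also have "dist (\<gamma> s) q \<le> l - s"
        using lipschitz_onD[OF 1(2), of s l] st True 1(1,4) by (simp add: dist_real_def)
      also have "dist q (\<gamma>' (t - l)) \<le> t - l" using right[of l] 2(3) t by simp
      finally show ?thesis by simp
    next
      case False
      then show ?thesis using right[of s] t st by (simp add: \<delta>_def)
    qed
  qed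
  have lip: "1-lipschitz_on {0..l + l'} \<delta>"
  proof (rule lipschitz_onI)
    fix s t assume st: "s \<in> {0..l + l'}" "t \<in> {0..l + l'}"
    show "dist (\<delta> s) (\<delta> t) \<le> 1 * dist s t"
    proof (cases "s \<le> t")
      case True
      then show ?thesis using *[OF st] by (simp add: dist_real_def)
    next
      case False
      then show ?thesis using *[OF st(2,1)] by (simp add: dist_real_def dist_commute[of "\<delta> s"])
    qed
  qed simp
  have im: "\<delta> ` {0..l + l'} \<subseteq> S"
  proof
    fix x assume "x \<in> \<delta> ` {0..l + l'}"
    then obtain t where t: "0 \<le> t" "t \<le> l + l'" "x = \<delta> t" by auto
    show "x \<in> S"
      using t subsetD[OF 1(5), of "\<gamma> t"] subsetD[OF 2(5), of "\<gamma>' (t - l)"] by (cases "t \<le> l") (auto simp: \<delta>_def)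
  qed
  define g where "g t = \<rho> (\<gamma> t) * indicator {0..l} t" for t
  define g' where "g' t = \<rho> (\<gamma>' t) * indicator {0..l'} t" for t
  have [measurable]: "g \<in> borel_measurable borel" "g' \<in> borel_measurable borel"
    unfolding g_def g'_def by (intro borel_curve_integrand 1(2) 2(2) rho)+
  have "(\<integral>\<^sup>+ t \<in> {0..l + l'}. \<rho> (\<delta> t) \<partial>lborel) \<le> (\<integral>\<^sup>+ t. g t + g' (- l + 1 * t) \<partial>lborel)"
    by (intro nn_integral_mono) (auto simp: g_def g'_def \<delta>_def indicator_def)
  also have "\<dots> = (\<integral>\<^sup>+ t. g t \<partial>lborel) + (\<integral>\<^sup>+ t. g' (- l + 1 * t) \<partial>lborel)"
    by (rule nn_integral_add) measurable
  also have "(\<integral>\<^sup>+ t. g' (- l + 1 * t) \<partial>lborel) = (\<integral>\<^sup>+ t. g' t \<partial>lborel)"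
    using nn_integral_real_affine[of g' 1 "- l"] by simp
  also have "(\<integral>\<^sup>+ t. g t \<partial>lborel) + (\<integral>\<^sup>+ t. g' t \<partial>lborel) \<le> v + v'"
    using 1(6) 2(6) unfolding g_def g'_def by (rule add_mono)
  finally have "(\<integral>\<^sup>+ t \<in> {0..l + l'}. \<rho> (\<delta> t) \<partial>lborel) \<le> v + v'" .
  moreover have "\<delta> 0 = p" using 1 by (simp add: \<delta>_def)
  ultimately show ?thesis unfolding reach_def using lip im \<delta>r 1(1) 2(1)
    by (intro exI[of _ "l + l'"] exI[of _ \<delta>]) simp
qed

lemma reach_sym:
  assumes "reach \<rho> S p q v" and rho: "\<rho> \<in> borel_measurable borel"
  shows "reach \<rho> S q p v"
proof -
  obtain l :: real and \<gamma> where 1: "0 \<le> l" "1-lipschitz_on {0..l} \<gamma>" "\<gamma> 0 = p" "\<gamma> l = q"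
     "\<gamma> ` {0..l} \<subseteq> S" "(\<integral>\<^sup>+ t \<in> {0..l}. \<rho> (\<gamma> t) \<partial>lborel) \<le> v"
    by (rule reachE[OF assms(1)])
  have lip: "1-lipschitz_on {0..l} (\<lambda>t. \<gamma> (l - t))"
  proof (rule lipschitz_onI)
    fix x y :: real assume "x \<in> {0..l}" "y \<in> {0..l}"
    then have "dist (\<gamma> (l - x)) (\<gamma> (l - y)) \<le> 1 * dist (l - x) (l - y)"
      by (intro lipschitz_onD[OF 1(2)]) auto
    then show "dist (\<gamma> (l - x)) (\<gamma> (l - y)) \<le> 1 * dist x y"
      by (simp add: dist_real_def abs_minus_commute)
  qed simp
  define g where "g t = \<rho> (\<gamma> t) * indicator {0..l} t" for t
  have "g \<in> borel_measurable borel" unfolding g_def by (intro borel_curve_integrand 1(2) rho)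
  then have "(\<integral>\<^sup>+ t. g t \<partial>lborel) = (\<integral>\<^sup>+ t. g (l + - 1 * t) \<partial>lborel)"
    using nn_integral_real_affine[of g "- 1" l] by simp
  also have "\<dots> = (\<integral>\<^sup>+ t \<in> {0..l}. \<rho> (\<gamma> (l - t)) \<partial>lborel)"
    by (intro nn_integral_cong) (auto simp: g_def indicator_def)
  finally have "(\<integral>\<^sup>+ t \<in> {0..l}. \<rho> (\<gamma> (l - t)) \<partial>lborel) \<le> v" using 1(6) by (simp add: g_def)
  moreover have "(\<lambda>t. \<gamma> (l - t)) ` {0..l} \<subseteq> S"
  proof
    fix x assume "x \<in> (\<lambda>t. \<gamma> (l - t)) ` {0..l}"
    then obtain t where t: "0 \<le> t" "t \<le> l" "x = \<gamma> (l - t)" by auto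
    then show "x \<in> S" using subsetD[OF 1(5), of "\<gamma> (l - t)"] by auto
  qed
  ultimately show ?thesis unfolding reach_def using lip 1
    by (intro exI[of _ l] exI[of _ "\<lambda>t. \<gamma> (l - t)"]) simp
qed

text \<open>The duration may exceed the distance, so one \<open>l\<close> serves for all pairs of
  points in a cube, and the degenerate case \<open>p = q\<close> is included.\<close>

lemma reach_segment:
  assumes "convex S" "p \<in> S" "q \<in> S" "0 < l" "dist p q \<le> l" and rho: "\<rho> \<in> borel_measurable borel"
  shows "reach \<rho> S p q (ennreal l * (\<integral>\<^sup>+ t \<in> {0..1}. \<rho> ((1 - t) *\<^sub>R p + t *\<^sub>R q) \<partial>lborel))"
proof -
  define \<gamma> where "\<gamma> t = (1 - t / l) *\<^sub>R p + (t / l) *\<^sub>R q" for t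
  have lip: "1-lipschitz_on {0..l} \<gamma>"
  proof (rule lipschitz_onI)
    fix s t
    have "\<gamma> s - \<gamma> t = ((s - t) / l) *\<^sub>R (q - p)"
      by (simp add: \<gamma>_def algebra_simps diff_divide_distrib)
    then have "dist (\<gamma> s) (\<gamma> t) = \<bar>s - t\<bar> * (dist p q / l)"
      using \<open>0 < l\<close> by (simp add: dist_norm norm_minus_commute)
    also have "\<dots> \<le> \<bar>s - t\<bar> * 1" using assms(4,5) by (intro mult_left_mono) simp_all
    finally show "dist (\<gamma> s) (\<gamma> t) \<le> 1 * dist s t" by (simp add: dist_real_def)
  qed simp
  have im: "\<gamma> ` {0..l} \<subseteq> S"
  proof
    fix x assume "x \<in> \<gamma> ` {0..l}"
    then obtain t where t: "0 \<le> t" "t \<le> l" "x = \<gamma> t" by auto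
    have "0 \<le> t / l" "t / l \<le> 1" using t \<open>0 < l\<close> by simp_all
    then show "x \<in> S" unfolding t(3) \<gamma>_def by (intro convexD_alt assms)
  qed
  define g where "g t = \<rho> (\<gamma> t) * indicator {0..l} t" for t
  have "g \<in> borel_measurable borel" unfolding g_def by (intro borel_curve_integrand lip rho)
  then have "(\<integral>\<^sup>+ t. g t \<partial>lborel) = ennreal l * (\<integral>\<^sup>+ t. g (0 + l * t) \<partial>lborel)"
    using nn_integral_real_affine[of g l 0] \<open>0 < l\<close> by simp
  also have "(\<integral>\<^sup>+ t. g (0 + l * t) \<partial>lborel) = (\<integral>\<^sup>+ t \<in> {0..1}. \<rho> ((1 - t) *\<^sub>R p + t *\<^sub>R q) \<partial>lborel)"
  proof (rule nn_integral_cong)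
    fix t
    have "0 + l * t \<in> {0..l} \<longleftrightarrow> t \<in> {0..1}"
      using \<open>0 < l\<close> mult_le_cancel_left_pos[of l t 1] by (simp add: zero_le_mult_iff)
    then show "g (0 + l * t) = \<rho> ((1 - t) *\<^sub>R p + t *\<^sub>R q) * indicator {0..1} t"
      using \<open>0 < l\<close> by (simp add: g_def \<gamma>_def indicator_def)
  qed
  finally have "(\<integral>\<^sup>+ t \<in> {0..l}. \<rho> (\<gamma> t) \<partial>lborel)
      \<le> ennreal l * (\<integral>\<^sup>+ t \<in> {0..1}. \<rho> ((1 - t) *\<^sub>R p + t *\<^sub>R q) \<partial>lborel)" by (simp add: g_def)
  moreover have "\<gamma> 0 = p" "\<gamma> l = q" using \<open>0 < l\<close> by (simp_all add: \<gamma>_def)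
  ultimately show ?thesis unfolding reach_def using lip im \<open>0 < l\<close>
    by (intro exI[of _ l] exI[of _ \<gamma>]) simp
qed

definition face_fun :: "(real ^ 'n \<Rightarrow> ennreal) \<Rightarrow> real ^ 'n \<Rightarrow> real \<Rightarrow> 'n \<Rightarrow> real \<Rightarrow> real ^ 'n \<Rightarrow> ennreal" where
  "face_fun \<rho> c r i \<sigma> u = \<rho> (c + r *\<^sub>R set_coord i \<sigma> u)"

definition seg_integral :: "(real ^ 'n \<Rightarrow> ennreal) \<Rightarrow> real ^ 'n \<Rightarrow> real ^ 'n \<Rightarrow> ennreal" where
  "seg_integral h a u = (\<integral>\<^sup>+ t \<in> {0..1}. h ((1 - t) *\<^sub>R a + t *\<^sub>R u) \<partial>lborel)"

lemma measurable_face_fun [measurable]: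
  assumes [measurable]: "\<rho> \<in> borel_measurable borel"
  shows "face_fun \<rho> c r i \<sigma> \<in> borel_measurable borel"
  unfolding face_fun_def[abs_def] by measurable

lemma measurable_seg_integral [measurable]:
  fixes h :: "real ^ 'n \<Rightarrow> ennreal"
  assumes [measurable]: "h \<in> borel_measurable borel"
  shows "seg_integral h a \<in> borel_measurable borel"
  unfolding seg_integral_def[abs_def] by measurable

text \<open>The curve makes a detour through \<open>u\<close>, projected to the face. Every
  \<open>u\<close> may serve, which permits averaging over \<open>u\<close> afterwards. The duration
  of each leg bounds its length through the sum of the coordinates.\<close>

lemma reach_in_face:
  fixes \<rho> :: "real ^ 'n \<Rightarrow> ennreal"
  assumes rho: "\<rho> \<in> borel_measurable borel" and r: "0 < r" and "a \<in> unit_cube" "b \<in> unit_cube"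
    "u \<in> unit_cube" "a $ i = \<sigma>" "b $ i = \<sigma>"
  shows "reach \<rho> ((\<lambda>u. c + r *\<^sub>R u) ` unit_cube) (c + r *\<^sub>R a) (c + r *\<^sub>R b)
    (ennreal (2 * real CARD('n) * r) *
      (seg_integral (face_fun \<rho> c r i \<sigma>) a u + seg_integral (face_fun \<rho> c r i \<sigma>) b u))"
proof -
  define S where "S = (\<lambda>u. c + r *\<^sub>R u) ` (unit_cube :: (real ^ 'n) set)"
  define l where "l = 2 * real CARD('n) * r"
  have S: "convex S" unfolding S_def by (intro convex_affinity convex_unit_cube)
  have l: "0 < l" using r by (simp add: l_def)
  define u' where "u' = set_coord i \<sigma> u"
  have u': "u' \<in> unit_cube" using assms(3,5,6) by (auto simp: u'_def unit_cube_def)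
  have half: "reach \<rho> S (c + r *\<^sub>R a) (c + r *\<^sub>R u') (ennreal l * seg_integral (face_fun \<rho> c r i \<sigma>) a u)"
    if a: "a \<in> unit_cube" "a $ i = \<sigma>" for a
  proof -
    have "norm (a - u') \<le> (\<Sum>j\<in>UNIV. \<bar>(a - u') $ j\<bar>)" by (rule norm_le_l1_cart)
    also have "\<dots> \<le> (\<Sum>j\<in>(UNIV :: 'n set). 2)"
    proof (rule sum_mono)
      fix j
      have "\<bar>a $ j\<bar> \<le> 1" "\<bar>u' $ j\<bar> \<le> 1" using a(1) u' by (auto simp: unit_cube_def)
      then show "\<bar>(a - u') $ j\<bar> \<le> 2" by simp
    qed
    finally have "norm (a - u') \<le> 2 * real CARD('n)" by simp
    moreover have "dist (c + r *\<^sub>R a) (c + r *\<^sub>R u') = norm (r *\<^sub>R (a - u'))"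
      by (simp add: dist_norm scaleR_diff_right)
    then have "dist (c + r *\<^sub>R a) (c + r *\<^sub>R u') = r * norm (a - u')" using r by simp
    ultimately have d: "dist (c + r *\<^sub>R a) (c + r *\<^sub>R u') \<le> l"
      unfolding l_def using mult_left_mono[of "norm (a - u')" "2 * real CARD('n)" r] r by (simp add: mult_ac)
    have eq: "\<rho> ((1 - t) *\<^sub>R (c + r *\<^sub>R a) + t *\<^sub>R (c + r *\<^sub>R u')) = face_fun \<rho> c r i \<sigma> ((1 - t) *\<^sub>R a + t *\<^sub>R u)" for t
    proof -
      have "(1 - t) *\<^sub>R (c + r *\<^sub>R a) + t *\<^sub>R (c + r *\<^sub>R u') = c + r *\<^sub>R set_coord i \<sigma> ((1 - t) *\<^sub>R a + t *\<^sub>R u)"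
        using a(2) by (auto simp: vec_eq_iff u'_def algebra_simps)
      then show ?thesis by (simp add: face_fun_def)
    qed
    have "reach \<rho> S (c + r *\<^sub>R a) (c + r *\<^sub>R u')
       (ennreal l * (\<integral>\<^sup>+ t \<in> {0..1}. \<rho> ((1 - t) *\<^sub>R (c + r *\<^sub>R a) + t *\<^sub>R (c + r *\<^sub>R u')) \<partial>lborel))"
      by (rule reach_segment[OF S _ _ l d rho]) (use a u' in \<open>auto simp: S_def\<close>)
    then show ?thesis by (simp add: eq seg_integral_def)
  qed
  have "reach \<rho> S (c + r *\<^sub>R a) (c + r *\<^sub>R b) (ennreal l * seg_integral (face_fun \<rho> c r i \<sigma>) a u
      + ennreal l * seg_integral (face_fun \<rho> c r i \<sigma>) b u)"
    by (rule reach_trans[OF half reach_sym[OF half rho] rho]) (use assms in auto)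
  then show ?thesis by (simp add: S_def l_def distrib_left)
qed

text \<open>The assumed cost is averaged over the detour point \<open>u\<close>; Morrey estimates at
  \<open>a\<close> and at \<open>b\<close> bound the average by a constant plus the energy of the
  face.\<close>

lemma face_integral_lower_bound:
  fixes \<rho> :: "real ^ 'n \<Rightarrow> ennreal"
  assumes rho: "\<rho> \<in> borel_measurable borel" and r: "0 < r" and ab: "a \<in> unit_cube" "b \<in> unit_cube"
    and big: "\<And>u. u \<in> unit_cube \<Longrightarrow> ennreal (1 / 3) \<le> ennreal (2 * real CARD('n) * r) *
      (seg_integral (face_fun \<rho> c r i \<sigma>) a u + seg_integral (face_fun \<rho> c r i \<sigma>) b u)"
  shows "ennreal ((1 / (24 * real CARD('n) ^ 2 * r)) ^ CARD('n))
    \<le> (\<integral>\<^sup>+ u \<in> unit_cube. face_fun \<rho> c r i \<sigma> u ^ CARD('n) \<partial>lborel)"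
proof -
  let ?n = "CARD('n)"
  define N where "N = real ?n"
  have N: "0 < N" by (simp add: N_def)
  define l where "l = 2 * N * r"
  \<comment> \<open>Chosen so that \<open>l * N * \<kappa> = 1 / 12\<close>: the constant terms of
    the two Morrey estimates use up half of \<open>2 ^ n / 3\<close>, and the energy has to supply
    the other half.\<close>
  define \<kappa> where "\<kappa> = 1 / (24 * N ^ 2 * r)"
  have pos: "0 < l" "0 < \<kappa>" using r N by (simp_all add: l_def \<kappa>_def)
  define h where "h = face_fun \<rho> c r i \<sigma>"
  have [measurable]: "h \<in> borel_measurable borel" unfolding h_def using rho by measurable
  define G where "G = (\<integral>\<^sup>+ u \<in> unit_cube. h u ^ ?n \<partial>lborel)"
  have dummy: "h (set_coord i x u) = h u" for x u
  proof -
    have "set_coord i \<sigma> (set_coord i x u) = set_coord i \<sigma> u" by (simp add: vec_eq_iff)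
    then show ?thesis by (simp add: h_def face_fun_def)
  qed
  have M: "(\<integral>\<^sup>+ u \<in> unit_cube. seg_integral h a u \<partial>lborel)
    \<le> ennreal (\<kappa> * N * 2 ^ ?n) + ennreal (N / \<kappa> ^ (?n - 1)) * G" if "a \<in> unit_cube" for a
    using morrey_segments[OF _ dummy that pos(2)] unfolding seg_integral_def G_def N_def by simp
  have "ennreal (1 / 3) * emeasure lborel (unit_cube :: (real ^ 'n) set)
      = (\<integral>\<^sup>+ u \<in> (unit_cube :: (real ^ 'n) set). ennreal (1 / 3) \<partial>lborel)"
    by (simp add: nn_integral_cmult_indicator)
  also have "\<dots> \<le> (\<integral>\<^sup>+ u. ennreal l * (seg_integral h a u * indicator unit_cube u + seg_integral h b u * indicator unit_cube u) \<partial>lborel)"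
    using big by (intro nn_integral_mono) (auto simp: indicator_def h_def l_def N_def)
  also have "\<dots> = ennreal l * ((\<integral>\<^sup>+ u \<in> unit_cube. seg_integral h a u \<partial>lborel)
      + (\<integral>\<^sup>+ u \<in> unit_cube. seg_integral h b u \<partial>lborel))"
    by (simp add: nn_integral_cmult nn_integral_add)
  also have "\<dots> \<le> ennreal l * ((ennreal (\<kappa> * N * 2 ^ ?n) + ennreal (N / \<kappa> ^ (?n - 1)) * G)
      + (ennreal (\<kappa> * N * 2 ^ ?n) + ennreal (N / \<kappa> ^ (?n - 1)) * G))"
    by (intro mult_left_mono add_mono M ab) simp
  finally have main: "ennreal (1 / 3) * ennreal (2 ^ ?n) \<le>
      ennreal l * ((ennreal (\<kappa> * N * 2 ^ ?n) + ennreal (N / \<kappa> ^ (?n - 1)) * G)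
      + (ennreal (\<kappa> * N * 2 ^ ?n) + ennreal (N / \<kappa> ^ (?n - 1)) * G))"
    by (simp only: emeasure_unit_cube)
  have "ennreal (\<kappa> ^ ?n) \<le> G"
  proof (cases G)
    case (real g)
    have "ennreal l * ((ennreal (\<kappa> * N * 2 ^ ?n) + ennreal (N / \<kappa> ^ (?n - 1)) * G)
        + (ennreal (\<kappa> * N * 2 ^ ?n) + ennreal (N / \<kappa> ^ (?n - 1)) * G))
      = ennreal (l * ((\<kappa> * N * 2 ^ ?n + N / \<kappa> ^ (?n - 1) * g) + (\<kappa> * N * 2 ^ ?n + N / \<kappa> ^ (?n - 1) * g)))"
    proof -
      have comb: "ennreal x * ((ennreal y + ennreal z * ennreal g) + (ennreal y + ennreal z * ennreal g))
          = ennreal (x * ((y + z * g) + (y + z * g)))" if "0 \<le> x" "0 \<le> y" "0 \<le> z" for x y z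
        using that real(1) by (simp flip: ennreal_mult ennreal_plus)
      show ?thesis unfolding real(2) by (rule comb) (use pos N in simp_all)
    qed
    moreover have "ennreal (1 / 3) * ennreal (2 ^ ?n) = ennreal (2 ^ ?n / 3)"
      by (subst ennreal_mult[symmetric]) auto
    ultimately have "ennreal (2 ^ ?n / 3) \<le>
        ennreal (l * ((\<kappa> * N * 2 ^ ?n + N / \<kappa> ^ (?n - 1) * g) + (\<kappa> * N * 2 ^ ?n + N / \<kappa> ^ (?n - 1) * g)))"
      using main by simp
    then have "2 ^ ?n / 3 \<le> l * ((\<kappa> * N * 2 ^ ?n + N / \<kappa> ^ (?n - 1) * g) + (\<kappa> * N * 2 ^ ?n + N / \<kappa> ^ (?n - 1) * g))"
      using pos N real(1) by (subst (asm) ennreal_le_iff) auto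
    also have "\<dots> = 2 * (l * N * \<kappa>) * 2 ^ ?n + 2 * (l * N * \<kappa>) * (g / \<kappa> ^ ?n)"
    proof -
      have "N / \<kappa> ^ (?n - 1) = N * \<kappa> / \<kappa> ^ ?n"
        using pos(2) by (subst power_minus_mult[of ?n \<kappa>, symmetric]) auto
      then show ?thesis by (simp add: algebra_simps)
    qed
    also have "l * N * \<kappa> = 1 / 12"
      using r N by (simp add: l_def \<kappa>_def power2_eq_square)
    finally have "(2 :: real) ^ ?n \<le> g / \<kappa> ^ ?n" by simp
    then have "1 \<le> g / \<kappa> ^ ?n"
      using order_trans[OF one_le_power[of "2::real" ?n]] by fastforce
    then have "\<kappa> ^ ?n \<le> g" using pos(2) by (simp add: le_divide_eq)
    then show ?thesis unfolding real(2) by (rule ennreal_leI)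
  qed simp
  then show ?thesis by (simp add: \<kappa>_def N_def G_def h_def)
qed

lemma sum_thirds_less_one:
  fixes a b c :: ennreal
  assumes "a < ennreal (1 / 3)" "b < ennreal (1 / 3)" "c < ennreal (1 / 3)"
  shows "a + b + c < 1"
proof -
  have lt: "x < top" if "x < ennreal (1 / 3)" for x using that by (rule order_less_trans) simp
  obtain a' b' c' where "a = ennreal a'" "b = ennreal b'" "c = ennreal c'" "0 \<le> a'" "0 \<le> b'" "0 \<le> c'"
    using lt[OF assms(1)] lt[OF assms(2)] lt[OF assms(3)] by (cases a; cases b; cases c) auto
  then show ?thesis using assms by (simp add: ennreal_less_iff flip: ennreal_plus ennreal_1)
qed

text \<open>Two points on the surface of the cube are joined by a chain through at most three faces.\<close>

lemma exists_large_face: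
  fixes \<rho> :: "real ^ 'n \<Rightarrow> ennreal"
  assumes rho: "\<rho> \<in> borel_measurable borel" and r: "0 < r" and n: "2 \<le> CARD('n)"
    and a: "a \<in> unit_cube" "\<bar>a $ i\<bar> = 1" and b: "b \<in> unit_cube" "\<bar>b $ j\<bar> = 1"
    and far: "\<And>v. reach \<rho> ((\<lambda>u. c + r *\<^sub>R u) ` unit_cube) (c + r *\<^sub>R a) (c + r *\<^sub>R b) v \<Longrightarrow> 1 \<le> v"
  shows "\<exists>k. \<exists>\<sigma>\<in>{-1, 1}. ennreal ((1 / (24 * real CARD('n) ^ 2 * r)) ^ CARD('n))
    \<le> (\<integral>\<^sup>+ u \<in> unit_cube. face_fun \<rho> c r k \<sigma> u ^ CARD('n) \<partial>lborel)"
proof -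
  define \<sigma> \<tau> where "\<sigma> = a $ i" and "\<tau> = b $ j"
  have \<sigma>: "\<sigma> \<in> {-1, 1}" and \<tau>: "\<tau> \<in> {-1, 1}" using a(2) b(2) by (auto simp: \<sigma>_def \<tau>_def abs_if split: if_splits)
  \<comment> \<open>Equal or opposite faces are linked through a face of another coordinate
    \<open>k\<close>, which exists because \<open>n\<close> is at least 2. Otherwise the two faces
    share the point \<open>p = q\<close> and the middle leg is degenerate.\<close>
  obtain k \<eta> and p q :: "real ^ 'n" where pq: "\<eta> \<in> {-1, 1}" "p \<in> unit_cube" "q \<in> unit_cube"
    "p $ i = \<sigma>" "p $ k = \<eta>" "q $ k = \<eta>" "q $ j = \<tau>"
  proof (cases "i = j")
    case True
    obtain k where k: "k \<noteq> i"
      using n card_le_Suc0_iff_eq[of "UNIV :: 'n set"] by (metis UNIV_I finite not_less_eq_eq numeral_2_eq_2)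
    show ?thesis
    proof (rule that[of 1 "set_coord i \<sigma> (set_coord k 1 0)" "set_coord j \<tau> (set_coord k 1 0)" k])
    qed (use \<sigma> \<tau> k True in \<open>auto simp: unit_cube_def\<close>)
  next
    case False
    show ?thesis
    proof (rule that[of \<sigma> "set_coord i \<sigma> (set_coord j \<tau> 0)" "set_coord i \<sigma> (set_coord j \<tau> 0)" i])
    qed (use \<sigma> \<tau> False in \<open>auto simp: unit_cube_def\<close>)
  qed
  let ?S = "(\<lambda>u. c + r *\<^sub>R u) ` (unit_cube :: (real ^ 'n) set)"
  let ?cost = "\<lambda>k \<sigma> a b u. ennreal (2 * real CARD('n) * r) *
      (seg_integral (face_fun \<rho> c r k \<sigma>) a u + seg_integral (face_fun \<rho> c r k \<sigma>) b u)"
  show ?thesis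
  proof (rule ccontr)
    assume neg: "\<not> ?thesis"
    \<comment> \<open>If all faces had small energy, each leg would admit a curve of cost below
      \<open>1 / 3\<close>.\<close>
    have cheap: "\<exists>v. reach \<rho> ?S (c + r *\<^sub>R a) (c + r *\<^sub>R b) v \<and> v < ennreal (1 / 3)"
      if "\<sigma> \<in> {-1, 1}" "a \<in> unit_cube" "b \<in> unit_cube" "a $ k = \<sigma>" "b $ k = \<sigma>" for k \<sigma> a b
    proof -
      have "\<exists>u\<in>unit_cube. \<not> ennreal (1 / 3) \<le> ?cost k \<sigma> a b u"
      proof (rule ccontr)
        assume "\<not> (\<exists>u\<in>unit_cube. \<not> ennreal (1 / 3) \<le> ?cost k \<sigma> a b u)"
        then have "\<And>u. u \<in> unit_cube \<Longrightarrow> ennreal (1 / 3) \<le> ?cost k \<sigma> a b u" by blast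
        from face_integral_lower_bound[OF rho r that(2,3) this] neg that(1) show False by blast
      qed
      then obtain u where u: "u \<in> unit_cube" "\<not> ennreal (1 / 3) \<le> ?cost k \<sigma> a b u" by (elim bexE)
      show ?thesis
        using reach_in_face[OF rho r that(2,3) u(1) that(4,5), of c] u(2)
        by (intro exI[of _ "?cost k \<sigma> a b u"]) (simp add: not_le)
    qed
    obtain v1 where v1: "reach \<rho> ?S (c + r *\<^sub>R a) (c + r *\<^sub>R p) v1" "v1 < ennreal (1 / 3)"
      using cheap[OF \<sigma> a(1) pq(2) \<sigma>_def[symmetric] pq(4)] by metis
    obtain v2 where v2: "reach \<rho> ?S (c + r *\<^sub>R p) (c + r *\<^sub>R q) v2" "v2 < ennreal (1 / 3)"
      using cheap[OF pq(1,2,3,5,6)] by metis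
    obtain v3 where v3: "reach \<rho> ?S (c + r *\<^sub>R q) (c + r *\<^sub>R b) v3" "v3 < ennreal (1 / 3)"
      using cheap[OF \<tau> pq(3) b(1) pq(7) \<tau>_def[symmetric]] by metis
    have "1 \<le> v1 + v2 + v3"
      by (rule far[OF reach_trans[OF reach_trans[OF v1(1) v2(1) rho] v3(1) rho]])
    then show False using sum_thirds_less_one[OF v1(2) v2(2) v3(2)] by simp
  qed
qed

text \<open>At each radius some face has large energy; multiplied by \<open>r ^ (n - 1)\<close> it
  contributes a multiple of \<open>1 / r\<close>, and integration over the radii gives the
  logarithm. Which face is large varies with \<open>r\<close> without control, so all
  \<open>2 * n\<close> pyramids are summed, each at the price of a factor 2.\<close>

lemma modulus_lower_bound:
  fixes \<rho> :: "real ^ 'n \<Rightarrow> ennreal"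
  assumes rho [measurable]: "\<rho> \<in> borel_measurable borel" and n: "2 \<le> CARD('n)"
    and s: "0 < s" "s \<le> S"
    and meet: "\<And>r. s \<le> r \<Longrightarrow> r \<le> S \<Longrightarrow> \<exists>a\<in>unit_cube. (\<exists>i. \<bar>a $ i\<bar> = 1) \<and> c + r *\<^sub>R a \<in> F"
      "\<And>r. s \<le> r \<Longrightarrow> r \<le> S \<Longrightarrow> \<exists>a\<in>unit_cube. (\<exists>i. \<bar>a $ i\<bar> = 1) \<and> c + r *\<^sub>R a \<in> F'"
    and adm: "\<And>p q v r. s \<le> r \<Longrightarrow> r \<le> S \<Longrightarrow> p \<in> F \<Longrightarrow> q \<in> F' \<Longrightarrow>
      reach \<rho> ((\<lambda>u. c + r *\<^sub>R u) ` unit_cube) p q v \<Longrightarrow> 1 \<le> v"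
  shows "ennreal ((1 / (24 * real CARD('n) ^ 2)) ^ CARD('n) * ln (S / s))
    \<le> 4 * of_nat CARD('n) * (\<integral>\<^sup>+ x. \<rho> x ^ CARD('n) \<partial>lborel)"
proof -
  let ?n = "CARD('n)"
  define \<kappa> where "\<kappa> = (1 / (24 * real ?n ^ 2)) ^ ?n"
  have \<kappa>: "0 < \<kappa>" by (simp add: \<kappa>_def)
  define G where "G k \<sigma> r = (\<integral>\<^sup>+ u \<in> unit_cube. \<rho> (c + r *\<^sub>R set_coord k \<sigma> u) ^ ?n \<partial>lborel)" for k \<sigma> r
  have [measurable]: "G k \<sigma> \<in> borel_measurable borel" for k \<sigma>
    unfolding G_def[abs_def] by measurable
  define H where "H k \<sigma> r = ennreal (r ^ (?n - 1)) * G k \<sigma> r * indicator {0<..} r" for k \<sigma> r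
  have [measurable]: "H k \<sigma> \<in> borel_measurable borel" for k \<sigma>
    unfolding H_def[abs_def] by measurable
  have slice: "ennreal (\<kappa> / r) \<le> (\<Sum>k\<in>UNIV. \<Sum>\<sigma>\<in>{-1, 1}. H k \<sigma> r)" if r: "s \<le> r" "r \<le> S" for r
  proof -
    have r0: "0 < r" using r s by simp
    obtain a i b j where ab: "a \<in> unit_cube" "\<bar>a $ i\<bar> = 1" "c + r *\<^sub>R a \<in> F"
      "b \<in> unit_cube" "\<bar>b $ j\<bar> = 1" "c + r *\<^sub>R b \<in> F'"
      using meet(1)[OF r] meet(2)[OF r] by (elim bexE exE conjE) (rule that)
    have "\<exists>k. \<exists>\<sigma>\<in>{-1, 1}. ennreal ((1 / (24 * real ?n ^ 2 * r)) ^ ?n)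
        \<le> G k \<sigma> r"
      unfolding G_def face_fun_def[symmetric]
      by (rule exists_large_face[OF rho r0 n ab(1,2,4,5)]) (rule adm[OF r ab(3,6)])
    then obtain k \<sigma> where k: "\<sigma> \<in> {-1, 1}"
      "ennreal ((1 / (24 * real ?n ^ 2 * r)) ^ ?n) \<le> G k \<sigma> r"
      by (elim exE bexE) (rule that)
    have "\<kappa> / r = r ^ (?n - 1) * (1 / (24 * real ?n ^ 2 * r)) ^ ?n"
    proof -
      have "r ^ ?n = r ^ (?n - 1) * r" by (rule power_minus_mult[symmetric]) simp
      then show ?thesis using r0 by (simp add: \<kappa>_def power_mult_distrib power_divide)
    qed
    then have "ennreal (\<kappa> / r) = ennreal (r ^ (?n - 1)) * ennreal ((1 / (24 * real ?n ^ 2 * r)) ^ ?n)"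
      using r0 by (simp only: ennreal_mult zero_le_power less_imp_le zero_le_divide_1_iff zero_le_mult_iff
          zero_le_numeral of_nat_0_le_iff simp_thms)
    also have "\<dots> \<le> ennreal (r ^ (?n - 1)) * G k \<sigma> r" using k(2) by (rule mult_left_mono) simp
    also have "\<dots> = H k \<sigma> r" using r0 by (simp add: H_def)
    also have "\<dots> \<le> (\<Sum>\<sigma>\<in>{-1, 1}. H k \<sigma> r)" using k(1) by (intro member_le_sum) auto
    also have "\<dots> \<le> (\<Sum>k\<in>UNIV. \<Sum>\<sigma>\<in>{-1, 1}. H k \<sigma> r)" by (rule member_le_sum) auto
    finally show ?thesis .
  qed
  have "(\<integral>\<^sup>+ r. ennreal (\<kappa> / r) * indicator {s..S} r \<partial>lborel) = ennreal (\<kappa> * ln S - \<kappa> * ln s)"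
  proof (rule nn_integral_FTC_Icc[where f = "\<lambda>r. \<kappa> / r" and F = "\<lambda>r. \<kappa> * ln r"])
    show "((\<lambda>r. \<kappa> * ln r) has_real_derivative \<kappa> / r) (at r)" if "r \<in> {s..S}" for r
      using that s by (auto intro!: derivative_eq_intros)
  qed (use s \<kappa> in auto)
  moreover have "\<kappa> * ln S - \<kappa> * ln s = \<kappa> * ln (S / s)"
    using s by (simp add: ln_div right_diff_distrib)
  ultimately have "ennreal (\<kappa> * ln (S / s)) = (\<integral>\<^sup>+ r. ennreal (\<kappa> / r) * indicator {s..S} r \<partial>lborel)" by simp
  also have "\<dots> \<le> (\<integral>\<^sup>+ r. (\<Sum>k\<in>UNIV. \<Sum>\<sigma>\<in>{-1, 1}. H k \<sigma> r) \<partial>lborel)"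
    using slice by (intro nn_integral_mono) (auto simp: indicator_def)
  also have "\<dots> = (\<Sum>k\<in>UNIV. \<Sum>\<sigma>\<in>{-1, 1}. \<integral>\<^sup>+ r. H k \<sigma> r \<partial>lborel)"
    by (subst nn_integral_sum) (auto simp: nn_integral_add)
  also have "\<dots> \<le> (\<Sum>k\<in>(UNIV :: 'n set). \<Sum>\<sigma>\<in>{-1, 1 :: real}. 2 * (\<integral>\<^sup>+ x. \<rho> x ^ ?n \<partial>lborel))"
  proof (intro sum_mono)
    fix k :: 'n and \<sigma> :: real assume "\<sigma> \<in> {-1, 1}"
    then have "\<bar>\<sigma>\<bar> = 1" by auto
    then show "(\<integral>\<^sup>+ r. H k \<sigma> r \<partial>lborel) \<le> 2 * (\<integral>\<^sup>+ x. \<rho> x ^ ?n \<partial>lborel)"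
      unfolding H_def G_def by (intro nn_integral_pyramid_le) measurable
  qed
  also have "\<dots> = 4 * of_nat ?n * (\<integral>\<^sup>+ x. \<rho> x ^ ?n \<partial>lborel)"
  proof -
    have "(\<Sum>\<sigma>\<in>{-1, 1 :: real}. 2 * (\<integral>\<^sup>+ x. \<rho> x ^ ?n \<partial>lborel)) = 4 * (\<integral>\<^sup>+ x. \<rho> x ^ ?n \<partial>lborel)"
      by (simp flip: distrib_right)
    then show ?thesis by (simp add: mult_ac)
  qed
  finally show ?thesis by (simp add: \<kappa>_def)
qed

section \<open>Equicontinuity\<close>

text \<open>
  This replaces the maximal lifting of a path ending at an omitted value: openness of \<open>f\<close> makes the
  image of a compact clopen piece of \<open>f -` \<beta>\<close> clopen in \<open>\<beta>\<close>.
\<close>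

lemma component_meets_frontier:
  fixes f :: "real ^ 'n \<Rightarrow> real ^ 'n"
  assumes D: "open D" "continuous_on D f" "open_map (top_of_set D) euclidean f"
    and X: "compact X" "X \<subseteq> D" and \<beta>: "connected \<beta>" "closed \<beta>" "\<not> \<beta> \<subseteq> f ` X"
    and a: "a \<in> X" "f a \<in> \<beta>"
  obtains F where "connected F" "a \<in> F" "F \<subseteq> X" "f ` F \<subseteq> \<beta>" "F \<inter> frontier X \<noteq> {}"
proof -
  define S where "S = {x \<in> X. f x \<in> \<beta>}"
  have "closed S"
  proof -
    have "S = X \<inter> f -` \<beta>" by (auto simp: S_def)
    then show ?thesis
      using continuous_closed_preimage[OF continuous_on_subset[OF D(2) X(2)] compact_imp_closed[OF X(1)] \<beta>(2)]
      by simp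
  qed
  then have "compact S"
    using X(1) by (metis (no_types, lifting) S_def bounded_subset compact_eq_bounded_closed mem_Collect_eq subsetI)
  have aS: "a \<in> S" using a by (simp add: S_def)
  define C where "C = connected_component_set S a"
  have C: "C \<in> components S" using aS by (auto simp: C_def components_def)
  have aC: "a \<in> C" using aS by (simp add: C_def)
  have CS: "C \<subseteq> S" unfolding C_def by (rule connected_component_subset)
  have "C \<inter> frontier X \<noteq> {}"
  proof
    assume "C \<inter> frontier X = {}"
    moreover have "C \<subseteq> closure X" using CS closure_subset by (auto simp: S_def)
    ultimately have "C \<subseteq> interior X" unfolding frontier_def by blast
    \<comment> \<open>A component of a compact set need not be relatively open, but by Sura-Bura it
      has arbitrarily small relatively clopen neighbourhoods.\<close>
    then obtain K where K: "openin (top_of_set S) K" "compact K" "C \<subseteq> K" "K \<subseteq> interior X"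
      using Sura_Bura_clopen_subset[OF closed_imp_locally_compact[OF \<open>closed S\<close>] C
          compact_components[OF \<open>compact S\<close> C] open_interior] by metis
    obtain V where V: "open V" "K = S \<inter> V" using K(1) by (auto simp: openin_open)
    define V' where "V' = V \<inter> interior X"
    have V': "V' \<subseteq> X" using interior_subset by (auto simp: V'_def)
    have "openin (top_of_set D) V'"
      using V(1) V' X(2) by (intro open_openin_trans[OF D(1)]) (auto simp: V'_def)
    then have "open (f ` V')"
      using D(3) unfolding open_map_def by (metis open_openin)
    \<comment> \<open>Since \<open>V'\<close> is open and \<open>f\<close> is an open map, this
      makes the image of \<open>K\<close> relatively open in \<open>\<beta>\<close>; compactness
      makes it closed.\<close>
    have eq: "f ` K = \<beta> \<inter> f ` V'"
    proof
      show "f ` K \<subseteq> \<beta> \<inter> f ` V'" using V(2) K(4) by (auto simp: S_def V'_def)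
      show "\<beta> \<inter> f ` V' \<subseteq> f ` K" using V(2) V' by (auto simp: S_def V'_def)
    qed
    then have "openin (top_of_set \<beta>) (f ` K)"
      using \<open>open (f ` V')\<close> by (simp add: openin_open_Int)
    moreover have "K \<subseteq> D" using K(4) interior_subset X(2) by blast
    then have "compact (f ` K)"
      using K(2) D(2) by (intro compact_continuous_image) (auto intro: continuous_on_subset)
    then have "closedin (top_of_set \<beta>) (f ` K)"
      using eq by (intro closed_subset compact_imp_closed) auto
    ultimately have "f ` K = {} \<or> f ` K = \<beta>"
      using \<beta>(1) unfolding connected_clopen by blast
    then have "f ` K = \<beta>" using aC K(3) by blast
    then show False using \<beta>(3) K(4) interior_subset[of X] by blast
  qed
  moreover have "connected C" unfolding C_def by (rule connected_connected_component)
  moreover have "C \<subseteq> X" "f ` C \<subseteq> \<beta>" using CS by (auto simp: S_def)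
  ultimately show ?thesis using aC that[of C] by blast
qed

section \<open>Continua crossing concentric cubes\<close>

lemma infnorm_attained:
  fixes x :: "real ^ 'n"
  shows "\<exists>i. \<bar>x $ i\<bar> = infnorm x"
proof -
  have "infnorm x \<in> (\<lambda>i. \<bar>x \<bullet> i\<bar>) ` Basis" unfolding infnorm_Max by (intro Max_in) auto
  then obtain b :: "real ^ 'n" where b: "b \<in> Basis" "infnorm x = \<bar>x \<bullet> b\<bar>" by auto
  obtain i where "b = axis i 1" using b(1) by (auto simp: Basis_vec_def)
  then show ?thesis using b(2) by (auto simp: inner_axis)
qed

lemma mem_cube_iff:
  fixes x :: "real ^ 'n"
  assumes "0 < r"
  shows "x \<in> (\<lambda>u. c + r *\<^sub>R u) ` unit_cube \<longleftrightarrow> infnorm (x - c) \<le> r"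
proof
  assume "x \<in> (\<lambda>u. c + r *\<^sub>R u) ` unit_cube"
  then obtain u where u: "u \<in> unit_cube" "x = c + r *\<^sub>R u" by auto
  obtain i where "\<bar>u $ i\<bar> = infnorm u" using infnorm_attained by metis
  then have "infnorm u \<le> 1" using u(1) by (auto simp: unit_cube_def) metis
  then show "infnorm (x - c) \<le> r" using u(2) assms by (simp add: infnorm_mul mult_left_le)
next
  assume le: "infnorm (x - c) \<le> r"
  have "(1 / r) *\<^sub>R (x - c) \<in> unit_cube"
    unfolding unit_cube_def
  proof (intro CollectI allI)
    fix j
    have "\<bar>(x - c) $ j\<bar> \<le> r" using component_le_infnorm_cart[of "x - c" j] le by linarith
    then show "\<bar>((1 / r) *\<^sub>R (x - c)) $ j\<bar> \<le> 1" using assms by (simp add: abs_mult)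
  qed
  moreover have "x = c + r *\<^sub>R ((1 / r) *\<^sub>R (x - c))" using assms by simp
  ultimately show "x \<in> (\<lambda>u. c + r *\<^sub>R u) ` unit_cube" by (rule rev_image_eqI)
qed

text \<open>On the connected set \<open>F\<close> the function \<open>infnorm (x - c)\<close> takes
  every value between its value at \<open>a\<close>, at most \<open>s\<close>, and its value at a
  frontier point, at least \<open>S\<close>.\<close>

lemma continuum_meets_cubes:
  fixes F :: "(real ^ 'n) set"
  assumes F: "connected F" "a \<in> F" "infnorm (a - c) \<le> s" and s: "0 < s"
    and fr: "F \<inter> frontier ((\<lambda>u. c + S *\<^sub>R u) ` unit_cube) \<noteq> {}" and r: "s \<le> r" "r \<le> S"
  shows "\<exists>a\<in>unit_cube. (\<exists>i. \<bar>a $ i\<bar> = 1) \<and> c + r *\<^sub>R a \<in> F"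
proof -
  have S: "0 < S" using s r by simp
  let ?X = "(\<lambda>u. c + S *\<^sub>R u) ` (unit_cube :: (real ^ 'n) set)"
  have cont: "continuous_on A (\<lambda>x. infnorm (x - c))" for A :: "(real ^ 'n) set"
    by (rule continuous_on_subset[OF _ subset_UNIV])
       (intro continuous_at_imp_continuous_on ballI continuous_infnorm continuous_intros)
  obtain b where b: "b \<in> F" "b \<in> frontier ?X" using fr by auto
  have "S \<le> infnorm (b - c)"
  proof (rule ccontr)
    assume "\<not> S \<le> infnorm (b - c)"
    then have "b \<in> {x. infnorm (x - c) < S}" by simp
    moreover have "open {x :: real ^ 'n. infnorm (x - c) < S}"
      by (intro open_Collect_less cont continuous_on_const)
    moreover have "{x. infnorm (x - c) < S} \<subseteq> ?X"
      unfolding subset_iff mem_cube_iff[OF S] by simp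
    ultimately have "b \<in> interior ?X" by (intro interiorI)
    then show False using b(2) by (simp add: frontier_def)
  qed
  moreover have "connected ((\<lambda>x. infnorm (x - c)) ` F)"
    by (intro connected_continuous_image cont F(1))
  then have "{infnorm (a - c)..infnorm (b - c)} \<subseteq> (\<lambda>x. infnorm (x - c)) ` F"
    using F(2) b(1) by (intro connected_contains_Icc) auto
  ultimately have "r \<in> (\<lambda>x. infnorm (x - c)) ` F" using F(3) r by auto
  then obtain x where x: "x \<in> F" "infnorm (x - c) = r" by auto
  have r0: "0 < r" using s r by simp
  then obtain u where u: "u \<in> unit_cube" "x = c + r *\<^sub>R u"
    using mem_cube_iff[OF r0, of x c] x(2) by auto
  obtain i where i: "\<bar>(x - c) $ i\<bar> = r" using infnorm_attained x(2) by metis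
  then have "\<bar>u $ i\<bar> = 1" using u(2) r0 by (simp add: abs_mult)
  then show ?thesis using u x(1) by metis
qed

text \<open>The moves from \<open>u\<close> to \<open>s *\<^sub>R u\<close> and from
  \<open>t *\<^sub>R v\<close> to \<open>v\<close> have total length at most
  \<open>t * norm v - s * norm u\<close>, because \<open>norm u \<le> norm v\<close>; this
  difference is in turn at most the distance of the two moved points. So a segment towards the
  centre stays away from an outward ray that starts farther out.\<close>

lemma dist_segment_ray:
  fixes u v :: "'a :: real_inner"
  assumes "norm u \<le> norm v" "0 \<le> s" "s \<le> 1" "1 \<le> t"
  shows "dist u v \<le> 2 * dist (s *\<^sub>R u) (t *\<^sub>R v)"
proof -
  have "norm (t *\<^sub>R v) - norm (s *\<^sub>R u) \<le> dist (s *\<^sub>R u) (t *\<^sub>R v)"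
    using norm_triangle_ineq2[of "t *\<^sub>R v" "s *\<^sub>R u"] by (simp add: dist_norm norm_minus_commute)
  then have "t * norm v - s * norm u \<le> dist (s *\<^sub>R u) (t *\<^sub>R v)" using assms by simp
  moreover have "dist u (s *\<^sub>R u) = (1 - s) * norm u"
  proof -
    have "u - s *\<^sub>R u = (1 - s) *\<^sub>R u" by (simp add: scaleR_diff_left)
    then show ?thesis using assms by (simp add: dist_norm)
  qed
  moreover have "dist (t *\<^sub>R v) v = (t - 1) * norm v"
  proof -
    have "t *\<^sub>R v - v = (t - 1) *\<^sub>R v" by (simp add: scaleR_diff_left)
    then show ?thesis using assms by (simp add: dist_norm)
  qed
  moreover have "dist u v \<le> dist u (s *\<^sub>R u) + dist (s *\<^sub>R u) (t *\<^sub>R v) + dist (t *\<^sub>R v) v"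
    using dist_triangle[of u v "s *\<^sub>R u"] dist_triangle[of "s *\<^sub>R u" v "t *\<^sub>R v"] by simp
  ultimately show ?thesis using assms(1) by (simp add: algebra_simps)
qed

lemma closed_ray:
  fixes y v :: "'a :: euclidean_space"
  assumes "v \<noteq> 0"
  shows "closed ((\<lambda>t. y + t *\<^sub>R v) ` {1..})"
proof -
  have "closed ((\<lambda>t. t *\<^sub>R v) ` {1..})"
    by (rule closed_injective_linear_image)
       (use assms in \<open>auto intro!: injI bounded_linear.linear bounded_linear_scaleR_left\<close>)
  then have "closed ((+) y ` (\<lambda>t. t *\<^sub>R v) ` {1..})" by (rule closed_translation)
  then show ?thesis by (simp add: image_image)
qed

text \<open>
  The two continua are preimage components of the segment from \<open>f a\<close> to the omitted value \<open>y1\<close> and of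
  the ray from \<open>f b\<close> to infinity, pointing away from \<open>y1\<close>.
\<close>

lemma oscillation_estimate:
  fixes f :: "real ^ 'n \<Rightarrow> real ^ 'n"
  assumes n: "2 \<le> CARD('n)" and D: "open D" "open_discrete_mapping D f"
    and Q: "Q \<in> borel_measurable lebesgue"
    and fin: "\<And>K. compact K \<Longrightarrow> (\<integral>\<^sup>+ z \<in> K. Q z \<partial>lebesgue) < \<infinity>"
    and iP: "\<And>z. inverse_Poletsky D Q f z"
    and s: "0 < s" "s \<le> S" and XD: "(\<lambda>u. x0 + S *\<^sub>R u) ` unit_cube \<subseteq> D"
    and omit: "y1 \<notin> f ` (\<lambda>u. x0 + S *\<^sub>R u) ` unit_cube"
    and a: "infnorm (a - x0) \<le> s" and b: "infnorm (b - x0) \<le> s"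
    and ab: "dist (f a) y1 \<le> dist (f b) y1" "dist (f a) y1 \<le> R"
    and w: "0 < w" "w \<le> 1" "2 * w \<le> dist (f a) (f b)"
  shows "ennreal ((1 / (24 * real CARD('n) ^ 2)) ^ CARD('n) * ln (S / s))
    \<le> 4 * of_nat CARD('n) * (ennreal (1 / w ^ CARD('n)) *
         (ennreal (2 ^ Suc CARD('n) * ((11 ^ CARD('n)) ^ CARD('n) * 2 ^ CARD('n) * 11 ^ CARD('n)))
          * (\<integral>\<^sup>+ y \<in> ball y1 (R + 2). (Q y + 1) \<partial>lebesgue)))"
proof -
  define X where "X = (\<lambda>u. x0 + S *\<^sub>R u) ` (unit_cube :: (real ^ 'n) set)"
  have S: "0 < S" using s by simp
  have f: "continuous_on D f" "open_map (top_of_set D) euclidean f"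
    using D(2) by (simp_all add: open_discrete_mapping_def)
  have X: "compact X" "X \<subseteq> D" using XD by (simp_all add: X_def compact_affinity unit_cube_eq_cbox)
  have aX: "a \<in> X" and bX: "b \<in> X"
    unfolding X_def mem_cube_iff[OF S] using a b s by simp_all
  obtain \<rho> where \<rho>: "\<rho> \<in> borel_measurable borel"
    and bound: "(\<integral>\<^sup>+ x. \<rho> x ^ CARD('n) \<partial>lborel)
       \<le> ennreal (1 / w ^ CARD('n)) *
         (ennreal (2 ^ Suc CARD('n) * ((11 ^ CARD('n)) ^ CARD('n) * 2 ^ CARD('n) * 11 ^ CARD('n)))
          * (\<integral>\<^sup>+ y \<in> ball y1 (R + 2). (Q y + 1) \<partial>lebesgue))"
    and long: "\<And>(l :: real) \<gamma>. 0 \<le> l \<Longrightarrow> 1-lipschitz_on {0..l} \<gamma> \<Longrightarrow> \<gamma> ` {0..l} \<subseteq> D \<Longrightarrow>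
       f (\<gamma> 0) \<in> cball y1 R \<Longrightarrow> w \<le> dist (f (\<gamma> 0)) (f (\<gamma> l)) \<Longrightarrow>
       1 \<le> (\<integral>\<^sup>+ t \<in> {0..l}. \<rho> (\<gamma> t) \<partial>lborel)"
    by (rule long_image_density[where a = y1 and R = R, OF D(1) f(1) Q fin iP w(1,2)]) (assumption, rule that)
  define u v where "u = f a - y1" and "v = f b - y1"
  have uv: "norm u \<le> norm v" "norm u \<le> R" "2 * w \<le> dist u v"
    using ab w(3) by (simp_all add: u_def v_def dist_norm)
  have v0: "v \<noteq> 0" using omit bX unfolding v_def X_def by auto
  obtain F where F: "connected F" "a \<in> F" "F \<subseteq> X" "f ` F \<subseteq> closed_segment (f a) y1" "F \<inter> frontier X \<noteq> {}"
  proof (rule component_meets_frontier[OF D(1) f X])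
    show "\<not> closed_segment (f a) y1 \<subseteq> f ` X" using omit unfolding X_def by auto
  qed (use aX in \<open>auto intro: convex_connected\<close>)
  define \<beta> where "\<beta> = (\<lambda>t. y1 + t *\<^sub>R v) ` {1..}"
  obtain F' where F': "connected F'" "b \<in> F'" "F' \<subseteq> X" "f ` F' \<subseteq> \<beta>" "F' \<inter> frontier X \<noteq> {}"
  proof (rule component_meets_frontier[OF D(1) f X])
    show "connected \<beta>" unfolding \<beta>_def
      by (intro connected_continuous_image continuous_intros) simp
    show "closed \<beta>" unfolding \<beta>_def by (rule closed_ray[OF v0])
    show "f b \<in> \<beta>" unfolding \<beta>_def by (rule image_eqI[of _ _ 1]) (simp_all add: v_def)
    \<comment> \<open>Infinity acts as the omitted value of the ray: the image of the cube is
      bounded, the ray is not.\<close>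
    show "\<not> \<beta> \<subseteq> f ` X"
    proof
      assume sub: "\<beta> \<subseteq> f ` X"
      have "compact (f ` X)" by (rule compact_continuous_image[OF continuous_on_subset[OF f(1) X(2)] X(1)])
      then have "bounded \<beta>" using sub bounded_subset compact_imp_bounded by blast
      then obtain B where B: "\<And>y. y \<in> \<beta> \<Longrightarrow> dist y1 y \<le> B"
        unfolding bounded_any_center[where a = y1] by blast
      define t where "t = max 1 ((B + 1) / norm v)"
      have "y1 + t *\<^sub>R v \<in> \<beta>" unfolding \<beta>_def by (rule imageI) (simp add: t_def)
      from B[OF this] have "\<bar>t\<bar> * norm v \<le> B" by (simp add: dist_norm)
      moreover have "B + 1 \<le> t * norm v"
        using v0 mult_right_mono[of "(B + 1) / norm v" t "norm v"] by (simp add: t_def)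
      moreover have "1 \<le> t" by (simp add: t_def)
      ultimately show False by simp
    qed
  qed (use bX in auto)
  have "ennreal ((1 / (24 * real CARD('n) ^ 2)) ^ CARD('n) * ln (S / s))
      \<le> 4 * of_nat CARD('n) * (\<integral>\<^sup>+ x. \<rho> x ^ CARD('n) \<partial>lborel)"
  proof (rule modulus_lower_bound[OF \<rho> n s, of x0 F F'])
    show "\<exists>a\<in>unit_cube. (\<exists>i. \<bar>a $ i\<bar> = 1) \<and> x0 + r *\<^sub>R a \<in> F" if "s \<le> r" "r \<le> S" for r
      by (rule continuum_meets_cubes[OF F(1,2) a s(1) F(5)[unfolded X_def] that])
    show "\<exists>a\<in>unit_cube. (\<exists>i. \<bar>a $ i\<bar> = 1) \<and> x0 + r *\<^sub>R a \<in> F'" if "s \<le> r" "r \<le> S" for r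
      by (rule continuum_meets_cubes[OF F'(1,2) b s(1) F'(5)[unfolded X_def] that])
    fix p q V r
    assume r: "s \<le> r" "r \<le> S" and pq: "p \<in> F" "q \<in> F'"
      and "reach \<rho> ((\<lambda>u. x0 + r *\<^sub>R u) ` unit_cube) p q V"
    then obtain l :: real and \<gamma> where \<gamma>: "0 \<le> l" "1-lipschitz_on {0..l} \<gamma>" "\<gamma> 0 = p" "\<gamma> l = q"
      "\<gamma> ` {0..l} \<subseteq> (\<lambda>u. x0 + r *\<^sub>R u) ` unit_cube" "(\<integral>\<^sup>+ t \<in> {0..l}. \<rho> (\<gamma> t) \<partial>lborel) \<le> V"
      by (elim reachE)
    have r0: "0 < r" using r s by simp
    have "(\<lambda>u. x0 + r *\<^sub>R u) ` unit_cube \<subseteq> X"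
      unfolding X_def subset_iff mem_cube_iff[OF S] mem_cube_iff[OF r0] using r(2) by auto
    then have im: "\<gamma> ` {0..l} \<subseteq> D" using \<gamma>(5) X(2) by blast
    have "f p \<in> closed_segment (f a) y1" using F(4) pq(1) by blast
    then obtain \<sigma> where \<sigma>: "0 \<le> \<sigma>" "\<sigma> \<le> 1" "f p = (1 - \<sigma>) *\<^sub>R f a + \<sigma> *\<^sub>R y1"
      unfolding in_segment by metis
    have fp: "f p = y1 + (1 - \<sigma>) *\<^sub>R u" unfolding \<sigma>(3) u_def by (simp add: algebra_simps)
    have "f q \<in> \<beta>" using F'(4) pq(2) by blast
    then obtain t where t: "1 \<le> t" "f q = y1 + t *\<^sub>R v" unfolding \<beta>_def by auto
    \<comment> \<open>Here it matters that \<open>f a\<close> is not farther from \<open>y1\<close>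
      than \<open>f b\<close>. The factor 2 is the reason for assuming a separation of
      \<open>2 * w\<close>.\<close>
    have "dist u v \<le> 2 * dist ((1 - \<sigma>) *\<^sub>R u) (t *\<^sub>R v)"
      by (rule dist_segment_ray) (use uv(1) \<sigma> t in auto)
    then have "w \<le> dist (f p) (f q)" using uv(3) by (simp add: fp t(2))
    \<comment> \<open>The whole segment stays within \<open>R\<close> of \<open>y1\<close>, so
      \<open>long\<close> applies to curves starting on \<open>F\<close>, however far out the ray
      runs.\<close>
    moreover have "dist y1 (f p) \<le> R"
    proof -
      have "(1 - \<sigma>) * norm u \<le> norm u" using \<sigma> by (intro mult_left_le_one_le) auto
      then show ?thesis using uv(2) \<sigma>(1,2) by (simp add: fp dist_norm)
    qed
    ultimately have "1 \<le> (\<integral>\<^sup>+ t \<in> {0..l}. \<rho> (\<gamma> t) \<partial>lborel)"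
      using \<gamma>(3,4) by (intro long[OF \<gamma>(1,2) im]) simp_all
    then show "1 \<le> V" using \<gamma>(6) by (rule order_trans)
  qed
  also have "\<dots> \<le> 4 * of_nat CARD('n) * (ennreal (1 / w ^ CARD('n)) *
         (ennreal (2 ^ Suc CARD('n) * ((11 ^ CARD('n)) ^ CARD('n) * 2 ^ CARD('n) * 11 ^ CARD('n)))
          * (\<integral>\<^sup>+ y \<in> ball y1 (R + 2). (Q y + 1) \<partial>lebesgue)))"
    by (rule mult_left_mono[OF bound]) simp
  finally show ?thesis .
qed

section \<open>The chordal metric and the conclusion\<close>

lemma chordal_dist_le_dist: "chordal_dist (Some x) (Some y) \<le> dist x y"
proof -
  have "1 * 1 \<le> sqrt (1 + (norm x)\<^sup>2) * sqrt (1 + (norm y)\<^sup>2)"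
    by (rule mult_mono) auto
  then have "norm (x - y) / (sqrt (1 + (norm x)\<^sup>2) * sqrt (1 + (norm y)\<^sup>2)) \<le> norm (x - y) / 1"
    by (intro divide_left_mono) auto
  then show ?thesis by (simp add: dist_norm)
qed

lemma chordal_dist_commute: "chordal_dist (Some x) (Some y) = chordal_dist (Some y) (Some x)"
  by (simp add: norm_minus_commute mult.commute)

text \<open>The chordal distance of nonzero points is at most
  \<open>1 / norm x + 1 / norm y\<close>. Hence one of two separated values is bounded, which fixes
  the region where \<open>Q\<close> is integrated independently of the map.\<close>

lemma norm_le_of_chordal_dist_ge:
  assumes "0 < \<epsilon>" "\<epsilon> \<le> chordal_dist (Some x) (Some y)"
  shows "norm x \<le> 2 / \<epsilon> \<or> norm y \<le> 2 / \<epsilon>"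
proof (rule ccontr)
  assume "\<not> ?thesis"
  then have big: "2 / \<epsilon> < norm x" "2 / \<epsilon> < norm y" by auto
  have pos: "0 < norm x" "0 < norm y" using big assms(1) by (smt (verit) divide_pos_pos)+
  have "norm (x - y) / (sqrt (1 + (norm x)\<^sup>2) * sqrt (1 + (norm y)\<^sup>2))
      \<le> (norm x + norm y) / (norm x * norm y)"
  proof (rule frac_le)
    show "norm x * norm y \<le> sqrt (1 + (norm x)\<^sup>2) * sqrt (1 + (norm y)\<^sup>2)"
      by (rule mult_mono) (auto intro: real_le_rsqrt)
  qed (use pos norm_triangle_ineq4 in auto)
  also have "\<dots> = 1 / norm x + 1 / norm y" using pos by (simp add: field_simps)
  also have "\<dots> < \<epsilon> / 2 + \<epsilon> / 2"
  proof (rule add_strict_mono)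
    show "1 / norm x < \<epsilon> / 2" "1 / norm y < \<epsilon> / 2"
      using big pos assms(1) by (simp_all add: field_simps)
  qed
  finally show False using assms(2) by simp
qed

theorem corollary1p2:
  fixes D :: "(real ^ 'n) set"
    and Q :: "real ^ 'n \<Rightarrow> ennreal"
    and \<RR> :: "(real ^ 'n \<Rightarrow> real ^ 'n) set"
    and x0 y0 :: "real ^ 'n"
    and r0 :: real
    and y :: "nat \<Rightarrow> real ^ 'n"
  assumes "2 \<le> CARD('n)"
    and "open D" and "connected D" and "D \<noteq> {}"
    and "Q \<in> borel_measurable lebesgue"
    and "\<And>K. compact K \<Longrightarrow> (\<integral>\<^sup>+ z \<in> K. Q z \<partial>lebesgue) < \<infinity>"
    and "\<And>f. f \<in> \<RR> \<Longrightarrow> open_discrete_mapping D f"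
    and "\<And>f z. f \<in> \<RR> \<Longrightarrow> inverse_Poletsky D Q f z"
    and "x0 \<in> D"
    and "Some y0 \<in> limit_set D x0 \<RR>"
    and "0 < r0"
    and "\<And>m. y m \<in> ball y0 r0" and "\<And>m. y m \<noteq> y0" and "y \<longlonglongrightarrow> y0"
    and "\<And>m. \<exists>C>0. ennreal C \<le> ext_dist x0 {x \<in> D. \<exists>f\<in>\<RR>. f x = y m}"
  shows "equicontinuous_at D x0 ((\<lambda>f. Some \<circ> f) ` \<RR>)"
proof -
  let ?n = "CARD('n)"
  obtain C where C: "0 < C" "ennreal C \<le> ext_dist x0 {x \<in> D. \<exists>f\<in>\<RR>. f x = y 0}"
    using assms(15)[of 0] by (elim exE conjE)
  obtain d where d: "0 < d" "ball x0 d \<subseteq> D"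
    using \<open>open D\<close> \<open>x0 \<in> D\<close> by (metis open_contains_ball)
  \<comment> \<open>The cube of half-width \<open>S\<close> lies within \<open>n * S\<close> of its
    centre, that is within \<open>min C d / 2\<close> of \<open>x0\<close>: inside \<open>D\<close>
    and away from all points where some map takes the value \<open>y 0\<close>.\<close>
  define S where "S = min C d / (2 * real ?n)"
  have S: "0 < S" using C(1) d(1) by (simp add: S_def)
  define X where "X = (\<lambda>u. x0 + S *\<^sub>R u) ` (unit_cube :: (real ^ 'n) set)"
  have near: "dist x0 x < min C d" if x: "x \<in> X" for x
  proof -
    obtain u where u: "u \<in> unit_cube" "x = x0 + S *\<^sub>R u" using x by (auto simp: X_def)
    have "norm u \<le> (\<Sum>j\<in>UNIV. \<bar>u $ j\<bar>)" by (rule norm_le_l1_cart)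
    also have "\<dots> \<le> (\<Sum>j\<in>(UNIV :: 'n set). 1)"
      using u(1) by (intro sum_mono) (simp add: unit_cube_def)
    finally have "S * norm u \<le> S * real ?n" using S by (intro mult_left_mono) auto
    also have "\<dots> = min C d / 2" by (simp add: S_def)
    also have "\<dots> < min C d" using C(1) d(1) by (cases "C \<le> d") (simp_all add: min_def)
    finally show ?thesis using u(2) S by (simp add: dist_norm)
  qed
  have XD: "X \<subseteq> D" using near d(2) by auto
  have omit: "y 0 \<notin> f ` X" if "f \<in> \<RR>" for f
  proof
    assume "y 0 \<in> f ` X"
    then obtain x where x: "x \<in> X" "f x = y 0" by auto
    then have "x \<in> {x \<in> D. \<exists>f\<in>\<RR>. f x = y 0}" using XD that by auto
    then have "ext_dist x0 {x \<in> D. \<exists>f\<in>\<RR>. f x = y 0} \<le> ennreal (dist x0 x)"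
      unfolding ext_dist_def by (rule INF_lower)
    with C(2) have "ennreal C \<le> ennreal (dist x0 x)" by (rule order_trans)
    then show False using near[OF x(1)] by simp
  qed
  show ?thesis
    unfolding equicontinuous_at_def
  proof (intro allI impI)
    fix \<epsilon> :: real assume \<epsilon>: "0 < \<epsilon>"
    \<comment> \<open>Whichever of the two separated values has norm at most
      \<open>2 / \<epsilon>\<close>, the one closer to \<open>y 0\<close> is then within
      \<open>R\<close> of \<open>y 0\<close>.\<close>
    define R where "R = 2 / \<epsilon> + norm (y 0)"
    define w where "w = min 1 (\<epsilon> / 2)"
    have w: "0 < w" "w \<le> 1" "2 * w \<le> \<epsilon>" using \<epsilon> by (auto simp: w_def)
    define \<kappa> where "\<kappa> = (1 / (24 * real ?n ^ 2)) ^ ?n"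
    have \<kappa>: "0 < \<kappa>" by (simp add: \<kappa>_def)
    define B where "B = 4 * of_nat ?n * (ennreal (1 / w ^ ?n) *
         (ennreal (2 ^ Suc ?n * ((11 ^ ?n) ^ ?n * 2 ^ ?n * 11 ^ ?n))
          * (\<integral>\<^sup>+ z \<in> ball (y 0) (R + 2). (Q z + 1) \<partial>lebesgue)))"
    have "B < top"
      using ball_integral_add_one_finite[OF assms(5,6), of "y 0" "R + 2"]
      unfolding B_def by (intro ennreal_mult_less_top[THEN iffD2] disjI2 conjI) (auto simp: ennreal_mult_less_top of_nat_less_top)
    then obtain M where M: "B = ennreal M" "0 \<le> M" by (cases B) auto
    \<comment> \<open>Solves \<open>\<kappa> * ln (S / \<delta>) = M + 1\<close>, just beyond the
      bound \<open>M\<close>, which depends on \<open>\<epsilon>\<close> but not on the map.\<close>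
    define \<delta> where "\<delta> = S * exp (- ((M + 1) / \<kappa>))"
    have \<delta>: "0 < \<delta>" "\<delta> \<le> S" using S \<kappa> M(2) by (simp_all add: \<delta>_def mult_left_le)
    have key: False
      if f: "f \<in> \<RR>" and ab: "infnorm (a - x0) \<le> \<delta>" "infnorm (b - x0) \<le> \<delta>"
        "dist (f a) (y 0) \<le> dist (f b) (y 0)" and far: "\<epsilon> \<le> chordal_dist (Some (f a)) (Some (f b))" for f a b
    proof -
      have "dist (f a) (y 0) \<le> R"
        using norm_le_of_chordal_dist_ge[OF \<epsilon> far]
      proof
        assume "norm (f a) \<le> 2 / \<epsilon>"
        then show ?thesis unfolding R_def dist_norm using norm_triangle_ineq4[of "f a" "y 0"] by linarith
      next
        assume "norm (f b) \<le> 2 / \<epsilon>"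
        then show ?thesis using ab(3) unfolding R_def dist_norm
          using norm_triangle_ineq4[of "f b" "y 0"] by linarith
      qed
      moreover have "2 * w \<le> dist (f a) (f b)"
        using w(3) far chordal_dist_le_dist[of "f a" "f b"] by linarith
      ultimately have "ennreal (\<kappa> * ln (S / \<delta>)) \<le> B"
        unfolding B_def \<kappa>_def
        using oscillation_estimate[OF assms(1,2) assms(7)[OF f] assms(5,6) assms(8)[OF f] \<delta>
            XD[unfolded X_def] omit[OF f, unfolded X_def] ab _ w(1,2)] by simp
      moreover have "\<kappa> * ln (S / \<delta>) = M + 1"
      proof -
        have "S / \<delta> = exp ((M + 1) / \<kappa>)" using S by (simp add: \<delta>_def exp_minus divide_inverse)
        then show ?thesis using \<kappa> by simp
      qed
      ultimately have "ennreal (M + 1) \<le> ennreal M" using M(1) by simp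
      then show False using M(2) by (subst (asm) ennreal_le_iff) auto
    qed
    have "chordal_dist (Some (f x)) (Some (f x0)) < \<epsilon>" if f: "f \<in> \<RR>" and x: "dist x x0 < \<delta>" for f x
    proof (rule ccontr)
      assume "\<not> ?thesis"
      then have far: "\<epsilon> \<le> chordal_dist (Some (f x)) (Some (f x0))" by simp
      have 1: "infnorm (x - x0) \<le> \<delta>" using infnorm_le_norm[of "x - x0"] x by (simp add: dist_norm)
      have 2: "infnorm (x0 - x0) \<le> \<delta>" using \<delta>(1) by (simp add: infnorm_0)
      show False
      \<comment> \<open>The estimate is asymmetric: the point whose image is closer to
        \<open>y 0\<close>, be it \<open>x\<close> or \<open>x0\<close>, takes the role of
        \<open>a\<close>.\<close>
      proof (cases "dist (f x) (y 0) \<le> dist (f x0) (y 0)")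
        case True
        then show False by (rule key[OF f 1 2 _ far])
      next
        case False
        then have "dist (f x0) (y 0) \<le> dist (f x) (y 0)" by simp
        then show False using far by (intro key[OF f 2 1]) (simp_all only: chordal_dist_commute)
      qed
    qed
    then show "\<exists>\<delta>>0. \<forall>g\<in>(\<lambda>f. Some \<circ> f) ` \<RR>. \<forall>x\<in>D. dist x x0 < \<delta> \<longrightarrow> chordal_dist (g x) (g x0) < \<epsilon>"
      using \<delta>(1) by (intro exI[of _ \<delta>]) (simp del: chordal_dist.simps)
  qed
qed

end
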